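(* Fix $d\ge2$. Consider the traveling salesman problem with $n$ i.i.d. input points $\mathbf X^n=(X_{n,1},\dots,X_{n,n})$ from a probability measure $\mathcal P$ on $\mathbb R^d$: minimize $\sum_{\{i,j\}\in E(G)}\|X_{n,i}-X_{n,j}\|_2$ over $G\in\mathcal G_n$, where $\mathcal G_n$ is the collection of all Hamiltonian cycles on the vertex set $[n]$. Assume: 1. $\mathcal P$ has a density $f$ with respect to Lebesgue measure on $\mathbb R^d$ which is bounded and almost everywhere continuous, and $\mathbb E_{\mathcal P}\|X\|_2<\infty$; 2. $\displaystyle\mathbb E\Bigl[\inf_{G\in\mathcal G_n}\sum_{\{i,j\}\in E(G)}\|X_{n,i}-X_{n,j}\|_2\Bigr]=O\bigl(n^{(d-1)/d}\bigr)$ as $n\to\infty$; 3. $\mathcal P$ satisfies either the Langevin assumption of the context for a pair $(\rho,g)$ with $\nabla g\ne0$ almost everywhere, or the rejection assumption of the context; 4. with $A_k$ the annular shell in $\mathbb R^d$ centred at $\mathbf 0$ with inner radius $2^k$ and outer radius $2^{k+1}$, and $a_{k,1}(f)=2^{kd/(d-1)}\int_{A_k}f(x)\,dx$ for $k\ge0$, one has $\sum_{k\ge0}(a_{k,1}(f))^{(d-1)/d}<\infty$. Then this traveling salesman problem is stable under small perturbations with perturbation blocks $\mathcal J_n=\{J_{n,i}:i\in[n]\}$, where $J_{n,i}=\{i\}$ for all $i\in[n]$.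
   Context: $[n]=\{1,\dots,n\}$; $E(G)$ is the edge set of $G$. The metric on $\mathcal G_n$ is $d_n(G_1,G_2)=\frac1n\operatorname{card}(E(G_1)\,\Delta\,E(G_2))$. The minimizer is almost surely unique, denoted $\widehat G_n(\mathbf X^n)$. The input index set is $I_n=[n]$. Stability. $\mathcal J_n=\{J_{n,l}:l\in\mathcal L_n\}$ is a finite family of subsets of $I_n$ with union $I_n$; $m_n=\operatorname{card}(\mathcal L_n)$. For each $l$, $\mathbf X^{n,l}$ is an independent copy of $\mathbf X^n$ (no further assumption on the joint law over $l$), and $\mathbf X^n_l$ is $\mathbf X^n$ with the coordinates in $J_{n,l}$ replaced by those of $\mathbf X^{n,l}$. For a metric $\mathsf d$, $P(T,\mathsf d,\varepsilon)$ is the largest cardinality of a subset of $T$ with pairwise distances $>\varepsilon$. With $\mathcal O_{n,A}=\{\widehat G_n(\mathbf X^n_l):l\in A\}$, the sequence is stable under small perturbations with perturbation blocks $\mathcal J_n$ if for any $\varepsilon,\delta>0$ there is $M(\varepsilon,\delta)<\infty$ with $\limsup_{n\to\infty}\mathbb P[\min_{A\subseteq\mathcal L_n:|A|>(1-\varepsilon)m_n}P(\mathcal O_{n,A},d_n,\varepsilon)\ge M(\varepsilon,\delta)]\le\delta$. Sub-Gamma: an integrable real $X$ is in $\mathscr G(\sigma^2,c)$ if $\log\mathbb E\exp[\lambda(X-\mathbb EX)]\le\lambda^2\sigma^2/(2(1-c|\lambda|))$ for all $|\lambda|<1/c$ (all $\lambda$ if $c=0$); $\mathscr G(\sigma^2,c;p)$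 is the class of $p$-dimensional random vectors all of whose coordinates are in $\mathscr G(\sigma^2,c)$. Langevin assumption on $\mathcal P$ for the pair $(\rho,g)$: there is $p\in\mathbb N$ with $\rho:\mathbb R^p\to\mathbb R$, $g:\mathbb R^p\to\mathbb R^d$ such that (1) $\exp(-\rho)$ is integrable on $\mathbb R^p$; (2) $\rho$ is Lebesgue-almost everywhere differentiable and $\nabla\rho$ is Lipschitz, or (2)$'$ $\rho$ is twice continuously differentiable and $\|\nabla\rho\|_2^2-\frac12\Delta\rho$ is bounded below ($\Delta$ here the Laplacian), or (2)$''$ $\rho$ is twice continuously differentiable and there are $a,b\in\mathbb R$ with $x\cdot\nabla\rho(x)\ge-a\|x\|_2^2-b$ for all $x$ (any one suffices); (3) if $Y$ has density proportional to $\exp(-\rho)$, then $\nabla\rho(Y)\in\mathscr G(\sigma^2,c;p)$ for some $\sigma^2>0$, $c\ge0$; (4) $g$ has uniformly bounded first and second order derivatives and $g(Y)\sim\mathcal P$ for $Y$ as in (3). $\nabla g$ is the $d\times p$ Jacobian matrix. Rejection assumption: for $X\sim\mathcal P$ and $W\sim N_d(\mathbf 0,I_d)$ independent and any $r,s\ge0$, $\mathbb E\bigl[\|W\|_2^r\bigl(1-f(X+sW)/f(X)\bigr)_+\bigr]\le C(f,r)\,s$, with $C(f,r)$ a finite positive constant depending only on $f$ and $r$. *)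

theory Defs
  imports "HOL-Probability.Probability" "HOL-Library.Landau_Symbols"
begin

text \<open>
  All graphs have vertex set \<open>{1..n}\<close>, so a graph is represented by its edge set, a set of
  two-element sets. A cycle of a simple graph has at least three vertices, so there are no
  Hamiltonian cycles for \<open>n \<le> 2\<close>.
\<close>

definition hamiltonian_cycles :: "nat \<Rightarrow> nat set set set" where
  "hamiltonian_cycles n =
     {{{vs ! i, vs ! (Suc i mod n)} |i. i < n} |vs.
        n \<ge> 3 \<and> length vs = n \<and> distinct vs \<and> set vs = {1..n}}"

text \<open>Each undirected edge is counted once, through its increasing enumeration.\<close>

definition tour_length :: "(nat \<Rightarrow> 'v::real_normed_vector) \<Rightarrow> nat set set \<Rightarrow> real" where
  "tour_length x G = (\<Sum>(i, j) \<in> {(i, j). i < j \<and> {i, j} \<in> G}. norm (x i - x j))"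

text \<open>
  Where the minimizer is not unique, \<^const>\<open>arg_min_on\<close> makes a choice that depends on \<open>x\<close> only
  through the set of minimizers, so this is a measurable function of \<open>x\<close>.
\<close>

definition optimal_tour :: "nat \<Rightarrow> (nat \<Rightarrow> 'v::real_normed_vector) \<Rightarrow> nat set set" where
  "optimal_tour n x = arg_min_on (tour_length x) (hamiltonian_cycles n)"

definition graph_dist :: "nat \<Rightarrow> nat set set \<Rightarrow> nat set set \<Rightarrow> real" where
  "graph_dist n G1 G2 = real (card ((G1 - G2) \<union> (G2 - G1))) / real n"

definition packing_number :: "'g set \<Rightarrow> ('g \<Rightarrow> 'g \<Rightarrow> real) \<Rightarrow> real \<Rightarrow> enat" where
  "packing_number T dst \<epsilon> =
     (SUP S \<in> {S. S \<subseteq> T \<and> finite S \<and> pairwise (\<lambda>x y. dst x y > \<epsilon>) S}. enat (card S))"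

definition independent_copy ::
  "'a measure \<Rightarrow> 'i set \<Rightarrow> ('i \<Rightarrow> 'a \<Rightarrow> 'v::topological_space) \<Rightarrow> ('i \<Rightarrow> 'a \<Rightarrow> 'v) \<Rightarrow> bool" where
  "independent_copy M I X Y \<longleftrightarrow>
     prob_space.indep_var M
       (PiM I (\<lambda>_. borel)) (\<lambda>\<omega>. \<lambda>i\<in>I. X i \<omega>)
       (PiM I (\<lambda>_. borel)) (\<lambda>\<omega>. \<lambda>i\<in>I. Y i \<omega>) \<and>
     distr M (PiM I (\<lambda>_. borel)) (\<lambda>\<omega>. \<lambda>i\<in>I. Y i \<omega>) =
     distr M (PiM I (\<lambda>_. borel)) (\<lambda>\<omega>. \<lambda>i\<in>I. X i \<omega>)"

text \<open>
  For every \<open>n\<close>, the input is \<open>(X n i)\<^sub>i\<close>, \<open>i \<in> I n\<close>, on the probability space \<open>M n\<close>; \<open>Y n l\<close> is the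
  independent copy used for the block \<open>J n l\<close>, \<open>l \<in> L n\<close>; \<open>Ghat n\<close> maps an input to the minimizer;
  \<open>dst n\<close> is the metric on the \<open>n\<close>-th solution space. The infimum over \<open>A\<close> is a minimum, because
  \<^typ>\<open>enat\<close> is well-ordered.
\<close>

definition stable_under_small_perturbations ::
  "(nat \<Rightarrow> 'a measure) \<Rightarrow> (nat \<Rightarrow> 'i set) \<Rightarrow> (nat \<Rightarrow> 'i \<Rightarrow> 'a \<Rightarrow> 'v) \<Rightarrow>
   (nat \<Rightarrow> 'l set) \<Rightarrow> (nat \<Rightarrow> 'l \<Rightarrow> 'i set) \<Rightarrow> (nat \<Rightarrow> 'l \<Rightarrow> 'i \<Rightarrow> 'a \<Rightarrow> 'v) \<Rightarrow>
   (nat \<Rightarrow> ('i \<Rightarrow> 'v) \<Rightarrow> 'g) \<Rightarrow> (nat \<Rightarrow> 'g \<Rightarrow> 'g \<Rightarrow> real) \<Rightarrow> bool" where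
  "stable_under_small_perturbations M I X L J Y Ghat dst \<longleftrightarrow>
     (\<forall>n. finite (L n) \<and> (\<Union>l\<in>L n. J n l) = I n) \<and>
     (\<forall>\<epsilon>>0. \<forall>\<delta>>0. \<exists>K::nat.
        limsup (\<lambda>n. ereal (measure (M n)
          {\<omega> \<in> space (M n).
             (INF A \<in> {A. A \<subseteq> L n \<and> real (card A) > (1 - \<epsilon>) * real (card (L n))}.
                packing_number
                  ((\<lambda>l. Ghat n (override_on (\<lambda>i. X n i \<omega>) (\<lambda>i. Y n l i \<omega>) (J n l))) ` A)
                  (dst n) \<epsilon>)
             \<ge> enat K}))
        \<le> ereal \<delta>)"

text \<open>
  \<open>v\<close> stands for the variance factor. For \<open>c > 0\<close> the condition \<open>c * \<bar>t\<bar> < 1\<close> means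
  \<open>\<bar>t\<bar> < 1 / c\<close>, and for \<open>c = 0\<close> it holds for all \<open>t\<close>.
\<close>

definition sub_gamma :: "'a measure \<Rightarrow> real \<Rightarrow> real \<Rightarrow> ('a \<Rightarrow> real) \<Rightarrow> bool" where
  "sub_gamma M v c X \<longleftrightarrow>
     integrable M X \<and>
     (\<forall>t. c * \<bar>t\<bar> < 1 \<longrightarrow>
        integrable M (\<lambda>\<omega>. exp (t * (X \<omega> - (\<integral>\<omega>'. X \<omega>' \<partial>M)))) \<and>
        ln (\<integral>\<omega>. exp (t * (X \<omega> - (\<integral>\<omega>'. X \<omega>' \<partial>M))) \<partial>M) \<le> t\<^sup>2 * v / (2 * (1 - c * \<bar>t\<bar>)))"

definition sub_gamma_vec :: "'a measure \<Rightarrow> real \<Rightarrow> real \<Rightarrow> ('a \<Rightarrow> real ^ 'p) \<Rightarrow> bool" where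
  "sub_gamma_vec M v c Z \<longleftrightarrow> (\<forall>i. sub_gamma M v c (\<lambda>\<omega>. Z \<omega> $ i))"

text \<open>The values of the following operators are meaningful only where the derivatives exist.\<close>

definition gradient :: "(real ^ 'p \<Rightarrow> real) \<Rightarrow> real ^ 'p \<Rightarrow> real ^ 'p" where
  "gradient \<rho> y = (THE D. GDERIV \<rho> y :> D)"

definition hessian :: "(real ^ 'p \<Rightarrow> real) \<Rightarrow> real ^ 'p \<Rightarrow> real ^ 'p ^ 'p" where
  "hessian \<rho> y = jacobian (gradient \<rho>) (at y)"

definition laplacian :: "(real ^ 'p \<Rightarrow> real) \<Rightarrow> real ^ 'p \<Rightarrow> real" where
  "laplacian \<rho> y = trace (hessian \<rho> y)"

definition twice_differentiable :: "(real ^ 'p \<Rightarrow> real) \<Rightarrow> bool" where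
  "twice_differentiable \<rho> \<longleftrightarrow>
     (\<forall>y. \<rho> differentiable (at y)) \<and> (\<forall>y. gradient \<rho> differentiable (at y))"

definition twice_continuously_differentiable :: "(real ^ 'p \<Rightarrow> real) \<Rightarrow> bool" where
  "twice_continuously_differentiable \<rho> \<longleftrightarrow>
     twice_differentiable \<rho> \<and> continuous_on UNIV (hessian \<rho>)"

text \<open>
  The law with density proportional to \<open>exp (- \<rho>)\<close>. It lives on the Lebesgue \<open>\<sigma>\<close>-algebra because
  \<^term>\<open>gradient \<rho>\<close> may be determined only almost everywhere, which is enough for measurability
  with respect to the completed measure.
\<close>

definition gibbs_measure :: "(real ^ 'p \<Rightarrow> real) \<Rightarrow> (real ^ 'p) measure" where
  "gibbs_measure \<rho> =
     density lebesgue (\<lambda>y. ennreal (exp (- \<rho> y) / (\<integral>z. exp (- \<rho> z) \<partial>lebesgue)))"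

definition langevin_assumption ::
  "(real ^ 'd) measure \<Rightarrow> (real ^ 'p \<Rightarrow> real) \<Rightarrow> (real ^ 'p \<Rightarrow> real ^ 'd) \<Rightarrow> bool" where
  "langevin_assumption P \<rho> g \<longleftrightarrow>
     integrable lebesgue (\<lambda>y. exp (- \<rho> y)) \<and>
     ((AE y in lebesgue. \<rho> differentiable (at y)) \<and>
        (\<exists>C. C-lipschitz_on {y. \<rho> differentiable (at y)} (gradient \<rho>))
      \<or> twice_continuously_differentiable \<rho> \<and>
        (\<exists>B. \<forall>y. (norm (gradient \<rho> y))\<^sup>2 - laplacian \<rho> y / 2 \<ge> B)
      \<or> twice_continuously_differentiable \<rho> \<and>
        (\<exists>a b. \<forall>y. y \<bullet> gradient \<rho> y \<ge> - a * (norm y)\<^sup>2 - b)) \<and>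
     (\<exists>v>0. \<exists>c\<ge>0. sub_gamma_vec (gibbs_measure \<rho>) v c (gradient \<rho>)) \<and>
     (\<forall>k. twice_differentiable (\<lambda>y. g y $ k) \<and>
          bounded (range (gradient (\<lambda>y. g y $ k))) \<and>
          bounded (range (hessian (\<lambda>y. g y $ k)))) \<and>
     distr (gibbs_measure \<rho>) borel g = P"

definition standard_gaussian :: "(real ^ 'd) measure" where
  "standard_gaussian = density lborel (\<lambda>w. ennreal (\<Prod>i\<in>UNIV. std_normal_density (w $ i)))"

text \<open>
  The pair of independent variables \<open>(X, W)\<close> is realized on the product space. The two degenerate
  conventions of the formula, \<open>f x = 0\<close> and \<open>0 powr 0 = 0\<close>, concern null sets only.
\<close>

definition rejection_assumption ::
  "(real ^ 'd) measure \<Rightarrow> (real ^ 'd \<Rightarrow> real) \<Rightarrow> bool" where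
  "rejection_assumption P f \<longleftrightarrow>
     (\<forall>r\<ge>0. \<exists>C>0. \<forall>s\<ge>0.
        (\<integral>(x, w). norm w powr r * max 0 (1 - f (x + s *\<^sub>R w) / f x)
           \<partial>(P \<Otimes>\<^sub>M standard_gaussian)) \<le> C * s)"

definition shell :: "nat \<Rightarrow> (real ^ 'd) set" where
  "shell k = {x. 2 ^ k \<le> norm x \<and> norm x < 2 ^ (k + 1)}"

definition shell_weight :: "(real ^ 'd \<Rightarrow> real) \<Rightarrow> nat \<Rightarrow> real" where
  "shell_weight f k =
     2 powr (real k * real CARD('d) / (real CARD('d) - 1)) * (LINT x:shell k|lborel. f x)"

end

theory Submission
  imports Defs
begin

text \<open>
  Suppose that there were many near-optimal tours whose edge sets are pairwise far apart. A small
  random perturbation of all points changes their lengths by amounts that behave like well separated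
  random variables, so by a Sudakov-type minoration the best of these tours becomes shorter than the
  old optimum by an arbitrarily large multiple of \<open>n\<^bsup>-1/d\<^esup>\<close>. This is impossible if the
  perturbation preserves the law of the points. Such a perturbation is a Metropolis step: a point moves
  by \<open>\<plusminus> s \<theta>\<close> with \<open>s = n\<^bsup>-1/2 - 1/d\<^esup>\<close>, but only inside the part of its law that lies below a
  compactly supported Lipschitz function \<open>h \<le> f\<close>. The remaining mass \<open>\<integral> (f - h)\<close> is arbitrarily small
  because \<open>f\<close> is almost everywhere continuous, and the rejection probability is of order \<open>s\<close>. The
  first order effect on the length of a tour is a Rademacher sum, and two tours that differ in many
  edges have well separated coefficients, because coincidences between the directions to four nearby
  points are rare. The second order effect is bounded by the sum of the inverse distances of nearby
  points.

  The optimal tour for the points with one point resampled becomes a near-optimal tour for the original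
  points after moving one vertex, at a cost bounded by two nearest neighbour distances; the sum of
  these distances over all vertices is at most the length of the optimal tour.
\<close>

section \<open>Sign averages and a Sudakov minoration\<close>

text \<open>The obstacle is precision. The optimal length is of order n \<alpha> with \<alpha> =
  n^(-1/d), while the gain to be exploited is a multiple of \<alpha>. So the perturbed points must
  have exactly the old law: only then do the two expected optimal lengths cancel and leave a usable
  inequality. The step size s = \<alpha> / sqrt n balances the effects. The coefficients of the
  Rademacher sums are of order one, so the first order gain is s sqrt n \<Lambda> = \<alpha>
  \<Lambda> with \<Lambda> at will. The second order error is s^2 times n / \<alpha> up to a
  constant, that is, of order \<alpha>. Order n s rejections cost at most 2 s each, in total of
  order \<alpha>^2. A large constant \<Lambda> therefore wins, and the number K of tours that the
  minoration asks for depends on \<Lambda> but not on n. The tour that becomes shortest depends on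
  the signs, so the error bounds have to be uniform over all tours. The slack granted to
  near-optimal tours is again a multiple of \<alpha>, because nearest neighbour distances are on
  average at most of that order.\<close>

definition signs :: "'i set \<Rightarrow> ('i \<Rightarrow> real) set" where
  "signs I = (\<Pi>\<^sub>E i\<in>I. {-1, 1})"

text \<open>A finite sum instead of an integral keeps the Rademacher estimates free of
  measurability; \<open>nn_integral_steps\<close> later reads it as an average over a uniform
  measure on the signs.\<close>

definition sign_average :: "'i set \<Rightarrow> (('i \<Rightarrow> real) \<Rightarrow> real) \<Rightarrow> real" where
  "sign_average I F = (\<Sum>\<xi>\<in>signs I. F \<xi>) / 2 ^ card I"

lemma finite_signs: "finite I \<Longrightarrow> finite (signs I)"
  unfolding signs_def by (intro finite_PiE) auto

lemma card_signs: "finite I \<Longrightarrow> card (signs I) = 2 ^ card I"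
  unfolding signs_def by (subst card_PiE) (auto simp: numeral_2_eq_2)

lemma signs_sq: "\<xi> \<in> signs I \<Longrightarrow> i \<in> I \<Longrightarrow> \<xi> i * \<xi> i = 1"
  unfolding signs_def by (auto simp: PiE_iff)

lemma abs_signs: "\<xi> \<in> signs I \<Longrightarrow> i \<in> I \<Longrightarrow> \<bar>\<xi> i\<bar> = 1"
  unfolding signs_def by (auto simp: PiE_iff)

lemma sum_signs_prod:
  fixes g :: "'i \<Rightarrow> real \<Rightarrow> 'b::comm_semiring_1"
  assumes "finite I"
  shows "(\<Sum>\<xi>\<in>signs I. \<Prod>i\<in>I. g i (\<xi> i)) = (\<Prod>i\<in>I. g i (-1) + g i 1)"
  unfolding signs_def using assms by (subst prod_sum_PiE[symmetric]) auto

lemma sign_average_const: "finite I \<Longrightarrow> sign_average I (\<lambda>_. c) = c"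
  unfolding sign_average_def by (simp add: card_signs)

lemma sign_average_mono:
  "(\<And>\<xi>. \<xi> \<in> signs I \<Longrightarrow> F \<xi> \<le> G \<xi>) \<Longrightarrow> sign_average I F \<le> sign_average I G"
  unfolding sign_average_def by (intro divide_right_mono sum_mono) auto

lemma sign_average_cong:
  "(\<And>\<xi>. \<xi> \<in> signs I \<Longrightarrow> F \<xi> = G \<xi>) \<Longrightarrow> sign_average I F = sign_average I G"
  unfolding sign_average_def by (intro arg_cong2[where f="(/)"] sum.cong) auto

lemma sign_average_add:
  "sign_average I (\<lambda>\<xi>. F \<xi> + G \<xi>) = sign_average I F + sign_average I G"
  unfolding sign_average_def by (simp add: sum.distrib add_divide_distrib)

lemma sign_average_diff:
  "sign_average I (\<lambda>\<xi>. F \<xi> - G \<xi>) = sign_average I F - sign_average I G"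
  unfolding sign_average_def by (simp add: sum_subtractf diff_divide_distrib)

lemma sign_average_cmult: "sign_average I (\<lambda>\<xi>. c * F \<xi>) = c * sign_average I F"
  unfolding sign_average_def by (simp add: sum_distrib_left)

lemma sign_average_sum:
  "sign_average I (\<lambda>\<xi>. \<Sum>k\<in>K. F k \<xi>) = (\<Sum>k\<in>K. sign_average I (F k))"
  unfolding sign_average_def by (subst sum.swap) (simp add: sum_divide_distrib)

lemma sign_average_prod:
  assumes "finite I"
  shows "sign_average I (\<lambda>\<xi>. \<Prod>i\<in>I. g i (\<xi> i)) = (\<Prod>i\<in>I. (g i (-1) + g i 1) / 2)"
  unfolding sign_average_def using assms
  by (simp add: sum_signs_prod prod_dividef)

lemma sign_average_coord:
  assumes "finite I" "j \<in> I"
  shows "sign_average I (\<lambda>\<xi>. \<xi> j) = 0"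
proof -
  have "sign_average I (\<lambda>\<xi>. \<xi> j) = sign_average I (\<lambda>\<xi>. \<Prod>i\<in>I. if i = j then \<xi> i else 1)"
    using assms by (simp add: prod.delta)
  also have "\<dots> = (\<Prod>i\<in>I. if i = j then 0 else 1)"
    unfolding sign_average_prod[OF assms(1), of "\<lambda>i x. if i = j then x else 1"]
    by (intro prod.cong) auto
  also have "\<dots> = 0" using assms by (subst prod_zero_iff) auto
  finally show ?thesis .
qed

lemma sign_average_coord2:
  assumes "finite I" "j \<in> I" "k \<in> I" "j \<noteq> k"
  shows "sign_average I (\<lambda>\<xi>. \<xi> j * \<xi> k) = 0"
proof -
  have "(\<Prod>i\<in>I. if i = j \<or> i = k then \<xi> i else 1) = \<xi> j * \<xi> k" for \<xi> :: "'a \<Rightarrow> real"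
  proof -
    have "(\<Prod>i\<in>I. if i = j \<or> i = k then \<xi> i else 1)
          = (\<Prod>i\<in>I. (if i = j then \<xi> i else 1) * (if i = k then \<xi> i else 1))"
      using assms by (intro prod.cong) auto
    also have "\<dots> = \<xi> j * \<xi> k" using assms by (simp add: prod.distrib prod.delta)
    finally show ?thesis .
  qed
  hence "sign_average I (\<lambda>\<xi>. \<xi> j * \<xi> k)
      = sign_average I (\<lambda>\<xi>. \<Prod>i\<in>I. if i = j \<or> i = k then \<xi> i else 1)"
    by simp
  also have "\<dots> = (\<Prod>i\<in>I. if i = j \<or> i = k then 0 else 1)"
    unfolding sign_average_prod[OF assms(1), of "\<lambda>i x. if i = j \<or> i = k then x else 1"]
    by (intro prod.cong) auto
  also have "\<dots> = 0" using assms by (subst prod_zero_iff) auto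
  finally show ?thesis .
qed

lemma sign_average_linear:
  assumes "finite I"
  shows "sign_average I (\<lambda>\<xi>. \<Sum>i\<in>I. \<xi> i * b i) = 0"
proof -
  have "sign_average I (\<lambda>\<xi>. \<xi> i * b i) = 0" if "i \<in> I" for i
    using sign_average_cmult[of I "b i" "\<lambda>\<xi>. \<xi> i"] sign_average_coord[OF assms that]
    by (simp add: mult.commute)
  thus ?thesis by (simp add: sign_average_sum)
qed

lemma sign_average_square:
  assumes "finite I"
  shows "sign_average I (\<lambda>\<xi>. (\<Sum>i\<in>I. \<xi> i * b i)\<^sup>2) = (\<Sum>i\<in>I. (b i)\<^sup>2)"
proof -
  have "sign_average I (\<lambda>\<xi>. (\<Sum>i\<in>I. \<xi> i * b i)\<^sup>2)
      = sign_average I (\<lambda>\<xi>. \<Sum>i\<in>I. \<Sum>j\<in>I. (b i * b j) * (\<xi> i * \<xi> j))"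
    by (simp add: power2_eq_square sum_product algebra_simps)
  also have "\<dots> = (\<Sum>i\<in>I. \<Sum>j\<in>I. (b i * b j) * sign_average I (\<lambda>\<xi>. \<xi> i * \<xi> j))"
    by (simp add: sign_average_sum sign_average_cmult)
  also have "\<dots> = (\<Sum>i\<in>I. \<Sum>j\<in>I. if j = i then b i * b j else 0)"
  proof (intro sum.cong refl)
    fix i j assume ij: "i \<in> I" "j \<in> I"
    have "sign_average I (\<lambda>\<xi>. \<xi> i * \<xi> j) = (if j = i then 1 else 0)"
    proof (cases "j = i")
      case True
      have "sign_average I (\<lambda>\<xi>. \<xi> i * \<xi> i) = sign_average I (\<lambda>_. 1)"
        by (rule sign_average_cong) (use ij in \<open>simp add: signs_sq\<close>)
      thus ?thesis using True assms by (simp add: sign_average_const)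
    next
      case False
      thus ?thesis using sign_average_coord2[OF assms, of i j] ij by auto
    qed
    thus "(b i * b j) * sign_average I (\<lambda>\<xi>. \<xi> i * \<xi> j) = (if j = i then b i * b j else 0)"
      by simp
  qed
  also have "\<dots> = (\<Sum>i\<in>I. (b i)\<^sup>2)" using assms by (simp add: sum.delta power2_eq_square)
  finally show ?thesis .
qed

text \<open>Greedy selection: a chosen element discards itself and fewer than q relatives, so m
  rounds use up at most m * q elements.\<close>

lemma independent_subset:
  assumes "symp r" "finite T" "card T \<ge> m * q" "q \<ge> 1"
    and "\<And>j. j \<in> T \<Longrightarrow> card {k \<in> T. k \<noteq> j \<and> r j k} < q"
  shows "\<exists>S\<subseteq>T. card S = m \<and> pairwise (\<lambda>j k. \<not> r j k) S"
  using assms(2,3,5)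
proof (induction m arbitrary: T)
  case 0
  show ?case by (intro exI[of _ "{}"]) (auto simp: pairwise_def)
next
  case (Suc m)
  have "card T > 0" using Suc.prems(2) assms(4) by simp
  then obtain j where j: "j \<in> T" by (metis card_gt_0_iff ex_in_conv)
  define T' where "T' = {k \<in> T. k \<noteq> j \<and> \<not> r j k}"
  have "T = insert j (T' \<union> {k \<in> T. k \<noteq> j \<and> r j k})" using j by (auto simp: T'_def)
  moreover have "finite (T' \<union> {k \<in> T. k \<noteq> j \<and> r j k})" using Suc.prems(1) by (simp add: T'_def)
  ultimately have "card T \<le> Suc (card (T' \<union> {k \<in> T. k \<noteq> j \<and> r j k}))"
    using card_insert_if[of "T' \<union> {k \<in> T. k \<noteq> j \<and> r j k}" j] by (simp split: if_splits)
  also have "\<dots> \<le> Suc (card T' + card {k \<in> T. k \<noteq> j \<and> r j k})"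
    by (simp add: card_Un_le)
  finally have "card T \<le> card T' + q" using Suc.prems(3)[OF j] by linarith
  hence "m * q \<le> card T'" using Suc.prems(2) by simp
  moreover have "card {k \<in> T'. k \<noteq> i \<and> r i k} < q" if "i \<in> T'" for i
  proof -
    have "card {k \<in> T'. k \<noteq> i \<and> r i k} \<le> card {k \<in> T. k \<noteq> i \<and> r i k}"
      using Suc.prems(1) by (intro card_mono) (auto simp: T'_def)
    also have "\<dots> < q" using Suc.prems(3)[of i] that by (auto simp: T'_def)
    finally show ?thesis .
  qed
  ultimately obtain S where S: "S \<subseteq> T'" "card S = m" "pairwise (\<lambda>j k. \<not> r j k) S"
    using Suc.IH[of T'] Suc.prems(1) by (auto simp: T'_def)
  have fS: "finite S" using S(1) Suc.prems(1) by (auto simp: T'_def intro: finite_subset)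
  have "j \<notin> S" using S(1) by (auto simp: T'_def)
  hence "card (insert j S) = Suc m" using S(2) fS by simp
  moreover have "pairwise (\<lambda>j k. \<not> r j k) (insert j S)"
    using S assms(1) by (auto simp: pairwise_insert T'_def dest: sympD)
  ultimately show ?case using S(1) j by (intro exI[of _ "insert j S"]) (auto simp: T'_def)
qed

text \<open>
  A finitary substitute for weak convergence of a subsequence: as long as no large almost
  orthogonal subfamily exists, moving the centre towards a vector with many large inner products
  decreases all the distances in a large subfamily by a fixed amount.
\<close>

lemma almost_orthogonal_subfamily:
  fixes v :: "'k \<Rightarrow> 'i \<Rightarrow> real"
  assumes I: "finite I" and \<delta>: "0 < \<delta>" "\<delta> \<le> R\<^sup>2" and "m \<ge> 1"
    and v: "\<And>k i. k \<in> T0 \<Longrightarrow> i \<in> I \<Longrightarrow> \<bar>v k i\<bar> \<le> \<beta>"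
  shows "T \<subseteq> T0 \<Longrightarrow> finite T \<Longrightarrow> m ^ Suc N \<le> card T \<Longrightarrow>
     (\<And>k. k \<in> T \<Longrightarrow> (\<Sum>i\<in>I. (v k i - u i)\<^sup>2) \<le> min (R\<^sup>2) (N * \<delta>\<^sup>2 / R\<^sup>2)) \<Longrightarrow>
     (\<And>i. i \<in> I \<Longrightarrow> \<bar>u i\<bar> \<le> \<beta>) \<Longrightarrow>
     \<exists>S\<subseteq>T. \<exists>u. card S = m \<and> (\<forall>i\<in>I. \<bar>u i\<bar> \<le> \<beta>) \<and>
       (\<forall>k\<in>S. (\<Sum>i\<in>I. (v k i - u i)\<^sup>2) \<le> R\<^sup>2) \<and>
       pairwise (\<lambda>j k. (\<Sum>i\<in>I. (v j i - u i) * (v k i - u i)) \<le> \<delta>) S"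
proof (induction N arbitrary: T u)
  case 0
  from 0(3) have "m \<le> card T" by simp
  then obtain S where S: "S \<subseteq> T" "card S = m" by (meson obtain_subset_with_card_n)
  \<comment> \<open>For N = 0 the bound on the distances is zero: all members of \<open>T\<close>
    coincide with the centre on \<open>I\<close>, and any m of them serve.\<close>
  have "v k i - u i = 0" if "k \<in> T" "i \<in> I" for k i
  proof -
    have "(\<Sum>i\<in>I. (v k i - u i)\<^sup>2) \<le> 0" using 0(4)[OF that(1)] by simp
    hence "(\<Sum>i\<in>I. (v k i - u i)\<^sup>2) = 0" by (intro antisym sum_nonneg) auto
    thus ?thesis using that I by (simp add: sum_nonneg_eq_0_iff)
  qed
  hence "pairwise (\<lambda>j k. (\<Sum>i\<in>I. (v j i - u i) * (v k i - u i)) \<le> \<delta>) S"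
    using S(1) \<delta>(1) by (force simp: pairwise_def subset_iff intro!: order_trans[OF sum_nonpos])
  moreover have "(\<Sum>i\<in>I. (v k i - u i)\<^sup>2) \<le> R\<^sup>2" if "k \<in> S" for k
    using order_trans[OF 0(4)[of k]] that S(1) by auto
  ultimately show ?case using S 0(5) by (intro exI[of _ S] conjI exI[of _ u]) auto
next
  case (Suc N)
  define r where "r = (\<lambda>j k. (\<Sum>i\<in>I. (v j i - u i) * (v k i - u i)) > \<delta>)"
  have "symp r" by (auto simp: symp_def r_def mult.commute)
  show ?case
  proof (cases "\<forall>j\<in>T. card {k \<in> T. k \<noteq> j \<and> r j k} < m ^ Suc N")
    case True
    have "\<exists>S\<subseteq>T. card S = m \<and> pairwise (\<lambda>j k. \<not> r j k) S"
      by (rule independent_subset[OF \<open>symp r\<close>, of T m "m ^ Suc N"]) (use Suc True \<open>m \<ge> 1\<close> in auto)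
    then obtain S where S: "S \<subseteq> T" "card S = m" "pairwise (\<lambda>j k. \<not> r j k) S" by blast
    thus ?thesis using Suc.prems
      by (intro exI[of _ S] conjI exI[of _ u]) (auto simp: r_def not_less)
  next
    case False
    then obtain j where j: "j \<in> T" "card {k \<in> T. k \<noteq> j \<and> r j k} \<ge> m ^ Suc N" by force
    define T' where "T' = {k \<in> T. k \<noteq> j \<and> r j k}"
    \<comment> \<open>This c minimises c^2 R^2 - 2 c \<delta>; the minimum -\<delta>^2 / R^2 is the
      decrease per round. As c \<le> 1, the new centre is a convex combination of \<open>u\<close>
      and \<open>v j\<close>, so its coordinates stay bounded by \<beta>.\<close>
    define c where "c = \<delta> / R\<^sup>2"
    have R: "R\<^sup>2 > 0" using \<delta> by linarith
    hence c: "0 < c" "c \<le> 1" using \<delta> by (auto simp: c_def)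
    define u' where "u' = (\<lambda>i. u i + c * (v j i - u i))"
    have "\<exists>S\<subseteq>T'. \<exists>u. card S = m \<and> (\<forall>i\<in>I. \<bar>u i\<bar> \<le> \<beta>) \<and>
       (\<forall>k\<in>S. (\<Sum>i\<in>I. (v k i - u i)\<^sup>2) \<le> R\<^sup>2) \<and>
       pairwise (\<lambda>j k. (\<Sum>i\<in>I. (v j i - u i) * (v k i - u i)) \<le> \<delta>) S"
    proof (rule Suc.IH[of T' u'])
      show "T' \<subseteq> T0" "finite T'" "m ^ Suc N \<le> card T'" using Suc.prems j by (auto simp: T'_def)
      show "\<bar>u' i\<bar> \<le> \<beta>" if "i \<in> I" for i
      proof -
        have "u' i = (1 - c) * u i + c * v j i" by (simp add: u'_def algebra_simps)
        hence "\<bar>u' i\<bar> \<le> (1 - c) * \<bar>u i\<bar> + c * \<bar>v j i\<bar>"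
          using c by (metis abs_mult abs_of_nonneg abs_triangle_ineq diff_ge_0_iff_ge less_imp_le)
        also have "\<dots> \<le> (1 - c) * \<beta> + c * \<beta>"
          using c Suc.prems(5)[OF that] v[of j i] j(1) Suc.prems(1) that
          by (intro add_mono mult_left_mono) auto
        finally show ?thesis by (simp add: algebra_simps)
      qed
      fix k assume k: "k \<in> T'"
      have "(\<Sum>i\<in>I. (v k i - u' i)\<^sup>2) = (\<Sum>i\<in>I. (v k i - u i)\<^sup>2
          + (c\<^sup>2 * (v j i - u i)\<^sup>2 - 2 * c * ((v j i - u i) * (v k i - u i))))"
        by (intro sum.cong refl) (simp add: u'_def power2_eq_square algebra_simps)
      also have "\<dots> = (\<Sum>i\<in>I. (v k i - u i)\<^sup>2) + (c\<^sup>2 * (\<Sum>i\<in>I. (v j i - u i)\<^sup>2)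
          - 2 * c * (\<Sum>i\<in>I. (v j i - u i) * (v k i - u i)))"
        by (simp add: sum.distrib sum_subtractf sum_distrib_left)
      also have "\<dots> \<le> min (R\<^sup>2) (Suc N * \<delta>\<^sup>2 / R\<^sup>2) + (c\<^sup>2 * R\<^sup>2 - 2 * c * \<delta>)"
        using Suc.prems(4)[of k] Suc.prems(4)[of j] k j c
        by (intro add_mono diff_mono mult_left_mono) (auto simp: T'_def r_def)
      also have "c\<^sup>2 * R\<^sup>2 - 2 * c * \<delta> = - (\<delta>\<^sup>2 / R\<^sup>2)"
        using R by (simp add: c_def power2_eq_square field_simps)
      also have "min (R\<^sup>2) (Suc N * \<delta>\<^sup>2 / R\<^sup>2) + - (\<delta>\<^sup>2 / R\<^sup>2) \<le> min (R\<^sup>2) (N * \<delta>\<^sup>2 / R\<^sup>2)"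
      proof -
        have "\<delta>\<^sup>2 / R\<^sup>2 \<ge> 0" by simp
        moreover have "Suc N * \<delta>\<^sup>2 / R\<^sup>2 = N * \<delta>\<^sup>2 / R\<^sup>2 + \<delta>\<^sup>2 / R\<^sup>2"
          by (simp add: add_divide_distrib algebra_simps)
        ultimately show ?thesis by linarith
      qed
      finally show "(\<Sum>i\<in>I. (v k i - u' i)\<^sup>2) \<le> min (R\<^sup>2) (N * \<delta>\<^sup>2 / R\<^sup>2)" .
    qed
    thus ?thesis by (force simp: T'_def)
  qed
qed

text \<open>The derivative x (1 - x) / (2 (1 + x)) of the difference \<open>g\<close> has the sign
  of x on the interval, so \<open>g\<close> is smallest at 0. The quadratic term is what later turns
  a lower bound on a Riesz product into a large Rademacher sum.\<close>

lemma one_plus_le_exp_quadratic: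
  fixes y :: real
  assumes "\<bar>y\<bar> \<le> 1 / 2"
  shows "1 + y \<le> exp (y - y\<^sup>2 / 4)"
proof -
  define g where "g = (\<lambda>x::real. x - x\<^sup>2 / 4 - ln (1 + x))"
  have deriv: "(g has_real_derivative (x * (1 - x) / (2 * (1 + x)))) (at x)" if "\<bar>x\<bar> \<le> 1 / 2" for x
  proof -
    have "1 + x > 0" using that by linarith
    thus ?thesis unfolding g_def
      by (auto intro!: derivative_eq_intros simp: field_simps power2_eq_square)
  qed
  have "g y \<ge> g 0"
  proof (cases "y \<ge> 0")
    case True
    show ?thesis
    proof (rule DERIV_nonneg_imp_nondecreasing[of 0 y g, OF True])
      fix x assume "0 \<le> x" "x \<le> y"
      thus "\<exists>D. (g has_real_derivative D) (at x) \<and> 0 \<le> D"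
        using assms by (intro exI[of _ "x * (1 - x) / (2 * (1 + x))"] conjI deriv) auto
    qed
  next
    case False
    show ?thesis
    proof (rule DERIV_nonpos_imp_nonincreasing[of y 0 g])
      show "y \<le> 0" using False by simp
      fix x assume x: "y \<le> x" "x \<le> 0"
      hence "x * (1 - x) / (2 * (1 + x)) \<le> 0"
        using assms by (intro divide_nonpos_nonneg mult_nonpos_nonneg) auto
      thus "\<exists>D. (g has_real_derivative D) (at x) \<and> D \<le> 0"
        using assms x by (intro exI[of _ "x * (1 - x) / (2 * (1 + x))"] conjI deriv) auto
    qed
  qed
  hence "ln (1 + y) \<le> y - y\<^sup>2 / 4" by (simp add: g_def)
  moreover have "1 + y > 0" using assms by linarith
  ultimately show ?thesis by (metis exp_le_cancel_iff exp_ln)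
qed

text \<open>
  The second moment method for an average of Riesz products: these have mean one, and their
  correlations are bounded by the exponentials of the inner products.
\<close>

lemma rademacher_max_lower_bound:
  fixes b :: "'k \<Rightarrow> 'i \<Rightarrow> real"
  assumes I: "finite I" and S: "finite S" "S \<noteq> {}" and \<tau>: "\<tau> > 0"
    and card: "exp (\<tau>\<^sup>2 * R\<^sup>2) \<le> card S"
    and small: "\<And>k i. k \<in> S \<Longrightarrow> i \<in> I \<Longrightarrow> \<bar>\<tau> * b k i\<bar> \<le> 1 / 2"
    and norm: "\<And>k. k \<in> S \<Longrightarrow> (\<Sum>i\<in>I. (b k i)\<^sup>2) \<le> R\<^sup>2"
    and orth: "pairwise (\<lambda>j k. (\<Sum>i\<in>I. b j i * b k i) \<le> 1 / (2 * \<tau>\<^sup>2)) S"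
    and far: "\<And>k. k \<in> S \<Longrightarrow> (\<Sum>i\<in>I. (b k i)\<^sup>2) \<ge> (a / 2)\<^sup>2"
    and pos: "\<tau> * a\<^sup>2 / 16 - 1 / \<tau> \<ge> 0"
  shows "sign_average I (\<lambda>\<xi>. MAX k\<in>S. \<Sum>i\<in>I. \<xi> i * b k i)
           \<ge> (\<tau> * a\<^sup>2 / 16 - 1 / \<tau>) / 12 - 1 - R\<^sup>2"
proof -
  \<comment> \<open>Used as densities, these products tilt every sign towards the sign of
    \<open>b k i\<close> and thus favour a large k-th sum; \<open>small\<close> makes their factors
    positive.\<close>
  define e where "e = (\<lambda>\<xi> k. \<Prod>i\<in>I. 1 + \<tau> * \<xi> i * b k i)"
  define Z where "Z = (\<lambda>\<xi>. (\<Sum>k\<in>S. e \<xi> k) / card S)"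
  \<comment> \<open>The level forced by e \<ge> 1/2: the exponent \<tau> y - \<tau>^2 / 4 times the
    squared norm is then at least -1, and the squared norm is at least (a/2)^2.\<close>
  define Q where "Q = \<tau> * a\<^sup>2 / 16 - 1 / \<tau>"
  define ip where "ip = (\<lambda>j k. \<Sum>i\<in>I. b j i * b k i)"
  have cS: "real (card S) > 0" using S by (simp add: card_gt_0_iff)
  have e_avg: "sign_average I (\<lambda>\<xi>. e \<xi> k) = 1" for k
    unfolding e_def using sign_average_prod[OF I, of "\<lambda>i x. 1 + \<tau> * x * b k i"] by simp
  have Z_avg: "sign_average I Z = 1"
  proof -
    have "sign_average I Z = sign_average I (\<lambda>\<xi>. (1 / card S) * (\<Sum>k\<in>S. e \<xi> k))"
      by (simp add: Z_def)
    also have "\<dots> = 1" using cS S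
      unfolding sign_average_cmult sign_average_sum by (simp add: e_avg)
    finally show ?thesis .
  qed
  have small2: "\<bar>\<tau>\<^sup>2 * (b j i * b k i)\<bar> \<le> 1 / 4" if "j \<in> S" "k \<in> S" "i \<in> I" for i j k
  proof -
    have "\<bar>\<tau>\<^sup>2 * (b j i * b k i)\<bar> = \<bar>\<tau> * b j i\<bar> * \<bar>\<tau> * b k i\<bar>"
      by (simp add: abs_mult power2_eq_square)
    also have "\<dots> \<le> (1/2) * (1/2)" using small that by (intro mult_mono) auto
    finally show ?thesis by simp
  qed
  have ee_avg: "sign_average I (\<lambda>\<xi>. e \<xi> j * e \<xi> k) \<le> exp (\<tau>\<^sup>2 * ip j k)" if "j \<in> S" "k \<in> S" for j k
  proof -
    have "sign_average I (\<lambda>\<xi>. e \<xi> j * e \<xi> k)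
        = sign_average I (\<lambda>\<xi>. \<Prod>i\<in>I. (1 + \<tau> * \<xi> i * b j i) * (1 + \<tau> * \<xi> i * b k i))"
      by (simp add: e_def prod.distrib)
    also have "\<dots> = (\<Prod>i\<in>I. 1 + \<tau>\<^sup>2 * (b j i * b k i))"
      unfolding sign_average_prod[OF I, of "\<lambda>i x. (1 + \<tau> * x * b j i) * (1 + \<tau> * x * b k i)"]
      by (intro prod.cong refl) (simp add: field_simps power2_eq_square)
    also have "\<dots> \<le> (\<Prod>i\<in>I. exp (\<tau>\<^sup>2 * (b j i * b k i)))"
    proof (rule prod_mono)
      fix i assume "i \<in> I"
      thus "0 \<le> 1 + \<tau>\<^sup>2 * (b j i * b k i) \<and> 1 + \<tau>\<^sup>2 * (b j i * b k i) \<le> exp (\<tau>\<^sup>2 * (b j i * b k i))"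
        using small2[OF that, of i] by (auto simp: abs_le_iff)
    qed
    also have "\<dots> = exp (\<tau>\<^sup>2 * ip j k)" by (simp add: exp_sum[OF I] ip_def sum_distrib_left)
    finally show ?thesis .
  qed
  have e_pos: "e \<xi> k \<ge> 0" if "\<xi> \<in> signs I" "k \<in> S" for \<xi> k
    unfolding e_def
  proof (rule prod_nonneg)
    fix i assume i: "i \<in> I"
    have "\<bar>\<tau> * \<xi> i * b k i\<bar> = \<bar>\<tau> * b k i\<bar>" using abs_signs[OF that(1) i] by (simp add: abs_mult)
    thus "0 \<le> 1 + \<tau> * \<xi> i * b k i" using small[OF that(2) i] by linarith
  qed
  have Z2_avg: "sign_average I (\<lambda>\<xi>. (Z \<xi>)\<^sup>2) \<le> 3"
  proof -
    have "sign_average I (\<lambda>\<xi>. (Z \<xi>)\<^sup>2)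
        = sign_average I (\<lambda>\<xi>. (1 / (real (card S))\<^sup>2) * (\<Sum>j\<in>S. \<Sum>k\<in>S. e \<xi> j * e \<xi> k))"
      by (simp add: Z_def power2_eq_square sum_product)
    also have "\<dots> = (1 / (real (card S))\<^sup>2) * (\<Sum>j\<in>S. \<Sum>k\<in>S. sign_average I (\<lambda>\<xi>. e \<xi> j * e \<xi> k))"
      by (simp only: sign_average_cmult sign_average_sum)
    \<comment> \<open>Off the diagonal the correlation is at most exp (1/2) \<le> 2. On the diagonal
      exp (\<tau>^2 R^2) does not exceed the cardinality of \<open>S\<close>, so the diagonal
      contributes at most one more to the mean.\<close>
    also have "\<dots> \<le> (1 / (real (card S))\<^sup>2) * (\<Sum>j\<in>S. \<Sum>k\<in>S. if k = j then 2 + real (card S) else 2)"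
    proof (intro mult_left_mono sum_mono)
      fix j k assume jk: "j \<in> S" "k \<in> S"
      show "sign_average I (\<lambda>\<xi>. e \<xi> j * e \<xi> k) \<le> (if k = j then 2 + real (card S) else 2)"
      proof (cases "k = j")
        case True
        have "ip j j \<le> R\<^sup>2" using norm[OF jk(1)] by (simp add: ip_def power2_eq_square)
        hence "\<tau>\<^sup>2 * ip j j \<le> \<tau>\<^sup>2 * R\<^sup>2" by (intro mult_left_mono) auto
        hence "exp (\<tau>\<^sup>2 * ip j j) \<le> exp (\<tau>\<^sup>2 * R\<^sup>2)" by (subst exp_le_cancel_iff)
        with ee_avg[OF jk] card True have "sign_average I (\<lambda>\<xi>. e \<xi> j * e \<xi> k) \<le> card S"
          by (metis order_trans)
        thus ?thesis using True by simp
      next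
        case False
        hence "ip j k \<le> 1 / (2 * \<tau>\<^sup>2)" using orth jk by (auto simp: pairwise_def ip_def)
        hence "\<tau>\<^sup>2 * ip j k \<le> \<tau>\<^sup>2 * (1 / (2 * \<tau>\<^sup>2))" by (intro mult_left_mono) auto
        hence "\<tau>\<^sup>2 * ip j k \<le> 1 / 2" using \<tau> by simp
        hence "exp (\<tau>\<^sup>2 * ip j k) \<le> exp (1 / 2)" by simp
        also have "\<dots> \<le> 2" by (rule exp_half_le2)
        finally show ?thesis using False ee_avg[OF jk] by simp
      qed
    qed auto
    also have "(\<Sum>j\<in>S. \<Sum>k\<in>S. if k = j then 2 + real (card S) else 2) = (\<Sum>j\<in>S. \<Sum>k\<in>S. 2 + (if k = j then real (card S) else 0))"
      by (intro sum.cong refl) auto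
    also have "\<dots> = 3 * (real (card S))\<^sup>2"
      using S by (simp add: sum.distrib power2_eq_square algebra_simps sum.delta)
    finally show ?thesis using cS by simp
  qed
  define A where "A = (\<lambda>\<xi>. of_bool (Z \<xi> \<ge> 1/2) :: real)"
  have PA: "sign_average I A \<ge> 1 / 12"
  proof -
    \<comment> \<open>A pointwise substitute for the Paley-Zygmund inequality: the square (Z/6 -
      1)^2 gives Z \<le> Z^2/12 + 3 where Z \<ge> 1/2. With first moment 1 and second moment at most
      3 this reads 1 \<le> 1/2 + 1/4 + 3 p, where p is the average of \<open>A\<close>.\<close>
    have "sign_average I Z \<le> sign_average I (\<lambda>\<xi>. 1/2 + ((1/12) * (Z \<xi>)\<^sup>2 + 3 * A \<xi>))"
    proof (rule sign_average_mono)
      fix \<xi>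
      have "(Z \<xi> / 6 - 1)\<^sup>2 \<ge> 0" by simp
      hence "Z \<xi> \<le> (1/12) * (Z \<xi>)\<^sup>2 + 3" by (simp add: power2_eq_square algebra_simps)
      moreover have "(Z \<xi>)\<^sup>2 \<ge> 0" by simp
      ultimately show "Z \<xi> \<le> 1/2 + ((1/12) * (Z \<xi>)\<^sup>2 + 3 * A \<xi>)"
        unfolding A_def of_bool_def by (cases "Z \<xi> \<ge> 1/2"; simp; linarith)
    qed
    also have "\<dots> = 1/2 + ((1/12) * sign_average I (\<lambda>\<xi>. (Z \<xi>)\<^sup>2) + 3 * sign_average I A)"
      unfolding sign_average_add sign_average_cmult sign_average_const[OF I] by (rule refl)
    finally show ?thesis using Z2_avg Z_avg by simp
  qed
  obtain k0 where k0: "k0 \<in> S" using S by blast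
  \<comment> \<open>Where Z < 1/2 the maximum could be negative. There it is bounded below by a
    single sum y through y \<ge> -1 - y^2, which costs at most 1 + R^2 on average.\<close>
  have "sign_average I (\<lambda>\<xi>. Q * A \<xi> + (- 1 + (- 1) * (\<Sum>i\<in>I. \<xi> i * b k0 i)\<^sup>2))
      \<le> sign_average I (\<lambda>\<xi>. MAX k\<in>S. \<Sum>i\<in>I. \<xi> i * b k i)"
  proof (rule sign_average_mono)
    fix \<xi> assume \<xi>: "\<xi> \<in> signs I"
    define mx where "mx = (MAX k\<in>S. \<Sum>i\<in>I. \<xi> i * b k i)"
    have mx: "(\<Sum>i\<in>I. \<xi> i * b k i) \<le> mx" if "k \<in> S" for k
      unfolding mx_def using that S by (intro Max_ge) auto
    show "Q * A \<xi> + (- 1 + (- 1) * (\<Sum>i\<in>I. \<xi> i * b k0 i)\<^sup>2) \<le> mx"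
    proof (cases "Z \<xi> \<ge> 1/2")
      case True
      have "\<exists>k\<in>S. e \<xi> k \<ge> 1/2"
      proof (rule ccontr)
        assume "\<not> ?thesis"
        hence "(\<Sum>k\<in>S. e \<xi> k) < (\<Sum>k\<in>S. 1/2)" using S by (intro sum_strict_mono) auto
        hence "Z \<xi> < 1/2" using cS by (simp add: Z_def field_simps)
        thus False using True by simp
      qed
      then obtain k where k: "k \<in> S" "e \<xi> k \<ge> 1/2" by blast
      have "e \<xi> k \<le> (\<Prod>i\<in>I. exp (\<tau> * (\<xi> i * b k i) - \<tau>\<^sup>2 / 4 * (b k i)\<^sup>2))"
        unfolding e_def
      proof (rule prod_mono)
        fix i assume i: "i \<in> I"
        have *: "\<bar>\<tau> * \<xi> i * b k i\<bar> \<le> 1 / 2"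
          using abs_signs[OF \<xi> i] small[OF k(1) i] by (simp add: abs_mult)
        have "(\<tau> * \<xi> i * b k i)\<^sup>2 = (\<xi> i * \<xi> i) * \<tau>\<^sup>2 * (b k i)\<^sup>2"
          by (simp add: power2_eq_square)
        hence "\<tau> * \<xi> i * b k i - (\<tau> * \<xi> i * b k i)\<^sup>2 / 4 = \<tau> * (\<xi> i * b k i) - \<tau>\<^sup>2 / 4 * (b k i)\<^sup>2"
          using signs_sq[OF \<xi> i] by simp
        with one_plus_le_exp_quadratic[OF *]
        have "1 + \<tau> * \<xi> i * b k i \<le> exp (\<tau> * (\<xi> i * b k i) - \<tau>\<^sup>2 / 4 * (b k i)\<^sup>2)"
          by (simp only:)
        moreover have "0 \<le> 1 + \<tau> * \<xi> i * b k i" using * by linarith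
        ultimately show "0 \<le> 1 + \<tau> * \<xi> i * b k i \<and>
              1 + \<tau> * \<xi> i * b k i \<le> exp (\<tau> * (\<xi> i * b k i) - \<tau>\<^sup>2 / 4 * (b k i)\<^sup>2)"
          by blast
      qed
      also have "\<dots> = exp (\<tau> * (\<Sum>i\<in>I. \<xi> i * b k i) - \<tau>\<^sup>2 / 4 * (\<Sum>i\<in>I. (b k i)\<^sup>2))"
        by (simp add: exp_sum[OF I, symmetric] sum_subtractf sum_distrib_left)
      finally have "1/2 \<le> exp (\<tau> * (\<Sum>i\<in>I. \<xi> i * b k i) - \<tau>\<^sup>2 / 4 * (\<Sum>i\<in>I. (b k i)\<^sup>2))"
        using k(2) by simp
      moreover have "exp (-1::real) \<le> 1/2"
        using exp_ge_add_one_self[of "1::real"] by (simp add: exp_minus field_simps)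
      ultimately have "exp (-1) \<le> exp (\<tau> * (\<Sum>i\<in>I. \<xi> i * b k i) - \<tau>\<^sup>2 / 4 * (\<Sum>i\<in>I. (b k i)\<^sup>2))"
        by linarith
      hence "-1 \<le> \<tau> * (\<Sum>i\<in>I. \<xi> i * b k i) - \<tau>\<^sup>2 / 4 * (\<Sum>i\<in>I. (b k i)\<^sup>2)" by simp
      moreover have "\<tau>\<^sup>2 / 4 * (\<Sum>i\<in>I. (b k i)\<^sup>2) \<ge> \<tau>\<^sup>2 / 4 * (a / 2)\<^sup>2"
        using far[OF k(1)] by (intro mult_left_mono) auto
      moreover have "\<tau> * (\<Sum>i\<in>I. \<xi> i * b k i) \<le> \<tau> * mx" using mx[OF k(1)] \<tau> by simp
      ultimately have "\<tau>\<^sup>2 / 4 * (a / 2)\<^sup>2 - 1 \<le> \<tau> * mx" by linarith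
      moreover have "\<tau>\<^sup>2 / 4 * (a / 2)\<^sup>2 - 1 = \<tau> * Q"
        using \<tau> by (simp add: Q_def power2_eq_square field_simps)
      ultimately have "Q \<le> mx" using \<tau> by simp
      moreover have "(\<Sum>i\<in>I. \<xi> i * b k0 i)\<^sup>2 \<ge> 0" by simp
      moreover have "Q * A \<xi> = Q" using True by (simp add: A_def)
      ultimately show ?thesis by linarith
    next
      case False
      define y where "y = (\<Sum>i\<in>I. \<xi> i * b k0 i)"
      have "(y + 1 / 2)\<^sup>2 \<ge> 0" by simp
      hence "-1 - y\<^sup>2 \<le> y" by (simp add: power2_eq_square algebra_simps)
      thus ?thesis using False mx[OF k0] by (simp add: A_def y_def)
    qed
  qed
  moreover have "sign_average I (\<lambda>\<xi>. Q * A \<xi> + (- 1 + (- 1) * (\<Sum>i\<in>I. \<xi> i * b k0 i)\<^sup>2))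
      = Q * sign_average I A + (- 1 + (- 1) * (\<Sum>i\<in>I. (b k0 i)\<^sup>2))"
    unfolding sign_average_add sign_average_cmult sign_average_const[OF I] sign_average_square[OF I]
    by (rule refl)
  moreover have "Q * sign_average I A \<ge> Q * (1/12)"
    using PA pos unfolding Q_def by (intro mult_left_mono) auto
  ultimately have "Q / 12 - 1 - R\<^sup>2 \<le> sign_average I (\<lambda>\<xi>. MAX k\<in>S. \<Sum>i\<in>I. \<xi> i * b k i)"
    using norm[OF k0] by linarith
  thus ?thesis unfolding Q_def .
qed

text \<open>K and \<beta> depend only on a, R and \<Lambda>, so they can be fixed before the number
  of points. Subtracting a common centre u is harmless because the linear form in u has sign average
  zero, and a-separation keeps all but at most one of the centred vectors at norm a/2 or
  more.\<close>

lemma rademacher_sudakov: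
  fixes a R \<Lambda> :: real
  assumes a: "a > 0" and R: "R > 0"
  shows "\<exists>K \<beta>. K > 0 \<and> \<beta> > 0 \<and>
    (\<forall>(I :: 'i set) (T :: 'k set) v. finite I \<and> finite T \<and> K \<le> card T \<and>
       (\<forall>k\<in>T. \<forall>i\<in>I. \<bar>v k i\<bar> \<le> \<beta>) \<and>
       (\<forall>k\<in>T. (\<Sum>i\<in>I. (v k i)\<^sup>2) \<le> R\<^sup>2) \<and>
       pairwise (\<lambda>j k. (\<Sum>i\<in>I. (v j i - v k i)\<^sup>2) \<ge> a\<^sup>2) T \<longrightarrow>
       sign_average I (\<lambda>\<xi>. MAX k\<in>T. \<Sum>i\<in>I. \<xi> i * v k i) \<ge> \<Lambda>)"
proof -
  \<comment> \<open>One demand each: 1 / R gives \<delta> \<le> R^2, the value 1 bounds 1 / \<tau>,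
    and the last entry then makes the bound of \<open>rademacher_max_lower_bound\<close> at least
    \<Lambda>.\<close>
  define \<tau> where "\<tau> = max (1 / R) (max 1 ((12 * (\<bar>\<Lambda>\<bar> + 1 + R\<^sup>2) + 1) * 16 / a\<^sup>2))"
  have \<tau>: "\<tau> \<ge> 1" "\<tau> \<ge> 1 / R" "\<tau> \<ge> (12 * (\<bar>\<Lambda>\<bar> + 1 + R\<^sup>2) + 1) * 16 / a\<^sup>2" by (auto simp: \<tau>_def)
  have "\<tau> * a\<^sup>2 \<ge> (12 * (\<bar>\<Lambda>\<bar> + 1 + R\<^sup>2) + 1) * 16" using \<tau>(3) a by (simp add: field_simps)
  moreover have "1 / \<tau> \<le> 1" using \<tau>(1) by simp
  ultimately have Q: "\<tau> * a\<^sup>2 / 16 - 1 / \<tau> \<ge> 12 * (\<bar>\<Lambda>\<bar> + 1 + R\<^sup>2)" by simp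
  define \<delta> where "\<delta> = 1 / (2 * \<tau>\<^sup>2)"
  have \<delta>: "\<delta> > 0" "\<delta> \<le> R\<^sup>2"
  proof -
    show "\<delta> > 0" using \<tau>(1) by (simp add: \<delta>_def)
    have "1 \<le> \<tau> * R" using \<tau>(2) R by (simp add: field_simps)
    hence "1 \<le> (\<tau> * R)\<^sup>2" by (metis one_le_power)
    thus "\<delta> \<le> R\<^sup>2" using \<tau>(1) by (simp add: \<delta>_def field_simps power_mult_distrib)
  qed
  \<comment> \<open>One more than the second moment method needs, since a vector close to the centre
    may have to be dropped.\<close>
  define m where "m = nat \<lceil>exp (\<tau>\<^sup>2 * R\<^sup>2)\<rceil> + 1"
  have "1 \<le> exp (\<tau>\<^sup>2 * R\<^sup>2)" by simp
  hence m: "exp (\<tau>\<^sup>2 * R\<^sup>2) \<le> m - 1" "m \<ge> 2"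
    unfolding m_def using real_nat_ceiling_ge[of "exp (\<tau>\<^sup>2 * R\<^sup>2)"] by (simp, linarith)
  \<comment> \<open>Enough rounds to start from the centre 0, where squared distances are only known
    to be at most R^2.\<close>
  define N where "N = nat \<lceil>R\<^sup>2 * R\<^sup>2 / \<delta>\<^sup>2\<rceil>"
  have "R\<^sup>2 * R\<^sup>2 / \<delta>\<^sup>2 \<le> N" unfolding N_def by (rule real_nat_ceiling_ge)
  hence N: "R\<^sup>2 \<le> N * \<delta>\<^sup>2 / R\<^sup>2" using \<delta> R by (simp add: field_simps)
  \<comment> \<open>Centred coordinates are at most 2 \<beta>, hence at most 1/2 after
    multiplication by \<tau>.\<close>
  define \<beta> where "\<beta> = 1 / (4 * \<tau>)"
  have main: "sign_average I (\<lambda>\<xi>. MAX k\<in>T. \<Sum>i\<in>I. \<xi> i * v k i) \<ge> \<Lambda>"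
    if I: "finite I" and T: "finite T" "m ^ Suc N \<le> card T"
      and v1: "\<forall>k\<in>T. \<forall>i\<in>I. \<bar>v k i\<bar> \<le> \<beta>"
      and v2: "\<forall>k\<in>T. (\<Sum>i\<in>I. (v k i)\<^sup>2) \<le> R\<^sup>2"
      and v3: "pairwise (\<lambda>j k. (\<Sum>i\<in>I. (v j i - v k i)\<^sup>2) \<ge> a\<^sup>2) T"
    for I :: "'i set" and T :: "'k set" and v
  proof -
    have "\<exists>S\<subseteq>T. \<exists>u. card S = m \<and> (\<forall>i\<in>I. \<bar>u i\<bar> \<le> \<beta>) \<and>
       (\<forall>k\<in>S. (\<Sum>i\<in>I. (v k i - u i)\<^sup>2) \<le> R\<^sup>2) \<and>
       pairwise (\<lambda>j k. (\<Sum>i\<in>I. (v j i - u i) * (v k i - u i)) \<le> \<delta>) S"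
    proof (rule almost_orthogonal_subfamily[OF I \<delta>, where ?T0.0 = T and N = N and u = "\<lambda>_. 0"])
      show "\<bar>0\<bar> \<le> \<beta>" using \<tau>(1) by (simp add: \<beta>_def)
    qed (use T v1 v2 N m in auto)
    then obtain S u where S: "S \<subseteq> T" "card S = m" and u: "\<forall>i\<in>I. \<bar>u i\<bar> \<le> \<beta>"
      and S2: "\<forall>k\<in>S. (\<Sum>i\<in>I. (v k i - u i)\<^sup>2) \<le> R\<^sup>2"
      and S3: "pairwise (\<lambda>j k. (\<Sum>i\<in>I. (v j i - u i) * (v k i - u i)) \<le> \<delta>) S" by blast
    define b where "b = (\<lambda>k i. v k i - u i)"
    define near where "near = {k \<in> S. (\<Sum>i\<in>I. (b k i)\<^sup>2) < (a / 2)\<^sup>2}"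
    have fS: "finite S" using S T by (auto intro: finite_subset)
    have "j = k" if "j \<in> near" "k \<in> near" for j k
    proof (rule ccontr)
      assume "j \<noteq> k"
      hence "a\<^sup>2 \<le> (\<Sum>i\<in>I. (v j i - v k i)\<^sup>2)"
        using v3 S that by (auto simp: pairwise_def near_def)
      also have "\<dots> \<le> (\<Sum>i\<in>I. 2 * (b j i)\<^sup>2 + 2 * (b k i)\<^sup>2)"
      proof (rule sum_mono)
        fix i
        have "(b j i + b k i)\<^sup>2 \<ge> 0" by simp
        thus "(v j i - v k i)\<^sup>2 \<le> 2 * (b j i)\<^sup>2 + 2 * (b k i)\<^sup>2"
          by (simp add: b_def power2_eq_square algebra_simps)
      qed
      also have "\<dots> = 2 * (\<Sum>i\<in>I. (b j i)\<^sup>2) + 2 * (\<Sum>i\<in>I. (b k i)\<^sup>2)"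
        by (simp add: sum.distrib sum_distrib_left)
      also have "\<dots> < 2 * (a / 2)\<^sup>2 + 2 * (a / 2)\<^sup>2"
        using that by (intro add_strict_mono) (auto simp: near_def)
      also have "\<dots> = a\<^sup>2" by (simp add: power2_eq_square)
      finally show False by simp
    qed
    moreover have fnear: "finite near" "near \<subseteq> S" using fS by (auto simp: near_def)
    ultimately have c_near: "card near \<le> 1" using card_le_Suc0_iff_eq[of near] by auto
    define S' where "S' = S - near"
    have cS': "card S' \<ge> m - 1"
      using S(2) c_near card_Diff_subset[OF fnear] by (simp add: S'_def)
    have "card S' > 0" using cS' m(2) by linarith
    hence ne: "S' \<noteq> {}" "finite S'" "S' \<subseteq> T"
      using S(1) by (auto simp: card_gt_0_iff S'_def)
    have "(\<tau> * a\<^sup>2 / 16 - 1 / \<tau>) / 12 - 1 - R\<^sup>2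
          \<le> sign_average I (\<lambda>\<xi>. MAX k\<in>S'. \<Sum>i\<in>I. \<xi> i * b k i)"
    proof (rule rademacher_max_lower_bound[OF I ne(2) ne(1)])
      show "\<tau> > 0" using \<tau>(1) by simp
      show "exp (\<tau>\<^sup>2 * R\<^sup>2) \<le> card S'" using m cS' by linarith
      show "\<bar>\<tau> * b k i\<bar> \<le> 1 / 2" if "k \<in> S'" "i \<in> I" for k i
      proof -
        have "\<bar>b k i\<bar> \<le> \<bar>v k i\<bar> + \<bar>u i\<bar>" by (simp add: b_def)
        also have "\<dots> \<le> 2 * \<beta>" using u v1 that ne(3) by (fastforce intro: add_mono)
        finally have "\<tau> * \<bar>b k i\<bar> \<le> \<tau> * (2 * \<beta>)" using \<tau>(1) by (intro mult_left_mono) auto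
        thus ?thesis using \<tau>(1) by (simp add: abs_mult \<beta>_def)
      qed
      show "(\<Sum>i\<in>I. (b k i)\<^sup>2) \<le> R\<^sup>2" if "k \<in> S'" for k using S2 that by (simp add: b_def S'_def)
      show "pairwise (\<lambda>j k. (\<Sum>i\<in>I. b j i * b k i) \<le> 1 / (2 * \<tau>\<^sup>2)) S'"
        using S3 by (auto simp: pairwise_def S'_def b_def \<delta>_def)
      show "(a / 2)\<^sup>2 \<le> (\<Sum>i\<in>I. (b k i)\<^sup>2)" if "k \<in> S'" for k
        using that by (auto simp: S'_def near_def)
      show "0 \<le> \<tau> * a\<^sup>2 / 16 - 1 / \<tau>" using Q by (smt (verit) zero_le_power2)
    qed
    also have "\<dots> \<le> sign_average I (\<lambda>\<xi>. (MAX k\<in>T. \<Sum>i\<in>I. \<xi> i * v k i) - (\<Sum>i\<in>I. \<xi> i * u i))"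
    proof (rule sign_average_mono)
      fix \<xi>
      have "(MAX k\<in>S'. \<Sum>i\<in>I. \<xi> i * b k i) \<in> (\<lambda>k. \<Sum>i\<in>I. \<xi> i * b k i) ` S'"
        using ne by (intro Max_in) auto
      then obtain k where k: "k \<in> S'" "(MAX k\<in>S'. \<Sum>i\<in>I. \<xi> i * b k i) = (\<Sum>i\<in>I. \<xi> i * b k i)"
        by auto
      have "(\<Sum>i\<in>I. \<xi> i * v k i) \<le> (MAX k\<in>T. \<Sum>i\<in>I. \<xi> i * v k i)"
        using k ne T by (intro Max_ge) auto
      thus "(MAX k\<in>S'. \<Sum>i\<in>I. \<xi> i * b k i) \<le> (MAX k\<in>T. \<Sum>i\<in>I. \<xi> i * v k i) - (\<Sum>i\<in>I. \<xi> i * u i)"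
        unfolding k(2) by (simp add: b_def right_diff_distrib sum_subtractf)
    qed
    also have "\<dots> = sign_average I (\<lambda>\<xi>. MAX k\<in>T. \<Sum>i\<in>I. \<xi> i * v k i)"
      by (simp add: sign_average_diff sign_average_linear[OF I])
    finally have *: "(\<tau> * a\<^sup>2 / 16 - 1 / \<tau>) / 12 - 1 - R\<^sup>2
        \<le> sign_average I (\<lambda>\<xi>. MAX k\<in>T. \<Sum>i\<in>I. \<xi> i * v k i)" .
    have "\<Lambda> \<le> z" if "12 * (\<bar>\<Lambda>\<bar> + 1 + R\<^sup>2) \<le> q" "q / 12 - 1 - R\<^sup>2 \<le> z" for q z :: real
      using that by (simp add: field_simps)
    from this[OF Q *] show ?thesis .
  qed
  show ?thesis
    by (rule exI[of _ "m ^ Suc N"], rule exI[of _ \<beta>]) (use main m(2) \<tau>(1) in \<open>auto simp: \<beta>_def\<close>)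
qed

section \<open>Tours\<close>

fun path_edges :: "nat list \<Rightarrow> nat set set" where
  "path_edges (a # b # r) = insert {a, b} (path_edges (b # r))"
| "path_edges _ = {}"

fun path_length :: "(nat \<Rightarrow> 'v::real_normed_vector) \<Rightarrow> nat list \<Rightarrow> real" where
  "path_length x (a # b # r) = norm (x a - x b) + path_length x (b # r)"
| "path_length x _ = 0"

definition cycle_edges :: "nat list \<Rightarrow> nat set set" where
  "cycle_edges vs = path_edges (vs @ [hd vs])"

text \<open>A function of the edge as a set, so that lengths can be summed over edge sets without
  choosing an orientation.\<close>

definition edge_length :: "(nat \<Rightarrow> 'v::real_normed_vector) \<Rightarrow> nat set \<Rightarrow> real" where
  "edge_length x e = norm (x (Min e) - x (Max e))"

definition neighbours :: "nat set set \<Rightarrow> nat \<Rightarrow> nat set" where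
  "neighbours G i = {j. j \<noteq> i \<and> {i, j} \<in> G}"

lemma edge_length_doubleton: "edge_length x {i, j} = norm (x i - x j)"
  unfolding edge_length_def by (cases "i \<le> j") (auto simp: norm_minus_commute max_def min_def)

lemma path_edges_append: "path_edges (xs @ a # ys) = path_edges (xs @ [a]) \<union> path_edges (a # ys)"
proof (induction xs)
  case (Cons c xs)
  thus ?case by (cases xs) auto
qed simp

lemma path_length_append:
  "path_length x (xs @ a # ys) = path_length x (xs @ [a]) + path_length x (a # ys)"
proof (induction xs)
  case (Cons c xs)
  thus ?case by (cases xs) auto
qed simp

lemma path_edges_snoc: "p \<noteq> [] \<Longrightarrow> path_edges (p @ [l]) = insert {last p, l} (path_edges p)"
  by (induction p rule: path_edges.induct) auto

lemma path_length_snoc: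
  "p \<noteq> [] \<Longrightarrow> path_length x (p @ [l]) = path_length x p + norm (x (last p) - x l)"
  by (induction p rule: path_edges.induct) auto

lemma path_edges_nth: "path_edges xs = {{xs ! i, xs ! Suc i} |i. Suc i < length xs}"
proof (induction xs rule: path_edges.induct)
  case (1 a b r)
  have "{{(a # b # r) ! i, (a # b # r) ! Suc i} |i. Suc i < length (a # b # r)}
      = insert {a, b} {{(b # r) ! i, (b # r) ! Suc i} |i. Suc i < length (b # r)}" (is "?L = ?R")
  proof (intro equalityI subsetI)
    fix e assume "e \<in> ?L"
    then obtain i where i: "e = {(a # b # r) ! i, (a # b # r) ! Suc i}" "Suc i < length (a # b # r)"
      by blast
    thus "e \<in> ?R" by (cases i) auto
  next
    fix e assume "e \<in> ?R"
    thus "e \<in> ?L"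
    proof
      assume "e = {a, b}"
      thus ?thesis by (intro CollectI exI[of _ 0]) auto
    next
      assume "e \<in> {{(b # r) ! i, (b # r) ! Suc i} |i. Suc i < length (b # r)}"
      then obtain i where "e = {(b # r) ! i, (b # r) ! Suc i}" "Suc i < length (b # r)" by blast
      thus ?thesis by (intro CollectI exI[of _ "Suc i"]) auto
    qed
  qed
  thus ?case using 1 by simp
qed auto

lemma path_length_cong:
  "(\<And>i. i \<in> set vs \<Longrightarrow> x i = y i) \<Longrightarrow> path_length x vs = path_length y vs"
  by (induction vs rule: path_edges.induct) auto

lemma hamiltonian_cycles_iff:
  "G \<in> hamiltonian_cycles n \<longleftrightarrow>
     (\<exists>vs. n \<ge> 3 \<and> length vs = n \<and> distinct vs \<and> set vs = {1..n} \<and> G = cycle_edges vs)"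
proof -
  have "{{vs ! i, vs ! (Suc i mod n)} |i. i < n} = cycle_edges vs" if "n \<ge> 3" "length vs = n" for vs
  proof -
    have "vs ! (Suc i mod n) = (vs @ [hd vs]) ! Suc i" if "i < n" for i
    proof -
      have "vs \<noteq> []" using \<open>n \<ge> 3\<close> \<open>length vs = n\<close> by auto
      thus ?thesis using that \<open>length vs = n\<close>
        by (cases "Suc i = n") (auto simp: nth_append hd_conv_nth)
    qed
    hence "{vs ! i, vs ! (Suc i mod n)} = {(vs @ [hd vs]) ! i, (vs @ [hd vs]) ! Suc i}" if "i < n" for i
      using that \<open>length vs = n\<close> by (simp add: nth_append)
    moreover have "Suc i < length (vs @ [hd vs]) \<longleftrightarrow> i < n" for i using \<open>length vs = n\<close> by simp
    ultimately show ?thesis unfolding cycle_edges_def path_edges_nth by blast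
  qed
  thus ?thesis unfolding hamiltonian_cycles_def by blast
qed

lemma cycle_edges_rotate: "cycle_edges (p @ a # q) = cycle_edges (a # q @ p)"
proof (cases p)
  case (Cons c p')
  show ?thesis unfolding cycle_edges_def Cons
    using path_edges_append[of "c # p'" a "q @ [c]"] path_edges_append[of "a # q" c "p' @ [a]"] by auto
qed simp

text \<open>Rotation puts any given vertex first. Its two neighbours are then the ends of the
  remaining list, and changes at that vertex become changes of lists.\<close>

lemma hamiltonian_cycle_from:
  assumes "G \<in> hamiltonian_cycles n" "l \<in> {1..n}"
  obtains p where "distinct (l # p)" "length p \<ge> 2" "set (l # p) = {1..n}" "G = cycle_edges (l # p)"
    "Suc (length p) = n"
proof -
  from assms(1) obtain vs where vs: "n \<ge> 3" "length vs = n" "distinct vs" "set vs = {1..n}"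
      "G = cycle_edges vs" by (auto simp: hamiltonian_cycles_iff)
  then obtain p q where pq: "vs = p @ l # q" using assms(2) by (metis split_list)
  show ?thesis
    by (rule that[of "q @ p"]) (use vs pq cycle_edges_rotate in auto)
qed

lemma path_edges_subset: "e \<in> path_edges vs \<Longrightarrow> e \<subseteq> set vs"
  by (induction vs rule: path_edges.induct) auto

lemma finite_path_edges [simp]: "finite (path_edges vs)"
  by (induction vs rule: path_edges.induct) auto

lemma path_edges_doubleton:
  "distinct vs \<Longrightarrow> e \<in> path_edges vs \<Longrightarrow> \<exists>i j. i \<in> set vs \<and> j \<in> set vs \<and> i \<noteq> j \<and> e = {i, j}"
  by (induction vs rule: path_edges.induct) fastforce+

lemma sum_path_edges: "distinct vs \<Longrightarrow> (\<Sum>e\<in>path_edges vs. edge_length x e) = path_length x vs"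
proof (induction vs rule: path_edges.induct)
  case (1 a b r)
  have "{a, b} \<notin> path_edges (b # r)" using path_edges_subset[of "{a, b}" "b # r"] 1(2) by auto
  thus ?case using 1 by (simp add: edge_length_doubleton)
qed auto

lemma cycle_edges_Cons:
  assumes "p \<noteq> []"
  shows "cycle_edges (l # p) = insert {l, hd p} (insert {last p, l} (path_edges p))"
proof -
  have "path_edges (p @ [l]) = insert {last p, l} (path_edges p)" by (rule path_edges_snoc[OF assms])
  moreover obtain b r where "p = b # r" using assms by (cases p) auto
  ultimately show ?thesis by (simp add: cycle_edges_def)
qed

lemma path_length_cycle:
  assumes "p \<noteq> []"
  shows "path_length x (l # p @ [l])
     = norm (x l - x (hd p)) + norm (x (last p) - x l) + path_length x p"
proof -
  have "path_length x (p @ [l]) = path_length x p + norm (x (last p) - x l)"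
    by (rule path_length_snoc[OF assms])
  moreover obtain b r where "p = b # r" using assms by (cases p) auto
  ultimately show ?thesis by simp
qed

lemma neighbours_cycle:
  assumes "distinct (l # p)" "p \<noteq> []"
  shows "neighbours (cycle_edges (l # p)) l = {hd p, last p}"
proof -
  have "{l, j} \<notin> path_edges p" for j using path_edges_subset[of "{l, j}" p] assms by auto
  thus ?thesis using assms unfolding neighbours_def cycle_edges_Cons[OF assms(2)]
    by (auto simp: doubleton_eq_iff)
qed

lemma hd_neq_last: "distinct p \<Longrightarrow> length p \<ge> 2 \<Longrightarrow> hd p \<noteq> last p"
  by (cases p) (auto split: if_splits)

lemma
  assumes "G \<in> hamiltonian_cycles n" "i \<in> {1..n}"
  shows card_neighbours: "card (neighbours G i) = 2"
    and neighbours_subset: "neighbours G i \<subseteq> {1..n} - {i}"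
    and finite_neighbours: "finite (neighbours G i)"
proof -
  obtain p where p: "distinct (i # p)" "length p \<ge> 2" "set (i # p) = {1..n}" "G = cycle_edges (i # p)"
    by (rule hamiltonian_cycle_from[OF assms])
  have ne: "p \<noteq> []" using p(2) by auto
  have N: "neighbours G i = {hd p, last p}" unfolding p(4) by (rule neighbours_cycle[OF p(1) ne])
  show "card (neighbours G i) = 2" using hd_neq_last[of p] p(1,2) by (simp add: N)
  show "neighbours G i \<subseteq> {1..n} - {i}" "finite (neighbours G i)"
    using p(1,3) ne hd_in_set[OF ne] last_in_set[OF ne] by (auto simp: N)
qed

lemma
  assumes "G \<in> hamiltonian_cycles n"
  shows hamiltonian_cycle_edge: "e \<in> G \<Longrightarrow> \<exists>i j. i \<in> {1..n} \<and> j \<in> {1..n} \<and> i \<noteq> j \<and> e = {i, j}"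
    and finite_hamiltonian_cycle: "finite G"
    and hamiltonian_cycle_ge3: "n \<ge> 3"
proof -
  show n: "n \<ge> 3" using assms by (auto simp: hamiltonian_cycles_iff)
  hence one: "1 \<in> {1..n}" by simp
  obtain p where p: "distinct (1 # p)" "length p \<ge> 2" "set (1 # p) = {1..n}" "G = cycle_edges (1 # p)"
    by (rule hamiltonian_cycle_from[OF assms one])
  have ne: "p \<noteq> []" using p(2) by auto
  show "finite G" by (simp add: p(4) cycle_edges_def)
  have hl: "hd p \<in> set p" "last p \<in> set p" "1 \<notin> set p" "hd p \<noteq> 1" "last p \<noteq> 1"
    using p(1) hd_in_set[OF ne] last_in_set[OF ne] by (auto simp del: hd_in_set last_in_set)
  have sub: "set p \<subseteq> {1..n}" "1 \<in> {1..n}" using p(3) by auto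
  show "\<exists>i j. i \<in> {1..n} \<and> j \<in> {1..n} \<and> i \<noteq> j \<and> e = {i, j}" if "e \<in> G"
  proof -
    have "e = {1, hd p} \<or> e = {last p, 1} \<or> e \<in> path_edges p"
      using that by (simp add: p(4) cycle_edges_Cons[OF ne])
    thus ?thesis
    proof (elim disjE)
      assume "e = {1, hd p}"
      thus ?thesis using hl sub by (intro exI[of _ 1] exI[of _ "hd p"]) auto
    next
      assume "e = {last p, 1}"
      thus ?thesis using hl sub by (intro exI[of _ "last p"] exI[of _ 1]) auto
    next
      assume "e \<in> path_edges p"
      then obtain i j where ij: "i \<in> set p" "j \<in> set p" "i \<noteq> j" "e = {i, j}"
        using path_edges_doubleton[of p e] p(1) by auto
      show ?thesis
        by (rule exI[of _ i], rule exI[of _ j]) (intro conjI subsetD[OF sub(1)] ij)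
    qed
  qed
qed

lemma tour_length_edges:
  assumes "\<And>e. e \<in> G \<Longrightarrow> \<exists>i j. i \<noteq> j \<and> e = {i, j}"
  shows "tour_length x G = (\<Sum>e\<in>G. edge_length x e)"
proof -
  have "bij_betw (\<lambda>(i, j). {i, j}) {(i, j). i < j \<and> {i, j} \<in> G} G"
    unfolding bij_betw_def
  proof
    show "inj_on (\<lambda>(i, j). {i, j}) {(i, j). i < j \<and> {i, j} \<in> G}"
      by (auto simp: inj_on_def doubleton_eq_iff)
    show "(\<lambda>(i, j). {i, j}) ` {(i, j). i < j \<and> {i, j} \<in> G} = G"
    proof (intro equalityI subsetI)
      fix e assume e: "e \<in> G"
      then obtain i j where ij: "i \<noteq> j" "e = {i, j}" using assms by blast
      have "e = (\<lambda>(i, j). {i, j}) (min i j, max i j)" using ij by (auto simp: min_def max_def)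
      moreover have "(min i j, max i j) \<in> {(i, j). i < j \<and> {i, j} \<in> G}"
        using ij e by (auto simp: min_def max_def insert_commute)
      ultimately show "e \<in> (\<lambda>(i, j). {i, j}) ` {(i, j). i < j \<and> {i, j} \<in> G}" by (rule image_eqI)
    qed auto
  qed
  from sum.reindex_bij_betw[OF this, of "edge_length x"]
  show ?thesis unfolding tour_length_def by (simp add: case_prod_unfold edge_length_doubleton)
qed

text \<open>With at least three vertices the two closing edges differ from each other and from the
  edges of the path, so no length is lost in passing from the list to the set of edges.\<close>

lemma tour_length_cycle:
  assumes "distinct (l # p)" "length p \<ge> 2"
  shows "tour_length x (cycle_edges (l # p)) = path_length x (l # p @ [l])"
proof -
  have ne: "p \<noteq> []" using assms(2) by auto
  have hl: "hd p \<in> set p" "last p \<in> set p" using ne by auto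
  have nin: "{l, hd p} \<notin> path_edges p" "{last p, l} \<notin> path_edges p"
    using path_edges_subset[of "{l, hd p}" p] path_edges_subset[of "{last p, l}" p] assms by auto
  have neq: "{l, hd p} \<noteq> {last p, l}"
    using hd_neq_last[of p] assms hl by (auto simp: doubleton_eq_iff)
  have "tour_length x (cycle_edges (l # p)) = (\<Sum>e\<in>cycle_edges (l # p). edge_length x e)"
  proof (rule tour_length_edges)
    fix e assume "e \<in> cycle_edges (l # p)"
    hence "e = {l, hd p} \<or> e = {last p, l} \<or> e \<in> path_edges p"
      by (simp add: cycle_edges_Cons[OF ne])
    thus "\<exists>i j. i \<noteq> j \<and> e = {i, j}"
    proof (elim disjE)
      assume "e = {l, hd p}"
      thus ?thesis using hl assms(1) by (intro exI[of _ l] exI[of _ "hd p"]) auto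
    next
      assume "e = {last p, l}"
      thus ?thesis using hl assms(1) by (intro exI[of _ "last p"] exI[of _ l]) auto
    next
      assume "e \<in> path_edges p"
      thus ?thesis using path_edges_doubleton[of p e] assms(1) by auto
    qed
  qed
  also have "\<dots> = path_length x (l # p @ [l])"
    unfolding cycle_edges_Cons[OF ne] path_length_cycle[OF ne]
    using nin neq sum_path_edges[of p x] assms by (simp add: edge_length_doubleton)
  finally show ?thesis .
qed

text \<open>Cut \<open>l\<close> out of the tour, close the gap, and reinsert \<open>l\<close> next to \<open>a\<close>.\<close>

lemma reinsert_vertex:
  assumes G: "G \<in> hamiltonian_cycles n" and l: "l \<in> {1..n}" and a: "a \<in> {1..n}" "a \<noteq> l"
  shows "\<exists>G'\<in>hamiltonian_cycles n. card (G - G' \<union> (G' - G)) \<le> 6 \<and>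
    (\<forall>x y :: nat \<Rightarrow> 'v::real_normed_vector. (\<forall>i\<in>{1..n} - {l}. x i = y i) \<longrightarrow>
       tour_length x G' \<le> tour_length y G + 2 * norm (x l - x a))"
proof -
  obtain p where p: "distinct (l # p)" "length p \<ge> 2" "set (l # p) = {1..n}" "G = cycle_edges (l # p)"
      "Suc (length p) = n"
    by (rule hamiltonian_cycle_from[OF G l])
  have ne: "p \<noteq> []" using p(2) by auto
  have "a \<in> set (l # p)" unfolding p(3) by (rule a(1))
  hence "a \<in> set p" using a(2) by simp
  then obtain p1 p2 where p12: "p = p1 @ a # p2" by (metis split_list)
  define c where "c = hd (p1 @ [a])"
  \<comment> \<open>\<open>b\<close> is the successor of \<open>a\<close> in the cycle without
    \<open>l\<close>. If \<open>p2\<close> is empty, \<open>a\<close> is the last vertex and its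
    successor is the head \<open>c\<close>.\<close>
  obtain b r where br: "p2 @ [c] = b # r" by (cases p2) auto
  have hdp: "hd p = c" by (cases p1) (auto simp: c_def p12)
  define G' where "G' = cycle_edges (l # p2 @ p1 @ [a])"
  have G': "G' = cycle_edges (p1 @ a # l # p2)"
    unfolding G'_def using cycle_edges_rotate[of "p1 @ [a]" l p2] by simp
  have HG: "G' \<in> hamiltonian_cycles n"
    unfolding hamiltonian_cycles_iff G' using p hamiltonian_cycle_ge3[OF G]
    by (intro exI[of _ "p1 @ a # l # p2"]) (auto simp: p12)
  have card6: "card (G - G' \<union> (G' - G)) \<le> 6"
  proof -
    have c1: "cycle_edges p = insert {last p, hd p} (path_edges p)"
      unfolding cycle_edges_def by (rule path_edges_snoc[OF ne])
    have c2: "cycle_edges p = path_edges (p1 @ [a]) \<union> insert {a, b} (path_edges (b # r))"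
      using path_edges_append[of p1 a "p2 @ [c]"] br hdp
      by (simp add: cycle_edges_def p12)
    have c3: "G' = path_edges (p1 @ [a]) \<union> insert {a, l} (insert {l, b} (path_edges (b # r)))"
      using path_edges_append[of p1 a "l # p2 @ [c]"] br
      by (simp add: G' cycle_edges_def c_def[symmetric] hd_append split: if_splits)
        (auto simp: c_def hd_append split: if_splits)
    have c4: "G = insert {l, hd p} (insert {last p, l} (path_edges p))"
      unfolding p(4) by (rule cycle_edges_Cons[OF ne])
    \<comment> \<open>Deleting \<open>l\<close> trades its two edges for the edge from
      \<open>last p\<close> to \<open>hd p\<close>; inserting it after \<open>a\<close> trades the
      edge from \<open>a\<close> to \<open>b\<close> for two edges at \<open>l\<close>. That makes
      six edges in all.\<close>
    have "G - G' \<union> (G' - G) \<subseteq> {{l, hd p}, {last p, l}, {a, b}, {a, l}, {l, b}, {last p, hd p}}"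
    proof
      fix e assume e: "e \<in> G - G' \<union> (G' - G)"
      have "e \<in> cycle_edges p \<Longrightarrow> e \<in> G' \<or> e = {a, b}" unfolding c2 c3 by auto
      moreover have "e \<in> cycle_edges p \<Longrightarrow> e \<in> G \<or> e = {last p, hd p}" unfolding c1 c4 by auto
      moreover have "e \<in> G \<Longrightarrow> e \<in> cycle_edges p \<or> e = {l, hd p} \<or> e = {last p, l}"
        unfolding c1 c4 by auto
      moreover have "e \<in> G' \<Longrightarrow> e \<in> cycle_edges p \<or> e = {a, l} \<or> e = {l, b}"
        unfolding c2 c3 by auto
      moreover have "(e \<in> G \<and> e \<notin> G') \<or> (e \<in> G' \<and> e \<notin> G)"
        using e by (simp only: Un_iff Diff_iff)
      ultimately show "e \<in> {{l, hd p}, {last p, l}, {a, b}, {a, l}, {l, b}, {last p, hd p}}"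
        unfolding insert_iff empty_iff by argo
    qed
    hence "card (G - G' \<union> (G' - G))
        \<le> card {{l, hd p}, {last p, l}, {a, b}, {a, l}, {l, b}, {last p, hd p}}"
      by (intro card_mono) auto
    also have "\<dots> \<le> 6"
      using card_length[of "[{l, hd p}, {last p, l}, {a, b}, {a, l}, {l, b}, {last p, hd p}]"] by simp
    finally show ?thesis .
  qed
  have len: "tour_length x G' \<le> tour_length y G + 2 * norm (x l - x a)"
    if xy: "\<forall>i\<in>{1..n} - {l}. x i = y i" for x y :: "nat \<Rightarrow> 'v::real_normed_vector"
  proof -
    have "path_length x p = path_length y p"
      using p(1,3) xy by (intro path_length_cong) auto
    moreover have xy2: "x (hd p) = y (hd p)" "x (last p) = y (last p)"
      using p(1,3) xy hd_in_set[OF ne] last_in_set[OF ne] by auto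
    moreover have "norm (x (last p) - x (hd p))
        \<le> norm (y l - y (hd p)) + norm (y (last p) - y l)"
      unfolding xy2 using norm_triangle_ineq[of "y l - y (hd p)" "y (last p) - y l"] by simp
    ultimately have *: "path_length x p + norm (x (last p) - x (hd p)) \<le> tour_length y G"
      unfolding p(4) tour_length_cycle[OF p(1,2)] path_length_cycle[OF ne] by simp
    have "tour_length x G' = path_length x (l # p2 @ p1 @ [a, l])"
      unfolding G'_def using tour_length_cycle[of l "p2 @ p1 @ [a]" x] p(1,2) by (simp add: p12 Int_commute)
    also have "\<dots> = norm (x l - x b) + path_length x (p2 @ p1 @ [a]) + norm (x a - x l)"
    proof -
      have hb: "hd (p2 @ p1 @ [a]) = b" using br by (cases p2) (auto simp: c_def)
      show ?thesis using path_length_cycle[of "p2 @ p1 @ [a]" x l] hb by simp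
    qed
    \<comment> \<open>The path \<open>p2 @ p1 @ [a]\<close> is the closed cycle through
      \<open>p\<close>, cut open at the edge from \<open>a\<close> to \<open>b\<close>.\<close>
    also have "path_length x (p2 @ p1 @ [a]) + norm (x a - x b)
        = path_length x p + norm (x (last p) - x (hd p))"
    proof (cases p2)
      case Nil
      thus ?thesis using br hdp by (simp add: p12)
    next
      case (Cons b' r')
      have bb: "b' = b" using br Cons by simp
      obtain d q where dq: "p1 @ [a] = d # q" by (cases "p1 @ [a]") auto
      have dc: "d = c" using dq by (simp add: c_def)
      have "path_length x (p2 @ p1 @ [a]) = path_length x (p2 @ [c]) + path_length x (p1 @ [a])"
        using path_length_append[of x p2 c q] dq dc by simp
      moreover have "path_length x (p2 @ [c]) = path_length x p2 + norm (x (last p2) - x c)"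
        using Cons by (intro path_length_snoc) auto
      moreover have "path_length x p = path_length x (p1 @ [a]) + norm (x a - x b) + path_length x p2"
        using path_length_append[of x p1 a p2] Cons bb by (simp add: p12)
      moreover have "last p = last p2" using Cons by (simp add: p12)
      ultimately show ?thesis using hdp by simp
    qed
    hence "norm (x l - x b) + path_length x (p2 @ p1 @ [a]) + norm (x a - x l)
        = path_length x p + norm (x (last p) - x (hd p))
          + (norm (x l - x b) + norm (x a - x l) - norm (x a - x b))" by simp
    also have "\<dots> \<le> tour_length y G + 2 * norm (x l - x a)"
    proof -
      have "norm (x l - x b) \<le> norm (x l - x a) + norm (x a - x b)"
        using norm_triangle_ineq[of "x l - x a" "x a - x b"] by simp
      thus ?thesis using * by (simp add: norm_minus_commute)
    qed
    finally show ?thesis .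
  qed
  show ?thesis
    by (rule bexI[OF _ HG], rule conjI[OF card6], intro allI impI, rule len)
qed

text \<open>Every edge is met once from each of its ends. This is the bridge from sums over edges,
  where lengths live, to sums over vertices, where the perturbations live.\<close>

lemma sum_over_tour:
  fixes \<phi> :: "nat \<Rightarrow> nat \<Rightarrow> 'b::comm_monoid_add"
  assumes "G \<in> hamiltonian_cycles n"
  shows "(\<Sum>(i, j)\<in>{(i, j). i < j \<and> {i, j} \<in> G}. \<phi> i j + \<phi> j i)
       = (\<Sum>i\<in>{1..n}. \<Sum>j\<in>neighbours G i. \<phi> i j)"
proof -
  have inI: "i \<in> {1..n} \<and> j \<in> {1..n}" if "{i, j} \<in> G" for i j
  proof -
    obtain k l where kl: "k \<in> {1..n} \<and> l \<in> {1..n} \<and> k \<noteq> l \<and> {i, j} = {k, l}"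
      using hamiltonian_cycle_edge[OF assms \<open>{i, j} \<in> G\<close>] by (elim exE)
    hence "{i, j} \<subseteq> {1..n}" by simp
    thus ?thesis by simp
  qed
  define E where "E = {(i, j). i < j \<and> {i, j} \<in> G}"
  define E' where "E' = {(i, j). j < i \<and> {i, j} \<in> G}"
  have "E \<subseteq> {1..n} \<times> {1..n}" "E' \<subseteq> {1..n} \<times> {1..n}"
    unfolding E_def E'_def using inI by blast+
  hence fin: "finite E" "finite E'" by (auto intro: finite_subset)
  have S: "Sigma {1..n} (neighbours G) = E \<union> E'"
  proof (intro equalityI subsetI)
    fix z assume "z \<in> Sigma {1..n} (neighbours G)"
    thus "z \<in> E \<union> E'" by (auto simp: E_def E'_def neighbours_def)
  next
    fix z assume z: "z \<in> E \<union> E'"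
    obtain i j where ij: "z = (i, j)" by (cases z)
    hence e: "i \<noteq> j" "{i, j} \<in> G" using z by (auto simp: E_def E'_def)
    have "i \<in> {1..n}" using inI[OF e(2)] by (rule conjunct1)
    thus "z \<in> Sigma {1..n} (neighbours G)" using e unfolding ij neighbours_def by simp
  qed
  have "(\<Sum>i\<in>{1..n}. \<Sum>j\<in>neighbours G i. \<phi> i j) = (\<Sum>(i, j)\<in>Sigma {1..n} (neighbours G). \<phi> i j)"
    using finite_neighbours[OF assms] by (intro sum.Sigma) auto
  also have "\<dots> = (\<Sum>(i, j)\<in>E. \<phi> i j) + (\<Sum>(i, j)\<in>E'. \<phi> i j)"
    unfolding S using fin by (intro sum.union_disjoint) (auto simp: E_def E'_def)
  also have "(\<Sum>(i, j)\<in>E'. \<phi> i j) = (\<Sum>(i, j)\<in>E. \<phi> j i)"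
    by (rule sum.reindex_bij_witness[of _ prod.swap prod.swap])
       (auto simp: E_def E'_def insert_commute)
  finally show ?thesis by (simp add: E_def sum.distrib case_prod_unfold)
qed

lemma card_tour_edges:
  assumes "G \<in> hamiltonian_cycles n"
  shows "card {(i, j). i < j \<and> {i, j} \<in> G} = n"
proof -
  have "2 * card {(i, j). i < j \<and> {i, j} \<in> G} = 2 * n"
    using sum_over_tour[OF assms, of "\<lambda>_ _. 1::nat"] card_neighbours[OF assms]
    by (simp add: case_prod_unfold)
  thus ?thesis by simp
qed

lemma tour_length_neighbours:
  assumes "G \<in> hamiltonian_cycles n"
  shows "2 * tour_length x G = (\<Sum>i\<in>{1..n}. \<Sum>j\<in>neighbours G i. norm (x i - x j))"
  using sum_over_tour[OF assms, of "\<lambda>i j. norm (x i - x j)"]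
  by (simp add: tour_length_def sum_distrib_left case_prod_unfold norm_minus_commute)

section \<open>Optimal tours\<close>

lemma tour_length_nonneg: "tour_length x G \<ge> 0"
  unfolding tour_length_def by (intro sum_nonneg) auto

lemma finite_hamiltonian_cycles: "finite (hamiltonian_cycles n)"
proof (rule finite_subset)
  show "hamiltonian_cycles n \<subseteq> Pow (Pow {1..n})"
    using hamiltonian_cycle_edge by fastforce
qed auto

lemma hamiltonian_cycles_nonempty: "n \<ge> 3 \<Longrightarrow> hamiltonian_cycles n \<noteq> {}"
proof -
  assume "n \<ge> 3"
  hence "cycle_edges [1..<Suc n] \<in> hamiltonian_cycles n"
    unfolding hamiltonian_cycles_iff by (intro exI[of _ "[1..<Suc n]"]) (auto simp del: upt_Suc)
  thus ?thesis by auto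
qed

text \<open>For n \<le> 2 there are no cycles and \<open>Min\<close> is applied to the empty set, so
  the value carries information only for n \<ge> 3.\<close>

definition optimal_length :: "nat \<Rightarrow> (nat \<Rightarrow> 'v::real_normed_vector) \<Rightarrow> real" where
  "optimal_length n x = (MIN G\<in>hamiltonian_cycles n. tour_length x G)"

lemma optimal_length_le: "G \<in> hamiltonian_cycles n \<Longrightarrow> optimal_length n x \<le> tour_length x G"
  unfolding optimal_length_def using finite_hamiltonian_cycles by (intro Min_le) auto

lemma
  assumes "n \<ge> 3"
  shows optimal_tour: "optimal_tour n x \<in> hamiltonian_cycles n"
    and tour_length_optimal_tour: "tour_length x (optimal_tour n x) = optimal_length n x"
proof -
  note fin = finite_hamiltonian_cycles[of n] and ne = hamiltonian_cycles_nonempty[OF assms]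
  show *: "optimal_tour n x \<in> hamiltonian_cycles n"
    unfolding optimal_tour_def by (rule arg_min_if_finite[OF fin ne])
  have "tour_length x (optimal_tour n x) \<le> tour_length x G" if "G \<in> hamiltonian_cycles n" for G
    using arg_min_if_finite(2)[OF fin ne, of "tour_length x"] that
    unfolding optimal_tour_def by (meson not_less)
  thus "tour_length x (optimal_tour n x) = optimal_length n x"
    unfolding optimal_length_def using fin ne * by (intro Min_eqI[symmetric]) auto
qed

lemma optimal_length_nonneg: "n \<ge> 3 \<Longrightarrow> optimal_length n x \<ge> 0"
  by (metis tour_length_optimal_tour tour_length_nonneg)

lemma tour_length_cong:
  assumes "G \<in> hamiltonian_cycles n" "\<And>i. i \<in> {1..n} \<Longrightarrow> x i = y i"
  shows "tour_length x G = tour_length y G"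
proof -
  have "2 * tour_length x G = 2 * tour_length y G"
    unfolding tour_length_neighbours[OF assms(1)]
    using assms(2) neighbours_subset[OF assms(1)] by (intro sum.cong refl) (metis DiffD1 subsetD)
  thus ?thesis by simp
qed

lemma optimal_length_cong:
  assumes "\<And>i. i \<in> {1..n} \<Longrightarrow> x i = y i"
  shows "optimal_length n x = optimal_length n y"
  unfolding optimal_length_def
  by (intro arg_cong[of _ _ Min] image_cong refl tour_length_cong[OF _ assms])

section \<open>Small sets in Euclidean space\<close>

text \<open>If a is long compared with s, then 2 |a| |a + b| \<le> |a|^2 + |a + b|^2 yields the
  linear term with the error |b|^2 / (2 |a|). If a is short, the capped error equals 4 s and the
  triangle inequality is enough. The cap keeps the error bounded when two points nearly
  coincide.\<close>

lemma norm_add_le_sgn: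
  fixes a b :: "'v::real_inner"
  assumes s: "s > 0" and b: "norm b \<le> 2 * s"
  shows "norm (a + b) \<le> norm a + b \<bullet> sgn a + 8 * s\<^sup>2 / max (norm a) (2 * s)"
proof (cases "norm a < 2 * s")
  case True
  have "\<bar>b \<bullet> sgn a\<bar> \<le> norm b * norm (sgn a)" by (rule Cauchy_Schwarz_ineq2)
  also have "\<dots> \<le> norm b * 1" by (intro mult_left_mono) (auto simp: norm_sgn)
  finally have "- norm b \<le> b \<bullet> sgn a" by linarith
  moreover have "8 * s\<^sup>2 / max (norm a) (2 * s) = 4 * s"
    using True s by (simp add: power2_eq_square)
  ultimately show ?thesis using norm_triangle_ineq[of a b] b by linarith
next
  case False
  hence a: "norm a \<ge> 2 * s" "norm a > 0" using s by linarith+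
  have ab: "b \<bullet> sgn a = a \<bullet> b / norm a" by (simp add: sgn_div_norm inner_commute divide_inverse)
  have n2: "(norm (a + b))\<^sup>2 = (norm a)\<^sup>2 + 2 * (a \<bullet> b) + (norm b)\<^sup>2"
    by (simp add: power2_norm_eq_inner inner_add_left inner_add_right inner_commute)
  have "0 \<le> (norm (a + b) - norm a)\<^sup>2" by simp
  hence "2 * norm a * norm (a + b) \<le> (norm (a + b))\<^sup>2 + (norm a)\<^sup>2"
    by (simp add: power2_diff mult_ac)
  also have "\<dots> = 2 * norm a * (norm a + a \<bullet> b / norm a + (norm b)\<^sup>2 / (2 * norm a))"
    using a(2) unfolding n2 by (simp add: field_simps power2_eq_square)
  finally have "norm (a + b) \<le> norm a + a \<bullet> b / norm a + (norm b)\<^sup>2 / (2 * norm a)"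
    using a(2) by simp
  moreover have "(norm b)\<^sup>2 / (2 * norm a) \<le> 8 * s\<^sup>2 / norm a"
  proof -
    have "(norm b)\<^sup>2 \<le> (2 * s)\<^sup>2" using b by (intro power_mono) auto
    also have "(2 * s)\<^sup>2 = 4 * s\<^sup>2" by (simp add: power_mult_distrib)
    finally have "(norm b)\<^sup>2 \<le> 16 * s\<^sup>2" using zero_le_power2[of s] by linarith
    thus ?thesis using a(2) by (simp add: field_simps)
  qed
  ultimately show ?thesis using a ab by (simp add: max_def)
qed

section \<open>Volumes of slabs and cones\<close>

lemma emeasure_lborel_vimage_minus:
  fixes v :: "'v::euclidean_space"
  assumes "S \<in> sets borel"
  shows "emeasure lborel {z. z - v \<in> S} = emeasure lborel S"
proof -
  have "emeasure lborel S = emeasure (distr lborel borel ((+) (- v))) S"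
    by (simp add: lborel_distr_plus)
  also have "\<dots> = emeasure lborel ((+) (- v) -` S \<inter> space lborel)"
    using assms by (intro emeasure_distr) auto
  also have "(+) (- v) -` S \<inter> space lborel = {z. z - v \<in> S}" by auto
  finally show ?thesis by simp
qed

text \<open>The m translates of S by multiples of r / m along e are disjoint and lie in the ball of
  radius 2 r, so each of them has at most the m-th part of its volume.\<close>

lemma emeasure_le_of_disjoint_translates:
  fixes S :: "'v::euclidean_space set"
  assumes S: "S \<in> sets borel" "S \<subseteq> cball 0 r" and r: "r > 0" and e: "norm e = 1" and m: "m > 0"
    and disj: "\<And>z t. z \<in> S \<Longrightarrow> r / real m \<le> t \<Longrightarrow> z + t *\<^sub>R e \<notin> S"
  shows "emeasure lborel S \<le> ennreal (unit_ball_vol (DIM('v)) * (2 * r) ^ DIM('v) / m)"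
proof -
  define T where "T = (\<lambda>j::nat. {z. z - (j * (r / m)) *\<^sub>R e \<in> S})"
  have T: "T j \<in> sets borel" for j unfolding T_def using S(1) by measurable
  have "disjoint_family_on T {..<m}"
    unfolding disjoint_family_on_def
  proof (intro ballI impI)
    have *: "T i \<inter> T j = {}" if "i < j" for i j
    proof (rule ccontr)
      assume "T i \<inter> T j \<noteq> {}"
      then obtain z where z: "z - (i * (r / m)) *\<^sub>R e \<in> S" "z - (j * (r / m)) *\<^sub>R e \<in> S"
        by (auto simp: T_def)
      have "1 * (r / m) \<le> (real j - real i) * (r / m)"
        using that r by (intro mult_right_mono) auto
      from disj[OF z(2), of "(real j - real i) * (r / m)"] this z(1) show False
        by (simp add: algebra_simps)
    qed
    show "T i \<inter> T j = {}" if "i \<noteq> j" for i j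
      using *[of i j] *[of j i] that by (cases i j rule: linorder_cases) auto
  qed
  hence "(\<Sum>j<m. emeasure lborel (T j)) = emeasure lborel (\<Union>j<m. T j)"
    using T by (intro sum_emeasure) auto
  also have "\<dots> \<le> emeasure lborel (cball (0::'v) (2 * r))"
  proof (rule emeasure_mono)
    show "(\<Union>j<m. T j) \<subseteq> cball 0 (2 * r)"
    proof safe
      fix j z assume j: "j < m" and z: "z \<in> T j"
      have "norm (z - (j * (r / m)) *\<^sub>R e) \<le> r" using z S(2) by (auto simp: T_def)
      moreover have "norm ((j * (r / m)) *\<^sub>R e) \<le> r"
      proof -
        have "j * (r / m) \<le> m * (r / m)" using j r m by (intro mult_right_mono) auto
        thus ?thesis using e r m by simp
      qed
      ultimately show "z \<in> cball 0 (2 * r)"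
        using norm_triangle_ineq[of "z - (j * (r / m)) *\<^sub>R e" "(j * (r / m)) *\<^sub>R e"] by simp
    qed
  qed auto
  also have "\<dots> = ennreal (unit_ball_vol (DIM('v)) * (2 * r) ^ DIM('v))"
    using r by (intro emeasure_cball) simp
  finally have "of_nat m * emeasure lborel S \<le> ennreal (unit_ball_vol (DIM('v)) * (2 * r) ^ DIM('v))"
    by (simp add: T_def emeasure_lborel_vimage_minus[OF S(1)])
  hence "ennreal (1 / m) * (of_nat m * emeasure lborel S)
      \<le> ennreal (1 / m) * ennreal (unit_ball_vol (DIM('v)) * (2 * r) ^ DIM('v))"
    by (intro mult_left_mono) auto
  moreover have "ennreal (1 / m) * of_nat m = 1"
    using m by (simp add: ennreal_of_nat_eq_real_of_nat flip: ennreal_mult)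
  moreover have "ennreal (1 / m) * ennreal (unit_ball_vol (DIM('v)) * (2 * r) ^ DIM('v))
      = ennreal (1 / m * (unit_ball_vol (DIM('v)) * (2 * r) ^ DIM('v)))"
    using r by (intro ennreal_mult[symmetric]) auto
  ultimately show ?thesis by (simp add: mult.assoc[symmetric])
qed

text \<open>The function y / sqrt (y^2 + q) has derivative q / (y^2 + q)^(3/2), which is at least q
  / r^3 as long as the norm stays below r; the proof is algebraic. Here y is the coordinate of a
  vector along an axis and q the squared norm of the rest.\<close>

lemma slope_normalized_ge:
  fixes \<alpha> \<beta> q r A B :: real
  assumes q: "q > 0" and t: "\<alpha> < \<beta>" and A: "A\<^sup>2 = \<alpha>\<^sup>2 + q" "0 \<le> A" "A \<le> r"
    and B: "B\<^sup>2 = \<beta>\<^sup>2 + q" "0 \<le> B" "B \<le> r"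
  shows "(\<beta> - \<alpha>) * q / r ^ 3 \<le> \<beta> / B - \<alpha> / A"
proof -
  define t P D where "t = \<beta> - \<alpha>" and "P = A * B" and "D = \<alpha> * \<beta> + q"
  have "A \<noteq> 0"
  proof
    assume "A = 0"
    hence "\<alpha>\<^sup>2 + q = 0" using A(1) by simp
    thus False using q zero_le_power2[of \<alpha>] by linarith
  qed
  hence A0: "A > 0" using A(2) by simp
  have "B \<noteq> 0"
  proof
    assume "B = 0"
    hence "\<beta>\<^sup>2 + q = 0" using B(1) by simp
    thus False using q zero_le_power2[of \<beta>] by linarith
  qed
  hence B0: "B > 0" using B(2) by simp
  have P0: "P > 0" and r0: "r > 0" using A0 B0 A(3) by (auto simp: P_def)
  have t0: "t > 0" using t by (simp add: t_def)
  have "P\<^sup>2 = (\<alpha>\<^sup>2 + q) * (\<beta>\<^sup>2 + q)" by (simp add: P_def power_mult_distrib A B)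
  \<comment> \<open>Lagrange's identity for the plane vectors (\<alpha>, sqrt q) and (\<beta>, sqrt
    q): \<open>P\<close> is the product of their norms, \<open>D\<close> their inner
    product.\<close>
  hence PD: "P\<^sup>2 - D\<^sup>2 = q * t\<^sup>2" by (simp add: D_def t_def power2_eq_square algebra_simps)
  moreover have "q * t\<^sup>2 \<ge> 0" using q by simp
  ultimately have "D\<^sup>2 \<le> P\<^sup>2" by linarith
  hence DP: "D \<le> P" by (rule power2_le_imp_le[OF _ less_imp_le[OF P0]])
  have "q * t\<^sup>2 = (P - D) * (P + D)" using PD by (simp add: power2_eq_square algebra_simps)
  also have "\<dots> \<le> (P - D) * (2 * P)" using DP by (intro mult_left_mono) auto
  finally have PmD: "q * t\<^sup>2 / (2 * P) \<le> P - D" using P0 by (simp add: field_simps)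
  have "t * (\<beta> / B - \<alpha> / A) * P = t * \<beta> * A - t * \<alpha> * B"
    using A0 B0 by (simp add: P_def field_simps)
  also have "\<dots> = A * (B\<^sup>2 - D) + B * (A\<^sup>2 - D)"
    unfolding A(1) B(1) by (simp add: t_def D_def power2_eq_square algebra_simps)
  also have "\<dots> = (A + B) * (P - D)" by (simp add: P_def power2_eq_square algebra_simps)
  finally have "t * (\<beta> / B - \<alpha> / A) = (A + B) * (P - D) / P" using P0 by (simp add: field_simps)
  also have "\<dots> \<ge> (A + B) * (q * t\<^sup>2 / (2 * P)) / P"
    using PmD A0 B0 P0 by (intro divide_right_mono mult_left_mono) auto
  also have "(A + B) * (q * t\<^sup>2 / (2 * P)) / P = t * (t * q * ((1 / (A * B * B) + 1 / (A * A * B)) / 2))"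
    using A0 B0 by (simp add: P_def power2_eq_square field_simps)
  finally have "t * q * ((1 / (A * B * B) + 1 / (A * A * B)) / 2) \<le> \<beta> / B - \<alpha> / A"
    using t0 by simp
  moreover have "1 / r ^ 3 \<le> (1 / (A * B * B) + 1 / (A * A * B)) / 2"
  proof -
    have "A * B * B \<le> r * r * r" "A * A * B \<le> r * r * r"
      using A B A0 B0 r0 by (intro mult_mono; auto)+
    hence "1 / (r * r * r) \<le> 1 / (A * B * B)" "1 / (r * r * r) \<le> 1 / (A * A * B)"
      using A0 B0 by (intro frac_le; simp)+
    thus ?thesis by (simp add: power3_eq_cube)
  qed
  hence "t * q * (1 / r ^ 3) \<le> t * q * ((1 / (A * B * B) + 1 / (A * A * B)) / 2)"
    using t0 q by (intro mult_left_mono) auto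
  ultimately have "t * q * (1 / r ^ 3) \<le> \<beta> / B - \<alpha> / A" by (rule order_trans[rotated])
  thus ?thesis by (simp add: t_def)
qed

lemma inner_Basis_sq_le:
  fixes a \<theta> \<theta>' :: "'v::euclidean_space"
  assumes "\<theta> \<in> Basis" "\<theta>' \<in> Basis" "\<theta> \<noteq> \<theta>'"
  shows "(a \<bullet> \<theta>)\<^sup>2 + (a \<bullet> \<theta>')\<^sup>2 \<le> (norm a)\<^sup>2"
proof -
  have "(a \<bullet> \<theta>)\<^sup>2 + (a \<bullet> \<theta>')\<^sup>2 = (\<Sum>b\<in>{\<theta>, \<theta>'}. (a \<bullet> b)\<^sup>2)" using assms by simp
  also have "\<dots> \<le> (\<Sum>b\<in>Basis. (a \<bullet> b)\<^sup>2)" using assms by (intro sum_mono2) auto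
  also have "\<dots> = (norm a)\<^sup>2" 
    unfolding power2_norm_eq_inner by (subst euclidean_inner) (simp add: power2_eq_square)
  finally show ?thesis .
qed

text \<open>Moving z along \<theta> increases the \<theta>-component of its direction at a rate that
  degenerates only near the axis. A slab around the hyperplane orthogonal to \<theta>' contains that
  axis and is thin in the direction \<theta>', which is where the second basis vector comes in;
  outside the slab, translation along \<theta> leaves the set.\<close>

lemma emeasure_cone_le:
  fixes \<theta> \<theta>' :: "'v::euclidean_space"
  assumes B: "\<theta> \<in> Basis" "\<theta>' \<in> Basis" "\<theta> \<noteq> \<theta>'" and r: "r > 0" and m: "m > 0"
    and \<kappa>: "\<kappa> \<le> 1 / (8 * real m ^ 3)"
  shows "emeasure lborel {z. norm z \<le> r \<and> \<bar>sgn z \<bullet> \<theta> - c\<bar> < \<kappa>}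
    \<le> ennreal (2 * unit_ball_vol (DIM('v)) * (2 * r) ^ DIM('v) / m)"
proof -
  define S1 where "S1 = {z::'v. norm z \<le> r \<and> \<bar>z \<bullet> \<theta>'\<bar> < r / (2 * m)}"
  define S2 where "S2 = {z::'v. norm z \<le> r \<and> \<bar>sgn z \<bullet> \<theta> - c\<bar> < \<kappa> \<and> r / (2 * m) \<le> \<bar>z \<bullet> \<theta>'\<bar>}"
  define V where "V = unit_ball_vol (DIM('v)) * (2 * r) ^ DIM('v) / m"
  have V: "V \<ge> 0" using r by (simp add: V_def)
  have sgn_meas: "(\<lambda>z::'v. sgn z) \<in> borel_measurable borel"
    unfolding sgn_div_norm by measurable
  have S1m: "S1 \<in> sets borel" unfolding S1_def by measurable
  have S2m: "S2 \<in> sets borel" unfolding S2_def using sgn_meas by measurable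
  have "emeasure lborel S1 \<le> ennreal V"
    unfolding V_def
  proof (rule emeasure_le_of_disjoint_translates[OF S1m _ r _ m])
    show "S1 \<subseteq> cball 0 r" by (auto simp: S1_def)
    show "norm \<theta>' = 1" using B by simp
    fix z t assume z: "z \<in> S1" and t: "r / real m \<le> t"
    show "z + t *\<^sub>R \<theta>' \<notin> S1"
    proof
      assume "z + t *\<^sub>R \<theta>' \<in> S1"
      hence "\<bar>z \<bullet> \<theta>' + t\<bar> < r / (2 * m)" using B by (simp add: S1_def inner_add_left)
      moreover have "\<bar>z \<bullet> \<theta>'\<bar> < r / (2 * m)" using z by (simp add: S1_def)
      ultimately have "t < r / (2 * m) + r / (2 * m)" by linarith
      thus False using t by (simp add: field_simps)
    qed
  qed
  moreover have "emeasure lborel S2 \<le> ennreal V"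
    unfolding V_def
  proof (rule emeasure_le_of_disjoint_translates[OF S2m _ r _ m])
    show "S2 \<subseteq> cball 0 r" by (auto simp: S2_def)
    show "norm \<theta> = 1" using B by simp
    fix z t assume z: "z \<in> S2" and t: "r / real m \<le> t"
    show "z + t *\<^sub>R \<theta> \<notin> S2"
    proof
      define b where "b = z + t *\<^sub>R \<theta>"
      assume "z + t *\<^sub>R \<theta> \<in> S2"
      hence bS: "b \<in> S2" by (simp add: b_def)
      define q where "q = (norm z)\<^sup>2 - (z \<bullet> \<theta>)\<^sup>2"
      have bth: "b \<bullet> \<theta> = z \<bullet> \<theta> + t" using B by (simp add: b_def inner_add_left)
      have nb: "(norm b)\<^sup>2 = (b \<bullet> \<theta>)\<^sup>2 + q"
      proof -
        have "\<theta> \<bullet> \<theta> = 1" using B by simp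
        hence "b \<bullet> b = z \<bullet> z + 2 * t * (z \<bullet> \<theta>) + t * t"
          by (simp add: b_def inner_add_left inner_add_right inner_commute algebra_simps)
        thus ?thesis unfolding bth q_def power2_norm_eq_inner
          by (simp add: power2_eq_square algebra_simps)
      qed
      have y: "r / (2 * m) \<le> \<bar>z \<bullet> \<theta>'\<bar>" using z by (simp add: S2_def)
      have "(r / (2 * m))\<^sup>2 \<le> \<bar>z \<bullet> \<theta>'\<bar>\<^sup>2" using y r by (intro power_mono) auto
      hence q1: "(r / (2 * m))\<^sup>2 \<le> q"
        using inner_Basis_sq_le[OF B, of z] by (simp add: q_def)
      have rm: "r / m > 0" "r / (2 * m) > 0" using r m by auto
      have q0: "q > 0" using q1 rm(2) by (smt (verit) zero_less_power)
      have t0: "t > 0" using t rm(1) by linarith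
      have "(b \<bullet> \<theta> - z \<bullet> \<theta>) * q / r ^ 3 \<le> b \<bullet> \<theta> / norm b - z \<bullet> \<theta> / norm z"
        by (rule slope_normalized_ge)
          (use q0 t0 bth nb z bS in \<open>auto simp: q_def S2_def\<close>)
      also have "\<dots> = sgn b \<bullet> \<theta> - sgn z \<bullet> \<theta>" by (simp add: sgn_div_norm divide_inverse)
      also have "\<dots> < 2 * \<kappa>" using z bS by (auto simp: S2_def abs_less_iff)
      finally have "t * q / r ^ 3 < 2 * \<kappa>" by (simp add: bth)
      moreover have "(r / m) * (r / (2 * m))\<^sup>2 / r ^ 3 \<le> t * q / r ^ 3"
        using t q1 rm r q0 t0 by (intro divide_right_mono mult_mono) auto
      \<comment> \<open>A shift by at least r / m, at squared distance at least (r / (2 m))^2 from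
        the axis, changes the component by at least 1 / (4 m^3) \<ge> 2 \<kappa>, the width of the
        cone.\<close>
      moreover have "(r / m) * (r / (2 * m))\<^sup>2 / r ^ 3 = 1 / (4 * real m ^ 3)"
        using r m by (simp add: power2_eq_square power3_eq_cube field_simps)
      ultimately show False using \<kappa> by simp
    qed
  qed
  ultimately have "emeasure lborel S1 + emeasure lborel S2 \<le> ennreal V + ennreal V" by (rule add_mono)
  moreover have "emeasure lborel {z. norm z \<le> r \<and> \<bar>sgn z \<bullet> \<theta> - c\<bar> < \<kappa>} \<le> emeasure lborel (S1 \<union> S2)"
  proof (intro emeasure_mono subsetI)
    fix z assume "z \<in> {z. norm z \<le> r \<and> \<bar>sgn z \<bullet> \<theta> - c\<bar> < \<kappa>}"
    thus "z \<in> S1 \<union> S2"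
      by (cases "\<bar>z \<bullet> \<theta>'\<bar> < r / (2 * m)") (simp_all add: S1_def S2_def not_less)
  qed (use S1m S2m in simp)
  moreover have "emeasure lborel (S1 \<union> S2) \<le> emeasure lborel S1 + emeasure lborel S2"
    using S1m S2m by (intro emeasure_subadditive) auto
  ultimately have "emeasure lborel {z. norm z \<le> r \<and> \<bar>sgn z \<bullet> \<theta> - c\<bar> < \<kappa>} \<le> ennreal V + ennreal V"
    by (meson order_trans)
  also have "\<dots> = ennreal (V + V)" by (rule ennreal_plus[symmetric, OF V V])
  also have "V + V = 2 * unit_ball_vol (DIM('v)) * (2 * r) ^ DIM('v) / m" by (simp add: V_def)
  finally show ?thesis .
qed

lemma dyadic_scale:
  fixes M r :: real
  assumes "0 < M" "M < r"
  obtains j :: nat where "r * (1/2) ^ Suc j \<le> M" "M < r * (1/2) ^ j"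
proof -
  define Q where "Q = (\<lambda>j. r * (1/2) ^ Suc j \<le> M)"
  have r: "0 < r" using assms by linarith
  hence "0 < M / r" using assms by (intro divide_pos_pos)
  then obtain n where n: "(1/2::real) ^ n < M / r" using real_arch_pow_inv[of "M / r" "1/2"] by force
  have "r * (1/2) ^ n \<le> r * (M / r)" using n r by (intro mult_left_mono) auto
  hence "r * (1/2) ^ n \<le> M" using r by simp
  moreover have "r * (1/2) ^ Suc n \<le> r * (1/2) ^ n" using r by simp
  ultimately have ex: "Q n" by (simp add: Q_def)
  define j where "j = (LEAST j. Q j)"
  have "Q j" unfolding j_def using ex by (rule LeastI)
  moreover have "M < r * (1/2) ^ j"
  proof (cases j)
    case (Suc i)
    hence "\<not> Q i" using not_less_Least[of i Q] by (simp add: j_def)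
    thus ?thesis by (simp add: Q_def Suc)
  qed (use assms in auto)
  ultimately show ?thesis by (intro that[of j]) (simp_all only: Q_def)
qed

text \<open>A dyadic ball of radius r / 2^j contributes of order r^(d-1) 2^(-j (d-1)), summable
  since d \<ge> 2. The bound does not involve \<sigma>, which matters because \<sigma> will shrink
  with the step size.\<close>

lemma nn_integral_inverse_norm_le:
  assumes dim: "DIM('v::euclidean_space) \<ge> 2" and r: "r > 0" and \<sigma>: "\<sigma> > 0"
  shows "(\<integral>\<^sup>+ z. ennreal (indicat_real {z. norm z < r} z / max (norm z) \<sigma>) \<partial>(lborel :: 'v measure))
    \<le> ennreal (4 * unit_ball_vol (DIM('v)) * r ^ (DIM('v) - 1))"
proof -
  define d where "d = DIM('v)"
  define \<omega> where "\<omega> = unit_ball_vol (DIM('v))"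
  have \<omega>: "\<omega> \<ge> 0" by (simp add: \<omega>_def)
  \<comment> \<open>The j-th term dominates the integrand where \<open>max (norm z) \<sigma>\<close>
    lies between r / 2^(j+1) and r / 2^j; if \<sigma> \<ge> r, the term j = 0 suffices.\<close>
  define F where "F = (\<lambda>(j::nat) (z::'v). ennreal (2 ^ Suc j / r) * indicator (ball 0 (r * (1/2) ^ j)) z)"
  have "(\<integral>\<^sup>+ z. ennreal (indicat_real {z. norm z < r} z / max (norm z) \<sigma>) \<partial>(lborel :: 'v measure))
      \<le> (\<integral>\<^sup>+ z. (\<Sum>j. F j z) \<partial>lborel)"
  proof (rule nn_integral_mono)
    fix z :: 'v
    show "ennreal (indicat_real {z. norm z < r} z / max (norm z) \<sigma>) \<le> (\<Sum>j. F j z)"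
    proof (cases "norm z < r")
      case True
      define M where "M = max (norm z) \<sigma>"
      have "\<exists>j. norm z < r * (1/2) ^ j \<and> 1 / M \<le> 2 ^ Suc j / r"
      proof (cases "M < r")
        case Mr: True
        have "M > 0" using \<sigma> by (simp add: M_def)
        then obtain j where j: "r * (1/2) ^ Suc j \<le> M" "M < r * (1/2) ^ j"
          using dyadic_scale Mr by blast
        have "1 / M \<le> 1 / (r * (1/2) ^ Suc j)"
          using j r \<open>M > 0\<close> by (intro divide_left_mono) auto
        also have "\<dots> = 2 ^ Suc j / r" by (simp add: power_one_over field_simps)
        finally show ?thesis using j(2) by (intro exI[of _ j]) (auto simp: M_def)
      next
        case False
        hence "1 / M \<le> 1 / r" using r by (intro divide_left_mono) auto
        also have "\<dots> \<le> 2 / r" using r by (simp add: divide_right_mono)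
        finally show ?thesis using True by (intro exI[of _ 0]) auto
      qed
      then obtain j where j: "norm z < r * (1/2) ^ j" "1 / M \<le> 2 ^ Suc j / r" by blast
      have "ennreal (indicat_real {z. norm z < r} z / max (norm z) \<sigma>) \<le> F j z"
        using True j by (simp add: F_def M_def ennreal_leI)
      also have "\<dots> = (\<Sum>i\<in>{j}. F i z)" by simp
      also have "\<dots> \<le> (\<Sum>j. F j z)" by (rule sum_le_suminf) auto
      finally show ?thesis .
    qed simp
  qed
  also have "\<dots> = (\<Sum>j. \<integral>\<^sup>+ z. F j z \<partial>lborel)"
  proof (rule nn_integral_suminf)
    fix j
    have [measurable]: "ball (0::'v) (r * (1/2) ^ j) \<in> sets borel" by simp
    show "F j \<in> borel_measurable lborel"
      unfolding F_def by measurable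
  qed
  also have "\<dots> \<le> (\<Sum>j. ennreal (2 * \<omega> * r ^ (d - 1) * (1/2) ^ j))"
  proof (rule suminf_le)
    fix j
    have "(\<integral>\<^sup>+ z. F j z \<partial>lborel) = ennreal (2 ^ Suc j / r) * emeasure lborel (ball (0::'v) (r * (1/2) ^ j))"
      unfolding F_def by (subst nn_integral_cmult_indicator) auto
    also have "\<dots> = ennreal (2 ^ Suc j / r) * ennreal (\<omega> * (r * (1/2) ^ j) ^ d)"
      using r by (subst emeasure_ball) (auto simp: \<omega>_def d_def)
    also have "\<dots> = ennreal (2 ^ Suc j / r * (\<omega> * (r * (1/2) ^ j) ^ d))"
      using r \<omega> by (intro ennreal_mult[symmetric]) auto
    also have "\<dots> \<le> ennreal (2 * \<omega> * r ^ (d - 1) * (1/2) ^ j)"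
    proof (rule ennreal_leI)
      obtain e where e: "d = Suc (Suc e)" using dim unfolding d_def
        by (metis add_2_eq_Suc le_Suc_ex)
      have p: "(2::real) ^ j * (1/2) ^ j = 1" by (simp add: power_one_over)
      have "2 ^ Suc j / r * (\<omega> * (r * (1/2) ^ j) ^ d)
          = 2 * \<omega> * r ^ (d - 1) * (1/2) ^ j * ((1/2) ^ j) ^ e * (2 ^ j * (1/2) ^ j)"
        using r by (simp add: e power_mult_distrib field_simps)
      also have "\<dots> \<le> 2 * \<omega> * r ^ (d - 1) * (1/2) ^ j * 1 * 1"
        unfolding p using r \<omega> by (intro mult_right_mono mult_left_mono) (auto simp: power_le_one)
      finally show "2 ^ Suc j / r * (\<omega> * (r * (1/2) ^ j) ^ d) \<le> 2 * \<omega> * r ^ (d - 1) * (1/2) ^ j"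
        by simp
    qed
    finally show "(\<integral>\<^sup>+ z. F j z \<partial>lborel) \<le> ennreal (2 * \<omega> * r ^ (d - 1) * (1/2) ^ j)" .
  qed auto
  also have "\<dots> = ennreal (\<Sum>j. 2 * \<omega> * r ^ (d - 1) * (1/2) ^ j)"
    using r \<omega> by (intro suminf_ennreal2) (auto intro!: summable_mult summable_geometric)
  also have "(\<Sum>j. 2 * \<omega> * r ^ (d - 1) * (1/2) ^ j) = 4 * \<omega> * r ^ (d - 1)"
    by (subst suminf_mult) (auto simp: suminf_geometric intro!: summable_geometric)
  finally show ?thesis by (simp add: \<omega>_def d_def)
qed

section \<open>Independent points with a bounded density\<close>

lemma in_uminus_image_iff: "z \<in> uminus ` S \<longleftrightarrow> - z \<in> S" for z :: "'a::group_add"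
  by (metis (mono_tags) image_eqI image_iff minus_minus)

locale bounded_density = prob_space P
  for P :: "'v::euclidean_space measure" +
  fixes f :: "'v \<Rightarrow> real" and B :: real
  assumes density: "P = density lborel (\<lambda>x. ennreal (f x))"
    and f_meas [measurable]: "f \<in> borel_measurable borel"
    and f_nonneg: "\<And>x. f x \<ge> 0"
    and f_le: "\<And>x. f x \<le> B"
begin

lemma sets_P [simp, measurable_cong]: "sets P = sets borel"
  unfolding density by simp

lemma space_P [simp]: "space P = UNIV"
  unfolding density by simp

lemma B_nonneg: "B \<ge> 0"
  using f_nonneg f_le order_trans by blast

lemma nn_integral_P: "g \<in> borel_measurable borel \<Longrightarrow> (\<integral>\<^sup>+ x. g x \<partial>P) = (\<integral>\<^sup>+ x. ennreal (f x) * g x \<partial>lborel)"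
  unfolding density by (subst nn_integral_density) auto

lemma nn_integral_P_le:
  assumes [measurable]: "g \<in> borel_measurable borel"
  shows "(\<integral>\<^sup>+ x. g x \<partial>P) \<le> ennreal B * (\<integral>\<^sup>+ x. g x \<partial>lborel)"
proof -
  have "(\<integral>\<^sup>+ x. ennreal (f x) * g x \<partial>lborel) \<le> (\<integral>\<^sup>+ x. ennreal B * g x \<partial>lborel)"
    using f_le by (intro nn_integral_mono mult_right_mono ennreal_leI) auto
  also have "\<dots> = ennreal B * (\<integral>\<^sup>+ x. g x \<partial>lborel)" by (rule nn_integral_cmult) simp
  finally show ?thesis by (simp add: nn_integral_P)
qed

lemma product_P: "product_prob_space (\<lambda>_::nat. P)"
  by unfold_locales

lemma prob_space_PiM_P: "prob_space (PiM I (\<lambda>_::nat. P))"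
  by (intro prob_space_PiM prob_space_axioms)

lemma nn_integral_resample_le:
  assumes I: "finite I" "k \<in> (I::nat set)" and \<phi>: "\<phi> \<in> borel_measurable (PiM I (\<lambda>_. P))"
    and le: "\<And>x. (\<integral>\<^sup>+ z. \<phi> (x(k := z)) \<partial>P) \<le> c"
  shows "(\<integral>\<^sup>+ x. \<phi> x \<partial>PiM I (\<lambda>_. P)) \<le> c"
proof -
  interpret product_prob_space "\<lambda>_::nat. P" by (rule product_P)
  interpret R: prob_space "PiM (I - {k}) (\<lambda>_. P)" by (rule prob_space_PiM_P)
  have I': "insert k (I - {k}) = I" using I by auto
  have "(\<integral>\<^sup>+ x. \<phi> x \<partial>PiM I (\<lambda>_. P))
      = (\<integral>\<^sup>+ x. \<integral>\<^sup>+ z. \<phi> (x(k := z)) \<partial>P \<partial>PiM (I - {k}) (\<lambda>_. P))"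
    using product_nn_integral_insert[of "I - {k}" k \<phi>, unfolded I'] I \<phi> by simp
  also have "\<dots> \<le> (\<integral>\<^sup>+ x. c \<partial>PiM (I - {k}) (\<lambda>_. P))" by (intro nn_integral_mono le)
  also have "\<dots> = c" by (simp add: R.emeasure_space_1)
  finally show ?thesis .
qed

section \<open>Probabilities for a single random point\<close>

lemma emeasure_P_vimage_le:
  assumes S: "S \<in> sets borel"
  shows "(\<integral>\<^sup>+ z. (if c - z \<in> S then 1 else 0) \<partial>P) \<le> ennreal B * emeasure lborel (uminus ` S)"
proof -
  have S': "uminus ` S \<in> sets borel"
  proof -
    have "uminus ` S = uminus -` S \<inter> space borel" by (auto simp: in_uminus_image_iff)
    also have "\<dots> \<in> sets borel" using S by (intro measurable_sets[of _ _ borel]) auto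
    finally show ?thesis .
  qed
  have [measurable]: "Measurable.pred borel (\<lambda>z. z - c \<in> uminus ` S)" using S' by measurable
  have eq: "c - z \<in> S \<longleftrightarrow> z - c \<in> uminus ` S" for z
    by (simp add: in_uminus_image_iff)
  have "(\<integral>\<^sup>+ z. (if c - z \<in> S then 1 else 0) \<partial>P)
      \<le> ennreal B * (\<integral>\<^sup>+ z. (if z - c \<in> uminus ` S then 1 else 0) \<partial>lborel)"
    unfolding eq by (rule nn_integral_P_le) measurable
  also have "(\<integral>\<^sup>+ z. (if z - c \<in> uminus ` S then 1 else 0) \<partial>lborel)
      = (\<integral>\<^sup>+ z. indicator {z. z - c \<in> uminus ` S} z \<partial>(lborel :: 'v measure))"
    by (intro nn_integral_cong) auto
  also have "\<dots> = emeasure lborel {z. z - c \<in> uminus ` S}"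
    using S' by (intro nn_integral_indicator) measurable
  also have "\<dots> = emeasure lborel (uminus ` S)" by (rule emeasure_lborel_vimage_minus[OF S'])
  finally show ?thesis .
qed

lemma near_prob_le:
  assumes "r > 0"
  shows "(\<integral>\<^sup>+ z. (if norm (c - z) \<le> r then 1 else 0) \<partial>P) \<le> ennreal (B * (unit_ball_vol (DIM('v)) * r ^ DIM('v)))"
proof -
  have "(\<integral>\<^sup>+ z. (if norm (c - z) \<le> r then 1 else 0) \<partial>P)
      = (\<integral>\<^sup>+ z. (if c - z \<in> cball 0 r then 1 else 0) \<partial>P)" by simp
  also have "\<dots> \<le> ennreal B * emeasure lborel (uminus ` cball (0::'v) r)"
    by (rule emeasure_P_vimage_le) simp
  also have "uminus ` cball (0::'v) r = cball 0 r"
    by (auto simp: in_uminus_image_iff)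
  also have "emeasure lborel (cball (0::'v) r) = ennreal (unit_ball_vol (DIM('v)) * r ^ DIM('v))"
    using assms by (intro emeasure_cball) simp
  finally show ?thesis using assms B_nonneg by (simp add: ennreal_mult)
qed

lemma cone_prob_le:
  assumes "\<theta> \<in> Basis" "\<theta>' \<in> Basis" "\<theta> \<noteq> \<theta>'" and r: "r > 0" and m: "m > 0"
    and \<kappa>: "\<kappa> \<le> 1 / (8 * real m ^ 3)"
  shows "(\<integral>\<^sup>+ z. (if norm (c - z) \<le> r \<and> \<bar>sgn (c - z) \<bullet> \<theta> - a\<bar> < \<kappa> then 1 else 0) \<partial>P)
    \<le> ennreal (B * (2 * unit_ball_vol (DIM('v)) * (2 * r) ^ DIM('v) / m))"
proof -
  define S where "S = {z. norm z \<le> r \<and> \<bar>sgn z \<bullet> \<theta> - a\<bar> < \<kappa>}"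
  have sgn_meas [measurable]: "(\<lambda>z::'v. sgn z) \<in> borel_measurable borel"
    unfolding sgn_div_norm by measurable
  have S: "S \<in> sets borel" unfolding S_def by measurable
  have "(\<integral>\<^sup>+ z. (if norm (c - z) \<le> r \<and> \<bar>sgn (c - z) \<bullet> \<theta> - a\<bar> < \<kappa> then 1 else 0) \<partial>P)
      = (\<integral>\<^sup>+ z. (if c - z \<in> S then 1 else 0) \<partial>P)" by (simp add: S_def)
  also have "\<dots> \<le> ennreal B * emeasure lborel (uminus ` S)" by (rule emeasure_P_vimage_le[OF S])
  also have "uminus ` S = {z. norm z \<le> r \<and> \<bar>sgn z \<bullet> \<theta> - (- a)\<bar> < \<kappa>}"
  proof -
    show ?thesis by (auto simp: in_uminus_image_iff S_def sgn_minus abs_minus_commute[of _ a] algebra_simps)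
  qed
  also have "emeasure lborel \<dots> \<le> ennreal (2 * unit_ball_vol (DIM('v)) * (2 * r) ^ DIM('v) / m)"
    by (rule emeasure_cone_le) fact+
  finally show ?thesis using r m B_nonneg
    by (simp add: ennreal_mult[symmetric] mult_left_mono)
qed

end

section \<open>Crowds and coincident directions\<close>

definition crowd :: "nat set \<Rightarrow> real \<Rightarrow> (nat \<Rightarrow> 'v::real_normed_vector) \<Rightarrow> nat \<Rightarrow> nat set" where
  "crowd I r x i = {j \<in> I - {i}. norm (x i - x j) \<le> r}"

text \<open>If i has the neighbours a, b in one tour and k, c in another, this is the difference of
  the two length gradients at i. The term of k stands apart because x k is the variable to be
  integrated out.\<close>

definition direction_defect :: "'v::real_inner \<Rightarrow> (nat \<Rightarrow> 'v) \<Rightarrow> nat \<Rightarrow> nat \<Rightarrow> nat \<Rightarrow> nat \<Rightarrow> nat \<Rightarrow> real" where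
  "direction_defect \<theta> x i a b c k =
     sgn (x i - x k) \<bullet> \<theta> - (sgn (x i - x a) + sgn (x i - x b) - sgn (x i - x c)) \<bullet> \<theta>"

text \<open>The points a, b, c come from the crowd without k, so the value that the direction to k
  has to hit does not depend on x k. They may coincide, since two tours may share a neighbour of
  i.\<close>

definition coincident :: "nat set \<Rightarrow> real \<Rightarrow> real \<Rightarrow> 'v::real_inner \<Rightarrow> (nat \<Rightarrow> 'v) \<Rightarrow> nat \<Rightarrow> bool" where
  "coincident I r \<kappa> \<theta> x i \<longleftrightarrow>
     (\<exists>k\<in>crowd I r x i. \<exists>a\<in>crowd (I - {k}) r x i. \<exists>b\<in>crowd (I - {k}) r x i. \<exists>c\<in>crowd (I - {k}) r x i.
        \<bar>direction_defect \<theta> x i a b c k\<bar> < \<kappa>)"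

context bounded_density
begin

text \<open>
  Vertices with more than \<open>Q\<close> points nearby are counted separately; for the others, integrating out
  the point \<open>k\<close> first leaves at most \<open>Q\<^sup>3\<close> cones.
\<close>

lemma coincident_count:
  fixes Q m :: nat
  assumes \<theta>: "\<theta> \<in> Basis" "\<theta>' \<in> Basis" "\<theta> \<noteq> \<theta>'" and r: "r > 0" and m: "m > 0" and Q: "Q > 0"
    and \<kappa>: "\<kappa> \<le> 1 / (8 * real m ^ 3)" and I: "finite I"
  shows "\<exists>J. J \<in> borel_measurable (PiM I (\<lambda>_. P)) \<and>
    (\<forall>x. of_nat (card {i \<in> I. coincident I r \<kappa> \<theta> x i}) \<le> J x) \<and>
    (\<integral>\<^sup>+ x. J x \<partial>PiM I (\<lambda>_. P)) \<le>
      ennreal ((real (card I))\<^sup>2 * B * unit_ball_vol (DIM('v)) * r ^ DIM('v) *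
        (1 / Q + 2 * 2 ^ DIM('v) * real Q ^ 3 / m))"
proof -
  define d where "d = DIM('v)"
  define \<omega> where "\<omega> = unit_ball_vol (DIM('v))"
  have \<omega>: "\<omega> \<ge> 0" by (simp add: \<omega>_def)
  have sgn_meas [measurable]: "(\<lambda>z::'v. sgn z) \<in> borel_measurable borel"
    unfolding sgn_div_norm by measurable
  define near :: "nat \<Rightarrow> nat \<Rightarrow> (nat \<Rightarrow> 'v) \<Rightarrow> ennreal" where
    "near = (\<lambda>i j x. if norm (x i - x j) \<le> r then 1 else 0)"
  \<comment> \<open>The cardinality is that of the crowd without k, so in the integral over x k all
    conditions except those on the direction and distance of k are constant.\<close>
  define T where "T = (\<lambda>i k a b c x. if card (crowd (I - {k}) r x i) \<le> Q \<and> a \<in> crowd (I - {k}) r x i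
      \<and> b \<in> crowd (I - {k}) r x i \<and> c \<in> crowd (I - {k}) r x i \<and> norm (x i - x k) \<le> r
      \<and> \<bar>direction_defect \<theta> x i a b c k\<bar> < \<kappa> then 1 else 0 :: ennreal)"
  define C where "C = (\<lambda>i k x. \<Sum>a\<in>I. \<Sum>b\<in>I. \<Sum>c\<in>I. T i k a b c x)"
  \<comment> \<open>A measurable majorant of the count: a crowd with more than Q points is paid for
    by the sum of \<open>near\<close> divided by Q, every other coincidence by
    \<open>C\<close>.\<close>
  define J where "J = (\<lambda>x. \<Sum>i\<in>I. \<Sum>k\<in>I - {i}. ennreal (1 / Q) * near i k x + C i k x)"
  have near_m [measurable]: "near i j \<in> borel_measurable (PiM I (\<lambda>_. P))" if "i \<in> I" "j \<in> I" for i j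
    unfolding near_def using that by measurable
  have crowd_m: "Measurable.pred (PiM I (\<lambda>_. P)) (\<lambda>x. a \<in> crowd (I - {k}) r x i)"
    if "i \<in> I" "a \<in> I" for i k a
    unfolding crowd_def using that by simp
  have card_m: "Measurable.pred (PiM I (\<lambda>_. P)) (\<lambda>x. card (crowd (I - {k}) r x i) \<le> Q)"
    if i: "i \<in> I" for i k
  proof -
    have eq: "card (crowd (I - {k}) r x i) \<le> Q
        \<longleftrightarrow> (\<Sum>a\<in>I. if a \<in> crowd (I - {k}) r x i then 1 else 0 :: real) \<le> real Q" for x
    proof -
      have "crowd (I - {k}) r x i = I \<inter> {a. a \<in> crowd (I - {k}) r x i}" by (auto simp: crowd_def)
      thus ?thesis using I by (simp add: sum.If_cases)
    qed
    have [measurable]: "(\<lambda>x. \<Sum>a\<in>I. if a \<in> crowd (I - {k}) r x i then 1 else 0 :: real)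
        \<in> borel_measurable (PiM I (\<lambda>_. P))"
      using crowd_m[OF i] by (intro borel_measurable_sum measurable_If) auto
    show ?thesis unfolding eq by measurable
  qed
  have T_m: "T i k a b c \<in> borel_measurable (PiM I (\<lambda>_. P))"
    if "i \<in> I" "k \<in> I" "a \<in> I" "b \<in> I" "c \<in> I" for i k a b c
  proof -
    note [measurable] = crowd_m[OF that(1,3), of k] crowd_m[OF that(1,4), of k]
      crowd_m[OF that(1,5), of k] card_m[OF that(1), of k]
    show ?thesis unfolding T_def direction_defect_def using that by measurable
  qed
  have C_m: "C i k \<in> borel_measurable (PiM I (\<lambda>_. P))" if "i \<in> I" "k \<in> I" for i k
    unfolding C_def using T_m that by (intro borel_measurable_sum) auto
  have J_m: "J \<in> borel_measurable (PiM I (\<lambda>_. P))"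
    unfolding J_def using C_m near_m by (intro borel_measurable_sum borel_measurable_add borel_measurable_times) auto
  have fc: "finite (crowd A r x i)" if "finite A" for A x i using that by (simp add: crowd_def)
  have J_ge: "of_nat (card {i \<in> I. coincident I r \<kappa> \<theta> x i}) \<le> J x" for x
  proof -
    have "of_nat (card {i \<in> I. coincident I r \<kappa> \<theta> x i})
        = (\<Sum>i\<in>I. if coincident I r \<kappa> \<theta> x i then 1 else 0 :: ennreal)"
      using I by (simp add: sum.If_cases Int_def)
    also have "\<dots> \<le> J x"
      unfolding J_def
    proof (rule sum_mono)
      fix i assume i: "i \<in> I"
      show "(if coincident I r \<kappa> \<theta> x i then 1 else 0)
          \<le> (\<Sum>k\<in>I - {i}. ennreal (1 / Q) * near i k x + C i k x)"
      proof (cases "coincident I r \<kappa> \<theta> x i")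
        case True
        then obtain k a b c where k: "k \<in> crowd I r x i"
          and abc: "a \<in> crowd (I - {k}) r x i" "b \<in> crowd (I - {k}) r x i" "c \<in> crowd (I - {k}) r x i"
          and def: "\<bar>direction_defect \<theta> x i a b c k\<bar> < \<kappa>"
          unfolding coincident_def by blast
        show ?thesis
        proof (cases "card (crowd I r x i) \<le> Q")
          case False
          have "1 \<le> ennreal (1 / Q) * of_nat (card (crowd I r x i))"
          proof -
            have "ennreal 1 \<le> ennreal (1 / Q * card (crowd I r x i))"
              using False Q by (intro ennreal_leI) (simp add: field_simps)
            also have "\<dots> = ennreal (1 / Q) * of_nat (card (crowd I r x i))"
              by (subst ennreal_mult) (auto simp: ennreal_of_nat_eq_real_of_nat)
            finally show ?thesis by simp
          qed
          also have "of_nat (card (crowd I r x i)) = (\<Sum>k\<in>I - {i}. near i k x)"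
            unfolding near_def crowd_def using I by (simp add: sum.If_cases Int_def conj_assoc)
          also have "ennreal (1 / Q) * (\<Sum>k\<in>I - {i}. near i k x)
              = (\<Sum>k\<in>I - {i}. ennreal (1 / Q) * near i k x)" by (rule sum_distrib_left)
          also have "\<dots> \<le> (\<Sum>k\<in>I - {i}. ennreal (1 / Q) * near i k x + C i k x)"
            by (intro sum_mono) simp
          finally show ?thesis using True by simp
        next
          case Qc: True
          have sub: "crowd (I - {k}) r x i \<subseteq> crowd I r x i" by (auto simp: crowd_def)
          have "card (crowd (I - {k}) r x i) \<le> Q"
            using card_mono[OF fc[OF I] sub] Qc by linarith
          hence T1: "T i k a b c x = 1" using k abc def by (simp add: T_def crowd_def)
          have inI: "a \<in> I" "b \<in> I" "c \<in> I" "k \<in> I - {i}" using k abc by (auto simp: crowd_def)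
          have "T i k a b c x \<le> (\<Sum>c\<in>I. T i k a b c x)"
            using I inI by (intro member_le_sum) auto
          also have "\<dots> \<le> (\<Sum>b\<in>I. \<Sum>c\<in>I. T i k a b c x)"
            using I inI by (intro member_le_sum[of b I "\<lambda>b. \<Sum>c\<in>I. T i k a b c x"]) auto
          also have "\<dots> \<le> C i k x"
            unfolding C_def
            using I inI by (intro member_le_sum[of a I "\<lambda>a. \<Sum>b\<in>I. \<Sum>c\<in>I. T i k a b c x"]) auto
          also have "\<dots> \<le> ennreal (1 / Q) * near i k x + C i k x" by simp
          also have "\<dots> \<le> (\<Sum>k\<in>I - {i}. ennreal (1 / Q) * near i k x + C i k x)"
            using I inI by (intro member_le_sum[of k _ "\<lambda>k. ennreal (1 / Q) * near i k x + C i k x"]) auto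
          finally show ?thesis using True T1 by simp
        qed
      qed simp
    qed
    finally show ?thesis .
  qed
  define N where "N = B * (\<omega> * r ^ d)"
  define G where "G = B * (2 * \<omega> * (2 * r) ^ d / m)"
  have NG: "N \<ge> 0" "G \<ge> 0" using B_nonneg \<omega> r by (auto simp: N_def G_def)
  have near_int: "(\<integral>\<^sup>+ x. near i k x \<partial>PiM I (\<lambda>_. P)) \<le> ennreal N" if "i \<in> I" "k \<in> I - {i}" for i k
  proof (rule nn_integral_resample_le[OF I, of k])
    show "(\<integral>\<^sup>+ z. near i k (x(k := z)) \<partial>P) \<le> ennreal N" for x
      using near_prob_le[OF r, of "x i"] that by (simp add: near_def N_def \<omega>_def d_def)
  qed (use that near_m in auto)
  have C_int: "(\<integral>\<^sup>+ x. C i k x \<partial>PiM I (\<lambda>_. P)) \<le> ennreal (real Q ^ 3 * G)" if "i \<in> I" "k \<in> I - {i}" for i k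
  proof (rule nn_integral_resample_le[OF I, of k])
    fix x :: "nat \<Rightarrow> 'v"
    define W where "W = crowd (I - {k}) r x i"
    have W: "finite W" "W \<subseteq> I" "k \<notin> W" "i \<noteq> k" using I that by (auto simp: W_def crowd_def)
    have Wz: "crowd (I - {k}) r (x(k := z)) i = W" for z
      using that by (auto simp: W_def crowd_def)
    show "(\<integral>\<^sup>+ z. C i k (x(k := z)) \<partial>P) \<le> ennreal (real Q ^ 3 * G)"
    proof (cases "card W \<le> Q")
      case False
      hence "C i k (x(k := z)) = 0" for z by (simp add: C_def T_def Wz)
      thus ?thesis by simp
    next
      case True
      define H where "H = (\<lambda>a b c z. if norm (x i - z) \<le> r \<and> \<bar>sgn (x i - z) \<bullet> \<theta> -
          (sgn (x i - x a) + sgn (x i - x b) - sgn (x i - x c)) \<bullet> \<theta>\<bar> < \<kappa> then 1 else 0 :: ennreal)"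
      have H_m: "H a b c \<in> borel_measurable borel" for a b c
        unfolding H_def by measurable
      have TW: "T i k a b c (x(k := z)) = (if a \<in> W \<and> b \<in> W \<and> c \<in> W then H a b c z else 0)" for a b c z
        using True W by (auto simp: T_def Wz H_def direction_defect_def)
      have "C i k (x(k := z)) = (\<Sum>a\<in>W. \<Sum>b\<in>W. \<Sum>c\<in>W. H a b c z)" for z
      proof -
        have "C i k (x(k := z)) = (\<Sum>a\<in>I. \<Sum>b\<in>I. \<Sum>c\<in>I. if a \<in> W \<and> b \<in> W \<and> c \<in> W then H a b c z else 0)"
          unfolding C_def by (intro sum.cong refl TW)
        also have "\<dots> = (\<Sum>a\<in>W. \<Sum>b\<in>W. \<Sum>c\<in>W. if a \<in> W \<and> b \<in> W \<and> c \<in> W then H a b c z else 0)"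
          using I W by (intro sum.mono_neutral_cong_right) (auto intro!: sum.mono_neutral_cong_right)
        also have "\<dots> = (\<Sum>a\<in>W. \<Sum>b\<in>W. \<Sum>c\<in>W. H a b c z)" by (intro sum.cong) auto
        finally show ?thesis .
      qed
      hence "(\<integral>\<^sup>+ z. C i k (x(k := z)) \<partial>P) = (\<Sum>a\<in>W. \<Sum>b\<in>W. \<Sum>c\<in>W. \<integral>\<^sup>+ z. H a b c z \<partial>P)"
        using H_m by (simp add: nn_integral_sum)
      also have "\<dots> \<le> (\<Sum>a\<in>W. \<Sum>b\<in>W. \<Sum>c\<in>W. ennreal G)"
        unfolding H_def G_def \<omega>_def d_def by (intro sum_mono cone_prob_le[OF \<theta> r m \<kappa>])
      also have "\<dots> = ennreal (real (card W) ^ 3 * G)"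
        using NG by (simp add: ennreal_of_nat_eq_real_of_nat ennreal_mult[symmetric] power3_eq_cube mult_ac)
      also have "\<dots> \<le> ennreal (real Q ^ 3 * G)"
        using True NG by (intro ennreal_leI mult_right_mono power_mono) auto
      finally show ?thesis .
    qed
  qed (use that C_m in auto)
  have "(\<integral>\<^sup>+ x. J x \<partial>PiM I (\<lambda>_. P))
      = (\<Sum>i\<in>I. \<Sum>k\<in>I - {i}. ennreal (1 / Q) * (\<integral>\<^sup>+ x. near i k x \<partial>PiM I (\<lambda>_. P))
          + (\<integral>\<^sup>+ x. C i k x \<partial>PiM I (\<lambda>_. P)))"
  proof -
    have m: "(\<lambda>x. ennreal (1 / Q) * near i k x + C i k x) \<in> borel_measurable (PiM I (\<lambda>_. P))"
      if "i \<in> I" "k \<in> I - {i}" for i k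
      using that near_m C_m by (intro borel_measurable_add borel_measurable_times) auto
    have "(\<integral>\<^sup>+ x. ennreal (1 / Q) * near i k x + C i k x \<partial>PiM I (\<lambda>_. P))
        = ennreal (1 / Q) * (\<integral>\<^sup>+ x. near i k x \<partial>PiM I (\<lambda>_. P)) + (\<integral>\<^sup>+ x. C i k x \<partial>PiM I (\<lambda>_. P))"
      if "i \<in> I" "k \<in> I - {i}" for i k
      using that near_m[of i k] C_m[of i k]
      by (subst nn_integral_add) (auto simp: nn_integral_cmult)
    moreover have "(\<integral>\<^sup>+ x. J x \<partial>PiM I (\<lambda>_. P))
        = (\<Sum>i\<in>I. \<Sum>k\<in>I - {i}. \<integral>\<^sup>+ x. ennreal (1 / Q) * near i k x + C i k x \<partial>PiM I (\<lambda>_. P))"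
    proof -
      have "(\<integral>\<^sup>+ x. J x \<partial>PiM I (\<lambda>_. P))
          = (\<Sum>i\<in>I. \<integral>\<^sup>+ x. (\<Sum>k\<in>I - {i}. ennreal (1 / Q) * near i k x + C i k x) \<partial>PiM I (\<lambda>_. P))"
        unfolding J_def by (rule nn_integral_sum) (intro borel_measurable_sum m)
      also have "\<dots> = (\<Sum>i\<in>I. \<Sum>k\<in>I - {i}. \<integral>\<^sup>+ x. ennreal (1 / Q) * near i k x + C i k x \<partial>PiM I (\<lambda>_. P))"
        by (intro sum.cong refl nn_integral_sum m)
      finally show ?thesis .
    qed
    ultimately show ?thesis by simp
  qed
  also have "\<dots> \<le> (\<Sum>i\<in>I. \<Sum>k\<in>I - {i}. ennreal (1 / Q) * ennreal N + ennreal (real Q ^ 3 * G))"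
    using near_int C_int by (intro sum_mono add_mono mult_left_mono) auto
  also have "\<dots> \<le> (\<Sum>i\<in>I. \<Sum>k\<in>I. ennreal (1 / Q) * ennreal N + ennreal (real Q ^ 3 * G))"
    using I by (intro sum_mono sum_mono2) auto
  also have "\<dots> = ennreal (card I * (card I * (1 / Q * N + real Q ^ 3 * G)))"
    using NG by (simp add: ennreal_of_nat_eq_real_of_nat ennreal_mult[symmetric] ennreal_plus[symmetric]
        del: ennreal_plus)
  also have "card I * (card I * (1 / Q * N + real Q ^ 3 * G))
      = (real (card I))\<^sup>2 * B * \<omega> * r ^ d * (1 / Q + 2 * 2 ^ d * real Q ^ 3 / m)"
    using Q m by (simp add: N_def G_def power_mult_distrib power2_eq_square field_simps)
  finally show ?thesis using J_m J_ge unfolding \<omega>_def d_def by blast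
qed

text \<open>Uniformity in \<sigma> is inherited from \<open>nn_integral_inverse_norm_le\<close>; the
  lemma is applied with \<sigma> = 2 s, which tends to zero.\<close>

lemma nn_integral_inverse_distance_le:
  fixes i j :: nat
  assumes dim: "DIM('v) \<ge> 2" and r: "r > 0" and \<sigma>: "\<sigma> > 0"
    and I: "finite I" "i \<in> I" "j \<in> I" "i \<noteq> j"
  shows "(\<integral>\<^sup>+ x. ennreal (indicat_real {z. norm z < r} (x i - x j) / max (norm (x i - x j)) \<sigma>) \<partial>PiM I (\<lambda>_. P))
    \<le> ennreal (B * (4 * unit_ball_vol (DIM('v)) * r ^ (DIM('v) - 1)))"
proof -
  define g where "g = (\<lambda>z::'v. ennreal (indicat_real {z. norm z < r} z / max (norm z) \<sigma>))"
  have [measurable]: "{z::'v. norm z < r} \<in> sets borel" by measurable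
  have g_m [measurable]: "g \<in> borel_measurable borel" unfolding g_def by measurable
  have "(\<integral>\<^sup>+ x. g (x i - x j) \<partial>PiM I (\<lambda>_. P)) \<le> ennreal (B * (4 * unit_ball_vol (DIM('v)) * r ^ (DIM('v) - 1)))"
  proof (rule nn_integral_resample_le[OF I(1,3)])
    show "(\<lambda>x. g (x i - x j)) \<in> borel_measurable (PiM I (\<lambda>_. P))" using I by measurable
    fix x :: "nat \<Rightarrow> 'v"
    have "(\<integral>\<^sup>+ z. g ((x(j := z)) i - (x(j := z)) j) \<partial>P) = (\<integral>\<^sup>+ z. g (x i - z) \<partial>P)"
      using I by simp
    also have "\<dots> \<le> ennreal B * (\<integral>\<^sup>+ z. g (x i - z) \<partial>lborel)" by (rule nn_integral_P_le) measurable
    also have "(\<integral>\<^sup>+ z. g (x i - z) \<partial>lborel) = (\<integral>\<^sup>+ z. g (- x i + z) \<partial>lborel)"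
      by (intro nn_integral_cong) (simp add: g_def norm_minus_commute indicator_def)
    also have "\<dots> = (\<integral>\<^sup>+ z. g z \<partial>distr lborel borel ((+) (- x i)))"
      by (subst nn_integral_distr) auto
    also have "\<dots> = (\<integral>\<^sup>+ z. g z \<partial>lborel)" by (simp add: lborel_distr_plus)
    also have "\<dots> \<le> ennreal (4 * unit_ball_vol (DIM('v)) * r ^ (DIM('v) - 1))"
      unfolding g_def by (rule nn_integral_inverse_norm_le[OF dim r \<sigma>])
    finally show "(\<integral>\<^sup>+ z. g ((x(j := z)) i - (x(j := z)) j) \<partial>P)
        \<le> ennreal (B * (4 * unit_ball_vol (DIM('v)) * r ^ (DIM('v) - 1)))"
      using B_nonneg r by (simp add: ennreal_mult[symmetric] mult_left_mono)
  qed
  thus ?thesis by (simp add: g_def)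
qed

end

section \<open>A stationary Metropolis step\<close>

text \<open>
  The lower approximations are inf-convolutions of \<open>f\<close> with \<open>k \<cdot> norm\<close>, cut off at radius \<open>k\<close>.
\<close>

lemma lipschitz_lower_approximation:
  fixes f :: "'v::euclidean_space \<Rightarrow> real"
  assumes meas [measurable]: "f \<in> borel_measurable borel" and nonneg: "\<And>x. f x \<ge> 0"
    and int: "(\<integral>\<^sup>+ x. ennreal (f x) \<partial>lborel) < \<infinity>"
    and cont: "AE x in lborel. isCont f x" and \<eta>: "\<eta> > 0"
  shows "\<exists>h k. k > 0 \<and> (\<forall>x. 0 \<le> h x \<and> h x \<le> f x) \<and> (\<forall>x y. \<bar>h x - h y\<bar> \<le> k * norm (x - y)) \<and>
    (\<forall>x. norm x > k \<longrightarrow> h x = 0) \<and> (\<integral>\<^sup>+ x. ennreal (f x - h x) \<partial>lborel) \<le> ennreal \<eta>"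
proof -
  define g where "g = (\<lambda>(k::real) x. INF y. f y + k * norm (x - y))"
  \<comment> \<open>The cut-off is 1-Lipschitz, so the minimum keeps the Lipschitz constant
    \<open>Suc n\<close> of the inf-convolution.\<close>
  define h where "h = (\<lambda>(n::nat) x. min (g (Suc n) x) (max 0 (Suc n - norm x)))"
  have bdd: "bdd_below (range (\<lambda>y. f y + k * norm (x - y)))" if "k \<ge> 0" for k x
    using nonneg that by (intro bdd_belowI[of _ 0]) auto
  have g_le: "g k x \<le> f y + k * norm (x - y)" if "k \<ge> 0" for k x y
    unfolding g_def by (rule cINF_lower[OF bdd[OF that]]) simp
  have g_ge: "c \<le> g k x" if "\<And>y. c \<le> f y + k * norm (x - y)" for c k x
    unfolding g_def by (rule cINF_greatest) (use that in auto)
  have g_lip: "g k x \<le> g k y + k * norm (x - y)" if k: "k \<ge> 0" for k x y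
  proof -
    have "g k x - k * norm (x - y) \<le> g k y"
    proof (rule g_ge)
      fix z
      have "norm (x - z) \<le> norm (x - y) + norm (y - z)"
        using norm_triangle_ineq[of "x - y" "y - z"] by simp
      hence "k * norm (x - z) \<le> k * (norm (x - y) + norm (y - z))" using k by (intro mult_left_mono)
      thus "g k x - k * norm (x - y) \<le> f z + k * norm (y - z)"
        using g_le[OF k, of x z] by (simp add: distrib_left)
    qed
    thus ?thesis by simp
  qed
  have h_nonneg: "0 \<le> h n x" for n x
    unfolding h_def using g_ge[of 0 "Suc n" x] nonneg by simp
  have h_le: "h n x \<le> f x" for n x
    unfolding h_def using g_le[of "Suc n" x x] by simp
  have h_lip1: "h n x \<le> h n y + Suc n * norm (x - y)" for n x y
  proof -
    have "norm y \<le> norm x + norm (x - y)" by (metis norm_minus_commute norm_triangle_sub)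
    moreover have "1 * norm (x - y) \<le> Suc n * norm (x - y)" by (intro mult_right_mono) auto
    ultimately have "max 0 (Suc n - norm x) \<le> max 0 (Suc n - norm y) + Suc n * norm (x - y)" by simp
    moreover have "min a b \<le> min a' b' + c" if "a \<le> a' + c" "b \<le> b' + c" for a b a' b' c :: real
      using that by (auto simp: min_def)
    ultimately show ?thesis unfolding h_def using g_lip[of "Suc n" x y] by simp
  qed
  have h_lip: "\<bar>h n x - h n y\<bar> \<le> Suc n * norm (x - y)" for n x y
    using h_lip1[of n x y] h_lip1[of n y x] by (simp add: norm_minus_commute abs_le_iff)
  have h_supp: "h n x = 0" if "norm x > Suc n" for n x
    using h_nonneg[of n x] that by (simp add: h_def)
  have h_cont: "continuous_on UNIV (h n)" for n
  proof (rule continuous_onI)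
    fix x :: 'v and e :: real assume e: "0 < e"
    show "\<exists>d>0. \<forall>x'\<in>UNIV. dist x' x < d \<longrightarrow> dist (h n x') (h n x) \<le> e"
    proof (intro exI[of _ "e / Suc n"] conjI ballI impI)
      fix x' assume "dist x' x < e / Suc n"
      hence "Suc n * norm (x' - x) \<le> e" by (simp add: dist_norm field_simps)
      thus "dist (h n x') (h n x) \<le> e" using h_lip[of n x' x] by (simp add: dist_real_def)
    qed (use e in simp)
  qed
  have h_m [measurable]: "h n \<in> borel_measurable borel" for n
    by (rule borel_measurable_continuous_onI[OF h_cont])
  have lim: "(\<lambda>n. h n x) \<longlonglongrightarrow> f x" if cx: "isCont f x" for x
  proof (rule LIMSEQ_I)
    fix e :: real assume e: "0 < e"
    obtain \<delta> where \<delta>: "\<delta> > 0" "\<And>y. dist y x < \<delta> \<Longrightarrow> dist (f y) (f x) < e / 2"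
      using cx half_gt_zero[OF e] unfolding continuous_at_eps_delta by blast
    \<comment> \<open>The first bound makes the cone exceed f x outside the \<delta>-ball around x,
      so only nearby values of f enter the infimum; the second keeps the cut-off above f x.\<close>
    define N where "N = nat \<lceil>max (f x / \<delta>) (norm x + f x)\<rceil>"
    have N: "f x / \<delta> \<le> N" "norm x + f x \<le> N" unfolding N_def by linarith+
    have "norm (h n x - f x) < e" if n: "n \<ge> N" for n
    proof -
      have "f x - e / 2 \<le> g (Suc n) x"
      proof (rule g_ge)
        fix y
        show "f x - e / 2 \<le> f y + Suc n * norm (x - y)"
        proof (cases "dist y x < \<delta>")
          case True
          hence "f x - e / 2 \<le> f y" using \<delta>(2)[of y] unfolding dist_real_def by linarith
          moreover have "0 \<le> Suc n * norm (x - y)" by simp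
          ultimately show ?thesis by linarith
        next
          case False
          have "f x \<le> N * \<delta>" using N(1) \<delta>(1) by (simp add: field_simps)
          also have "\<dots> \<le> Suc n * norm (x - y)"
            using n False \<delta>(1) by (intro mult_mono) (auto simp: dist_norm norm_minus_commute)
          finally show ?thesis using nonneg[of y] e by linarith
        qed
      qed
      moreover have "f x \<le> max 0 (Suc n - norm x)" using N(2) n by simp
      ultimately have "f x - e / 2 \<le> h n x" using e by (simp add: h_def)
      thus ?thesis using h_le[of n x] e by (simp add: abs_if)
    qed
    thus "\<exists>no. \<forall>n\<ge>no. norm (h n x - f x) < e" by blast
  qed
  have "(\<lambda>n. \<integral>\<^sup>+ x. ennreal (f x - h n x) \<partial>lborel) \<longlonglongrightarrow> (\<integral>\<^sup>+ x. 0 \<partial>(lborel :: 'v measure))"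
  proof (rule nn_integral_dominated_convergence[where w = "\<lambda>x. ennreal (f x)"])
    show "AE x in lborel. (\<lambda>n. ennreal (f x - h n x)) \<longlonglongrightarrow> 0"
      using cont
    proof eventually_elim
      case (elim x)
      have "(\<lambda>n. ennreal (f x - h n x)) \<longlonglongrightarrow> ennreal (f x - f x)"
        by (intro tendsto_ennrealI tendsto_diff tendsto_const lim elim)
      thus ?case by simp
    qed
    show "AE x in lborel. ennreal (f x - h n x) \<le> ennreal (f x)" for n
      using h_nonneg by (intro AE_I2 ennreal_leI) simp
  qed (use int in auto)
  hence "(\<lambda>n. \<integral>\<^sup>+ x. ennreal (f x - h n x) \<partial>lborel) \<longlonglongrightarrow> 0" by simp
  hence "eventually (\<lambda>n. (\<integral>\<^sup>+ x. ennreal (f x - h n x) \<partial>lborel) < ennreal \<eta>) sequentially"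
    using \<eta> by (intro order_tendstoD) auto
  then obtain n where "(\<integral>\<^sup>+ x. ennreal (f x - h n x) \<partial>lborel) < ennreal \<eta>"
    by (auto simp: eventually_sequentially)
  thus ?thesis using h_nonneg h_le h_lip h_supp
    by (intro exI[of _ "h n"] exI[of _ "real (Suc n)"]) (auto intro: less_imp_le)
qed

section \<open>An auxiliary uniform variable and the Metropolis kernel\<close>

definition unit_uniform :: "real measure" where
  "unit_uniform = uniform_measure lborel {0..1}"

lemma prob_space_unit_uniform: "prob_space unit_uniform"
  unfolding unit_uniform_def by (rule prob_space_uniform_measure) auto

lemma sets_unit_uniform [simp, measurable_cong]: "sets unit_uniform = sets borel"
  unfolding unit_uniform_def by simp

lemma space_unit_uniform [simp]: "space unit_uniform = UNIV"
  unfolding unit_uniform_def by simp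

lemma emeasure_unit_uniform_threshold:
  assumes "0 \<le> m" "m \<le> F" "F > 0"
  shows "emeasure unit_uniform {u. u * F < m} = ennreal (m / F)"
proof -
  have eq: "{u. u * F < m} = {..<m / F}" using assms by (auto simp: pos_less_divide_eq[OF assms(3)])
  have "m / F \<le> 1" using assms by simp
  hence "{0..1} \<inter> {..<m / F} = {0..<m / F}" by auto
  moreover have "{..<m / F} \<in> sets borel" by simp
  ultimately show ?thesis using assms unfolding eq unit_uniform_def
    using divide_ennreal[of "m / F" 1] by (subst emeasure_uniform_measure) simp_all
qed

text \<open>Multiplying by F instead of dividing by it covers F = 0 as well, where both sides
  vanish; points of zero density need no exception.\<close>

lemma nn_integral_threshold:
  assumes m: "0 \<le> m" "m \<le> F"
  shows "ennreal F * (\<integral>\<^sup>+ u. (if u * F < m then \<alpha> else \<beta>) \<partial>unit_uniform)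
       = ennreal m * \<alpha> + ennreal (F - m) * \<beta>"
proof (cases "F = 0")
  case False
  hence F: "F > 0" using m by linarith
  interpret prob_space unit_uniform by (rule prob_space_unit_uniform)
  define S where "S = {u. u * F < m}"
  have S [measurable]: "S \<in> sets unit_uniform" unfolding S_def by measurable
  have eS: "emeasure unit_uniform S = ennreal (m / F)"
    unfolding S_def by (rule emeasure_unit_uniform_threshold[OF m F])
  have eC: "emeasure unit_uniform (- S) = ennreal (1 - m / F)"
  proof -
    have "emeasure unit_uniform (space unit_uniform - S)
        = emeasure unit_uniform (space unit_uniform) - emeasure unit_uniform S"
      by (rule emeasure_compl[OF S]) (simp add: eS)
    also have "\<dots> = ennreal 1 - ennreal (m / F)" unfolding emeasure_space_1 eS by simp
    also have "\<dots> = ennreal (1 - m / F)" by (rule ennreal_minus) (use m F in simp)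
    finally show ?thesis unfolding space_unit_uniform Compl_eq_Diff_UNIV .
  qed
  have "(\<integral>\<^sup>+ u. (if u * F < m then \<alpha> else \<beta>) \<partial>unit_uniform)
      = (\<integral>\<^sup>+ u. \<alpha> * indicator S u + \<beta> * indicator (- S) u \<partial>unit_uniform)"
    by (intro nn_integral_cong) (simp add: S_def)
  also have "\<dots> = \<alpha> * ennreal (m / F) + \<beta> * ennreal (1 - m / F)"
  proof -
    have C [measurable]: "- S \<in> sets unit_uniform" using S by (simp add: borel_comp)
    have "(\<integral>\<^sup>+ u. \<alpha> * indicator S u + \<beta> * indicator (- S) u \<partial>unit_uniform)
        = (\<integral>\<^sup>+ u. \<alpha> * indicator S u \<partial>unit_uniform) + (\<integral>\<^sup>+ u. \<beta> * indicator (- S) u \<partial>unit_uniform)"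
      by (rule nn_integral_add) measurable
    thus ?thesis by (simp only: nn_integral_cmult_indicator[OF S] nn_integral_cmult_indicator[OF C] eS eC)
  qed
  finally have "ennreal F * (\<integral>\<^sup>+ u. (if u * F < m then \<alpha> else \<beta>) \<partial>unit_uniform)
      = (ennreal F * ennreal (m / F)) * \<alpha> + (ennreal F * ennreal (1 - m / F)) * \<beta>"
    by (simp only: distrib_left) (simp only: ac_simps)
  also have "ennreal F * ennreal (m / F) = ennreal m"
    using F m by (subst ennreal_mult[symmetric]) auto
  also have "ennreal F * ennreal (1 - m / F) = ennreal (F - m)"
  proof -
    have "1 - m / F \<ge> 0" "F * (1 - m / F) = F - m" using F m by (simp_all add: right_diff_distrib)
    thus ?thesis using F by (subst ennreal_mult[symmetric]) auto
  qed
  finally show ?thesis .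
next
  case True
  hence "m = 0" using m by linarith
  thus ?thesis using True by simp
qed

text \<open>
  A Metropolis step along \<open>\<plusminus> v\<close> that only moves the part of the mass lying below \<open>h\<close>: the auxiliary
  variable \<open>u\<close> is uniform on \<open>[0, 1]\<close>, so \<open>(x, u * f x)\<close> is uniform on the subgraph of \<open>f\<close>.
\<close>

locale metropolis = bounded_density P f B
  for P :: "'v::euclidean_space measure" and f B +
  fixes h :: "'v \<Rightarrow> real" and v :: 'v
  assumes h_meas [measurable]: "h \<in> borel_measurable borel"
    and h_nonneg: "\<And>x. h x \<ge> 0" and h_le: "\<And>x. h x \<le> f x"
begin

text \<open>The threshold is symmetric in the two ends of the move. This is detailed balance: the
  mass sent from x to x + e v equals the mass sent back by the opposite sign.\<close>

definition step :: "'v \<times> real \<Rightarrow> real \<Rightarrow> 'v" where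
  "step q e = (if snd q * f (fst q) < min (h (fst q)) (h (fst q + e *\<^sub>R v))
               then fst q + e *\<^sub>R v else fst q)"

text \<open>Independent of the sign, so it can serve as a fixed 0-1 factor of the Rademacher
  coefficients.\<close>

definition movable :: "'v \<times> real \<Rightarrow> bool" where
  "movable q \<longleftrightarrow> snd q * f (fst q) < h (fst q)"

text \<open>The part of the decision that does depend on the sign. It is treated as an error: the
  move that the linear expansion assumes does not take place.\<close>

definition rejected :: "'v \<times> real \<Rightarrow> real \<Rightarrow> bool" where
  "rejected q e \<longleftrightarrow> movable q \<and> h (fst q + e *\<^sub>R v) \<le> snd q * f (fst q)"

definition Q :: "('v \<times> real) measure" where
  "Q = P \<Otimes>\<^sub>M unit_uniform"

lemma step_eq: "step q e = (if movable q \<and> \<not> rejected q e then fst q + e *\<^sub>R v else fst q)"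
  by (auto simp: step_def movable_def rejected_def)

lemma prob_space_Q: "prob_space Q"
proof -
  interpret U: prob_space unit_uniform by (rule prob_space_unit_uniform)
  interpret pair_prob_space P unit_uniform ..
  show ?thesis unfolding Q_def by unfold_locales
qed

lemma sets_Q [simp, measurable_cong]: "sets Q = sets (borel \<Otimes>\<^sub>M borel)"
  unfolding Q_def by (intro sets_pair_measure_cong) auto

lemma space_Q [simp]: "space Q = UNIV"
  unfolding Q_def by (simp add: space_pair_measure)

lemma step_measurable [measurable]: "(\<lambda>q. step q e) \<in> borel_measurable (borel \<Otimes>\<^sub>M borel)"
  unfolding step_def by measurable

lemma movable_measurable [measurable]: "Measurable.pred (borel \<Otimes>\<^sub>M borel) movable"
  unfolding movable_def by measurable

lemma rejected_measurable [measurable]: "Measurable.pred (borel \<Otimes>\<^sub>M borel) (\<lambda>q. rejected q e)"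
  unfolding rejected_def by measurable

lemma nn_integral_Q:
  assumes "\<psi> \<in> borel_measurable (borel \<Otimes>\<^sub>M borel)"
  shows "(\<integral>\<^sup>+ q. \<psi> q \<partial>Q) = (\<integral>\<^sup>+ x. ennreal (f x) * (\<integral>\<^sup>+ u. \<psi> (x, u) \<partial>unit_uniform) \<partial>lborel)"
proof -
  interpret U: prob_space unit_uniform by (rule prob_space_unit_uniform)
  have \<psi> [measurable]: "\<psi> \<in> borel_measurable (P \<Otimes>\<^sub>M unit_uniform)"
    using assms sets_Q unfolding Q_def by (simp cong: measurable_cong_sets)
  have "(\<integral>\<^sup>+ q. \<psi> q \<partial>Q) = (\<integral>\<^sup>+ x. \<integral>\<^sup>+ u. \<psi> (x, u) \<partial>unit_uniform \<partial>P)"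
    unfolding Q_def by (rule U.nn_integral_fst[symmetric]) measurable
  also have "\<dots> = (\<integral>\<^sup>+ x. ennreal (f x) * (\<integral>\<^sup>+ u. \<psi> (x, u) \<partial>unit_uniform) \<partial>lborel)"
  proof (rule nn_integral_P)
    have "(\<lambda>x. \<integral>\<^sup>+ u. \<psi> (x, u) \<partial>unit_uniform) \<in> borel_measurable P"
      by (rule U.borel_measurable_nn_integral_fst) measurable
    thus "(\<lambda>x. \<integral>\<^sup>+ u. \<psi> (x, u) \<partial>unit_uniform) \<in> borel_measurable borel"
      by (simp cong: measurable_cong_sets)
  qed
  finally show ?thesis .
qed

lemma nn_integral_fst_Q:
  assumes [measurable]: "\<phi> \<in> borel_measurable borel"
  shows "(\<integral>\<^sup>+ q. \<phi> (fst q) \<partial>Q) = (\<integral>\<^sup>+ x. \<phi> x \<partial>P)"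
proof -
  interpret U: prob_space unit_uniform by (rule prob_space_unit_uniform)
  have "(\<integral>\<^sup>+ u. c \<partial>unit_uniform) = c" for c using U.emeasure_space_1 by simp
  thus ?thesis by (subst nn_integral_Q) (auto simp: nn_integral_P)
qed

text \<open>The mass arriving by the moves of one sign is the mass leaving by the moves of the other
  sign, by a translation of the Lebesgue integral. The law P is therefore recovered from the sum
  over both signs, not sign by sign.\<close>

lemma nn_integral_step:
  assumes [measurable]: "\<phi> \<in> borel_measurable borel"
  shows "(\<integral>\<^sup>+ q. \<phi> (step q (-1)) + \<phi> (step q 1) \<partial>Q) = 2 * (\<integral>\<^sup>+ x. \<phi> x \<partial>P)"
proof -
  define m where "m = (\<lambda>e x. min (h x) (h (x + e *\<^sub>R v)))"
  have m_meas [measurable]: "m e \<in> borel_measurable borel" for e unfolding m_def by measurable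
  have m: "0 \<le> m e x" "m e x \<le> f x" for e x
    using h_nonneg h_le[of x] by (auto simp: m_def)
  have one: "(\<integral>\<^sup>+ q. \<phi> (step q e) \<partial>Q)
      = (\<integral>\<^sup>+ x. ennreal (m e x) * \<phi> (x + e *\<^sub>R v) \<partial>lborel) + (\<integral>\<^sup>+ x. ennreal (f x - m e x) * \<phi> x \<partial>lborel)" for e
  proof -
    have "(\<integral>\<^sup>+ q. \<phi> (step q e) \<partial>Q) = (\<integral>\<^sup>+ x. ennreal (f x) * (\<integral>\<^sup>+ u. \<phi> (step (x, u) e) \<partial>unit_uniform) \<partial>lborel)"
      by (rule nn_integral_Q) measurable
    also have "\<dots> = (\<integral>\<^sup>+ x. ennreal (f x) * (\<integral>\<^sup>+ u. (if u * f x < m e x then \<phi> (x + e *\<^sub>R v) else \<phi> x) \<partial>unit_uniform) \<partial>lborel)"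
      by (intro nn_integral_cong arg_cong2[where f = "(*)"] refl) (auto simp: step_def m_def)
    also have "\<dots> = (\<integral>\<^sup>+ x. ennreal (m e x) * \<phi> (x + e *\<^sub>R v) + ennreal (f x - m e x) * \<phi> x \<partial>lborel)"
      by (intro nn_integral_cong nn_integral_threshold m)
    also have "\<dots> = (\<integral>\<^sup>+ x. ennreal (m e x) * \<phi> (x + e *\<^sub>R v) \<partial>lborel) + (\<integral>\<^sup>+ x. ennreal (f x - m e x) * \<phi> x \<partial>lborel)"
      by (rule nn_integral_add) measurable
    finally show ?thesis .
  qed
  have shift: "(\<integral>\<^sup>+ x. ennreal (m e x) * \<phi> (x + e *\<^sub>R v) \<partial>lborel) = (\<integral>\<^sup>+ x. ennreal (m (- e) x) * \<phi> x \<partial>lborel)" for e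
  proof -
    have "(\<integral>\<^sup>+ x. ennreal (m (- e) x) * \<phi> x \<partial>lborel)
        = (\<integral>\<^sup>+ x. ennreal (m (- e) x) * \<phi> x \<partial>distr lborel borel ((+) (e *\<^sub>R v)))"
      by (simp add: lborel_distr_plus)
    also have "\<dots> = (\<integral>\<^sup>+ x. ennreal (m (- e) (e *\<^sub>R v + x)) * \<phi> (e *\<^sub>R v + x) \<partial>lborel)"
      by (subst nn_integral_distr) auto
    also have "\<dots> = (\<integral>\<^sup>+ x. ennreal (m e x) * \<phi> (x + e *\<^sub>R v) \<partial>lborel)"
      by (intro nn_integral_cong) (simp add: m_def add.commute min.commute)
    finally show ?thesis by simp
  qed
  have comb: "(\<integral>\<^sup>+ x. ennreal (m e x) * \<phi> x \<partial>lborel) + (\<integral>\<^sup>+ x. ennreal (f x - m e x) * \<phi> x \<partial>lborel)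
      = (\<integral>\<^sup>+ x. \<phi> x \<partial>P)" for e
  proof -
    have "(\<integral>\<^sup>+ x. ennreal (m e x) * \<phi> x \<partial>lborel) + (\<integral>\<^sup>+ x. ennreal (f x - m e x) * \<phi> x \<partial>lborel)
        = (\<integral>\<^sup>+ x. ennreal (m e x) * \<phi> x + ennreal (f x - m e x) * \<phi> x \<partial>lborel)"
      by (rule nn_integral_add[symmetric]) measurable
    also have "\<dots> = (\<integral>\<^sup>+ x. ennreal (f x) * \<phi> x \<partial>lborel)"
    proof (intro nn_integral_cong)
      fix x
      have "ennreal (m e x) + ennreal (f x - m e x) = ennreal (f x)"
        using m[of e x] by (subst ennreal_plus[symmetric]) auto
      thus "ennreal (m e x) * \<phi> x + ennreal (f x - m e x) * \<phi> x = ennreal (f x) * \<phi> x"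
        by (metis distrib_right)
    qed
    finally show ?thesis by (simp add: nn_integral_P)
  qed
  have "(\<integral>\<^sup>+ q. \<phi> (step q (-1)) + \<phi> (step q 1) \<partial>Q)
      = (\<integral>\<^sup>+ q. \<phi> (step q (-1)) \<partial>Q) + (\<integral>\<^sup>+ q. \<phi> (step q 1) \<partial>Q)"
    by (rule nn_integral_add) measurable
  also have "\<dots> = ((\<integral>\<^sup>+ x. ennreal (m 1 x) * \<phi> x \<partial>lborel) + (\<integral>\<^sup>+ x. ennreal (f x - m 1 x) * \<phi> x \<partial>lborel))
     + ((\<integral>\<^sup>+ x. ennreal (m (-1) x) * \<phi> x \<partial>lborel) + (\<integral>\<^sup>+ x. ennreal (f x - m (-1) x) * \<phi> x \<partial>lborel))"
    unfolding one shift by (simp add: add_ac)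
  also have "\<dots> = 2 * (\<integral>\<^sup>+ x. \<phi> x \<partial>P)" unfolding comb by (simp add: mult_2)
  finally show ?thesis .
qed

definition steps :: "nat set \<Rightarrow> (nat \<Rightarrow> 'v \<times> real) \<Rightarrow> (nat \<Rightarrow> real) \<Rightarrow> nat \<Rightarrow> 'v" where
  "steps I q \<xi> = (\<lambda>i\<in>I. step (q i) (\<xi> i))"

lemma steps_measurable:
  "(\<lambda>q. steps I q \<xi>) \<in> measurable (PiM I (\<lambda>_. Q)) (PiM I (\<lambda>_. P))"
  unfolding steps_def by measurable

text \<open>With uniform signs the coordinates are moved independently. It suffices to identify the
  resulting law on boxes, where the sum over signs factorises by \<open>sum_signs_prod\<close> and
  each factor is covered by \<open>nn_integral_step\<close>.\<close>

lemma nn_integral_steps: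
  assumes I: "finite I" and F [measurable]: "F \<in> borel_measurable (PiM I (\<lambda>_. P))"
  shows "(\<integral>\<^sup>+ q. (\<Sum>\<xi>\<in>signs I. F (steps I q \<xi>)) \<partial>PiM I (\<lambda>_. Q)) = 2 ^ card I * (\<integral>\<^sup>+ x. F x \<partial>PiM I (\<lambda>_. P))"
proof -
  interpret Q: prob_space Q by (rule prob_space_Q)
  interpret QQ: product_prob_space "\<lambda>_::nat. Q" by unfold_locales
  interpret PP: product_prob_space "\<lambda>_::nat. P" by (rule product_P)
  define R where "R = uniform_count_measure (signs I)"
  have fin: "finite (signs I)" and ne: "signs I \<noteq> {}" using finite_signs[OF I] by (auto simp: signs_def PiE_eq_empty_iff)
  have card: "card (signs I) = 2 ^ card I" by (rule card_signs[OF I])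
  interpret R: prob_space R unfolding R_def by (rule prob_space_uniform_count_measure[OF fin ne])
  have QI: "sigma_finite_measure (PiM I (\<lambda>_. Q))"
    by (intro prob_space_imp_sigma_finite prob_space_PiM prob_space_Q)
  have R_int: "(\<integral>\<^sup>+ \<xi>. g \<xi> \<partial>R) = (\<Sum>\<xi>\<in>signs I. ennreal (1 / 2 ^ card I) * g \<xi>)" for g
    unfolding R_def uniform_count_measure_def using fin
    by (subst nn_integral_point_measure_finite) (auto simp: card)
  define T where "T = (\<lambda>(\<xi>, q). steps I q \<xi>)"
  have T [measurable]: "T \<in> measurable (R \<Otimes>\<^sub>M PiM I (\<lambda>_. Q)) (PiM I (\<lambda>_. P))"
  proof -
    have "T \<in> measurable (count_space (signs I) \<Otimes>\<^sub>M PiM I (\<lambda>_. Q)) (PiM I (\<lambda>_. P))"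
      using fin steps_measurable unfolding T_def
      by (intro measurable_pair_measure_countable1) (auto intro: countable_finite)
    moreover have "sets (R \<Otimes>\<^sub>M PiM I (\<lambda>_. Q)) = sets (count_space (signs I) \<Otimes>\<^sub>M PiM I (\<lambda>_. Q))"
      unfolding R_def by (intro sets_pair_measure_cong) (auto simp: sets_uniform_count_measure)
    ultimately show ?thesis by (simp cong: measurable_cong_sets)
  qed
  have int: "(\<integral>\<^sup>+ z. G (T z) \<partial>(R \<Otimes>\<^sub>M PiM I (\<lambda>_. Q)))
      = ennreal (1 / 2 ^ card I) * (\<integral>\<^sup>+ q. (\<Sum>\<xi>\<in>signs I. G (steps I q \<xi>)) \<partial>PiM I (\<lambda>_. Q))"
    if G [measurable]: "G \<in> borel_measurable (PiM I (\<lambda>_. P))" for G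
  proof -
    have Gs: "(\<lambda>q. G (steps I q \<xi>)) \<in> borel_measurable (PiM I (\<lambda>_. Q))" for \<xi>
      by (rule measurable_compose[OF steps_measurable G])
    have "(\<integral>\<^sup>+ z. G (T z) \<partial>(R \<Otimes>\<^sub>M PiM I (\<lambda>_. Q)))
        = (\<integral>\<^sup>+ \<xi>. \<integral>\<^sup>+ q. G (T (\<xi>, q)) \<partial>PiM I (\<lambda>_. Q) \<partial>R)"
      by (rule sigma_finite_measure.nn_integral_fst[OF QI, symmetric]) measurable
    also have "\<dots> = ennreal (1 / 2 ^ card I) * (\<Sum>\<xi>\<in>signs I. \<integral>\<^sup>+ q. G (steps I q \<xi>) \<partial>PiM I (\<lambda>_. Q))"
      by (simp add: R_int T_def sum_distrib_left)
    also have "(\<Sum>\<xi>\<in>signs I. \<integral>\<^sup>+ q. G (steps I q \<xi>) \<partial>PiM I (\<lambda>_. Q))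
        = (\<integral>\<^sup>+ q. (\<Sum>\<xi>\<in>signs I. G (steps I q \<xi>)) \<partial>PiM I (\<lambda>_. Q))"
      by (rule nn_integral_sum[symmetric]) (rule Gs)
    finally show ?thesis .
  qed
  have pow: "ennreal (1 / 2 ^ card I) * 2 ^ card I = 1"
  proof -
    have "(2::ennreal) ^ card I = ennreal (2 ^ card I)" by (simp add: ennreal_power[symmetric])
    thus ?thesis by (simp add: ennreal_mult[symmetric])
  qed
  have "distr (R \<Otimes>\<^sub>M PiM I (\<lambda>_. Q)) (PiM I (\<lambda>_. P)) T = PiM I (\<lambda>_. P)"
  proof (rule PP.PiM_eqI[OF I])
    fix A :: "nat \<Rightarrow> 'v set" assume A: "\<And>i. i \<in> I \<Longrightarrow> A i \<in> sets P"
    have PA [measurable]: "Pi\<^sub>E I A \<in> sets (PiM I (\<lambda>_. P))" using A by (intro sets_PiM_I_finite I) auto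
    have "emeasure (distr (R \<Otimes>\<^sub>M PiM I (\<lambda>_. Q)) (PiM I (\<lambda>_. P)) T) (Pi\<^sub>E I A)
        = (\<integral>\<^sup>+ x. indicator (Pi\<^sub>E I A) x \<partial>distr (R \<Otimes>\<^sub>M PiM I (\<lambda>_. Q)) (PiM I (\<lambda>_. P)) T)"
      using PA by simp
    also have "\<dots> = (\<integral>\<^sup>+ z. indicator (Pi\<^sub>E I A) (T z) \<partial>(R \<Otimes>\<^sub>M PiM I (\<lambda>_. Q)))"
      by (rule nn_integral_distr) measurable
    also have "\<dots> = ennreal (1 / 2 ^ card I) *
        (\<integral>\<^sup>+ q. (\<Sum>\<xi>\<in>signs I. indicator (Pi\<^sub>E I A) (steps I q \<xi>)) \<partial>PiM I (\<lambda>_. Q))"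
      by (rule int) measurable
    also have "(\<integral>\<^sup>+ q. (\<Sum>\<xi>\<in>signs I. indicator (Pi\<^sub>E I A) (steps I q \<xi>)) \<partial>PiM I (\<lambda>_. Q))
        = (\<integral>\<^sup>+ q. (\<Prod>i\<in>I. indicator (A i) (step (q i) (-1)) + indicator (A i) (step (q i) 1)) \<partial>PiM I (\<lambda>_. Q))"
    proof (intro nn_integral_cong)
      fix q :: "nat \<Rightarrow> 'v \<times> real"
      have "indicator (Pi\<^sub>E I A) (steps I q \<xi>) = (\<Prod>i\<in>I. indicator (A i) (step (q i) (\<xi> i)) :: ennreal)" for \<xi>
        using I by (auto simp: steps_def indicator_def PiE_iff prod_zero_iff intro!: prod.neutral)
      thus "(\<Sum>\<xi>\<in>signs I. indicator (Pi\<^sub>E I A) (steps I q \<xi>))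
          = (\<Prod>i\<in>I. indicator (A i) (step (q i) (-1)) + indicator (A i) (step (q i) 1) :: ennreal)"
        using sum_signs_prod[OF I, of "\<lambda>i e. indicator (A i) (step (q i) e) :: ennreal"] by simp
    qed
    also have "\<dots> = (\<Prod>i\<in>I. \<integral>\<^sup>+ q. indicator (A i) (step q (-1)) + indicator (A i) (step q 1) \<partial>Q)"
    proof (rule QQ.product_nn_integral_prod[OF I])
      fix i assume "i \<in> I"
      hence [measurable]: "A i \<in> sets borel" using A by simp
      show "(\<lambda>q. indicator (A i) (step q (-1)) + indicator (A i) (step q 1) :: ennreal) \<in> borel_measurable Q"
        by measurable
    qed
    also have "\<dots> = (\<Prod>i\<in>I. 2 * emeasure P (A i))"
    proof (intro prod.cong refl)
      fix i assume "i \<in> I"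
      hence Ai: "A i \<in> sets P" "A i \<in> sets borel" using A by simp_all
      have "(\<integral>\<^sup>+ q. indicator (A i) (step q (-1)) + indicator (A i) (step q 1) \<partial>Q)
          = 2 * (\<integral>\<^sup>+ x. indicator (A i) x \<partial>P)"
        using Ai by (intro nn_integral_step) simp
      thus "(\<integral>\<^sup>+ q. indicator (A i) (step q (-1)) + indicator (A i) (step q 1) \<partial>Q) = 2 * emeasure P (A i)"
        using Ai by simp
    qed
    also have "\<dots> = 2 ^ card I * (\<Prod>i\<in>I. emeasure P (A i))" by (simp add: prod.distrib)
    finally show "emeasure (distr (R \<Otimes>\<^sub>M PiM I (\<lambda>_. Q)) (PiM I (\<lambda>_. P)) T) (Pi\<^sub>E I A) = (\<Prod>i\<in>I. emeasure P (A i))"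
      using pow by (simp add: mult.assoc[symmetric])
  qed simp
  hence "(\<integral>\<^sup>+ x. F x \<partial>PiM I (\<lambda>_. P)) = (\<integral>\<^sup>+ x. F x \<partial>distr (R \<Otimes>\<^sub>M PiM I (\<lambda>_. Q)) (PiM I (\<lambda>_. P)) T)"
    by simp
  also have "\<dots> = (\<integral>\<^sup>+ z. F (T z) \<partial>(R \<Otimes>\<^sub>M PiM I (\<lambda>_. Q)))"
    by (rule nn_integral_distr) measurable
  also have "\<dots> = ennreal (1 / 2 ^ card I) *
      (\<integral>\<^sup>+ q. (\<Sum>\<xi>\<in>signs I. F (steps I q \<xi>)) \<partial>PiM I (\<lambda>_. Q))" by (rule int) measurable
  finally show ?thesis using pow by (simp add: mult.assoc[symmetric] mult.commute[of "2 ^ card I"])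
qed

lemma not_movable_prob: "(\<integral>\<^sup>+ q. (if movable q then 0 else 1) \<partial>Q) = (\<integral>\<^sup>+ x. ennreal (f x - h x) \<partial>lborel)"
proof -
  have "(\<integral>\<^sup>+ q. (if movable q then 0 else 1) \<partial>Q)
      = (\<integral>\<^sup>+ x. ennreal (f x) * (\<integral>\<^sup>+ u. (if movable (x, u) then 0 else 1) \<partial>unit_uniform) \<partial>lborel)"
    by (rule nn_integral_Q) measurable
  also have "\<dots> = (\<integral>\<^sup>+ x. ennreal (f x - h x) \<partial>lborel)"
    unfolding movable_def fst_conv snd_conv
    by (intro nn_integral_cong) (subst nn_integral_threshold; simp add: h_nonneg h_le)
  finally show ?thesis .
qed

text \<open>At x the movable part of the mass splits into the accepted part, of height the minimum
  of h at both ends, and the rejected part. The latter has height at most the Lipschitz constant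
  times the step length, and it vanishes outside the ball of radius k.\<close>

lemma rejected_prob_le:
  assumes lip: "\<And>x y. \<bar>h x - h y\<bar> \<le> k * norm (x - y)" and supp: "\<And>x. norm x > k \<Longrightarrow> h x = 0"
    and k: "k > 0"
  shows "(\<integral>\<^sup>+ q. (if rejected q e then 1 else 0) \<partial>Q)
    \<le> ennreal (k * norm (e *\<^sub>R v) * (unit_ball_vol (DIM('v)) * k ^ DIM('v)))"
proof -
  have pt: "ennreal (f x) * (\<integral>\<^sup>+ u. (if rejected (x, u) e then 1 else 0) \<partial>unit_uniform)
      \<le> ennreal (k * norm (e *\<^sub>R v)) * indicator (cball 0 k) x" for x
  proof -
    define m where "m = min (h x) (h (x + e *\<^sub>R v))"
    have m: "0 \<le> m" "m \<le> h x" "m \<le> f x" using h_nonneg h_le[of x] by (auto simp: m_def)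
    have split: "(if u * f x < h x then 1 else 0 :: ennreal)
        = (if u * f x < m then 1 else 0) + (if rejected (x, u) e then 1 else 0)" for u
      by (auto simp: rejected_def movable_def m_def)
    have meas: "(\<lambda>u. if rejected (x, u) e then 1 else 0 :: ennreal) \<in> borel_measurable unit_uniform"
      unfolding rejected_def movable_def by simp
    have "ennreal (h x) = ennreal (f x) * (\<integral>\<^sup>+ u. (if u * f x < h x then 1 else 0) \<partial>unit_uniform)"
      using nn_integral_threshold[of "h x" "f x" 1 0] h_nonneg h_le by simp
    also have "(\<integral>\<^sup>+ u. (if u * f x < h x then 1 else 0) \<partial>unit_uniform)
        = (\<integral>\<^sup>+ u. (if u * f x < m then 1 else 0 :: ennreal) \<partial>unit_uniform)
          + (\<integral>\<^sup>+ u. (if rejected (x, u) e then 1 else 0) \<partial>unit_uniform)"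
      unfolding split by (rule nn_integral_add[OF _ meas]) simp
    finally have "ennreal (h x) = ennreal m
        + ennreal (f x) * (\<integral>\<^sup>+ u. (if rejected (x, u) e then 1 else 0) \<partial>unit_uniform)"
      using nn_integral_threshold[of m "f x" 1 0] m by (simp add: distrib_left)
    hence "ennreal (f x) * (\<integral>\<^sup>+ u. (if rejected (x, u) e then 1 else 0) \<partial>unit_uniform) = ennreal (h x) - ennreal m"
      by (metis ennreal_add_diff_cancel_left ennreal_neq_top)
    also have "\<dots> = ennreal (h x - m)" using m by (intro ennreal_minus)
    also have "\<dots> \<le> ennreal (k * norm (e *\<^sub>R v)) * indicator (cball 0 k) x"
    proof (cases "norm x \<le> k")
      case True
      have "h x - m \<le> k * norm (e *\<^sub>R v)"
        using lip[of x "x + e *\<^sub>R v"] k by (auto simp: m_def min_def)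
      thus ?thesis using True by (simp add: ennreal_leI)
    next
      case False
      hence "h x = 0" using supp by simp
      thus ?thesis using m by simp
    qed
    finally show ?thesis .
  qed
  have "(\<integral>\<^sup>+ q. (if rejected q e then 1 else 0) \<partial>Q)
      = (\<integral>\<^sup>+ x. ennreal (f x) * (\<integral>\<^sup>+ u. (if rejected (x, u) e then 1 else 0) \<partial>unit_uniform) \<partial>lborel)"
    by (rule nn_integral_Q) measurable
  also have "\<dots> \<le> (\<integral>\<^sup>+ x. ennreal (k * norm (e *\<^sub>R v)) * indicator (cball (0::'v) k) x \<partial>lborel)"
    by (intro nn_integral_mono pt)
  also have "\<dots> = ennreal (k * norm (e *\<^sub>R v)) * emeasure lborel (cball (0::'v) k)"
    by (rule nn_integral_cmult_indicator) simp
  also have "\<dots> = ennreal (k * norm (e *\<^sub>R v) * (unit_ball_vol (DIM('v)) * k ^ DIM('v)))"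
    using k by (simp add: emeasure_cball ennreal_mult)
  finally show ?thesis .
qed

end

section \<open>Perturbation of tour lengths\<close>

text \<open>The first order change of the length when vertex i alone moves along \<theta>;
  coinciding points contribute nothing because \<open>sgn 0 = 0\<close>.\<close>

definition tour_gradient :: "nat set set \<Rightarrow> 'v::real_inner \<Rightarrow> (nat \<Rightarrow> 'v) \<Rightarrow> nat \<Rightarrow> real" where
  "tour_gradient G \<theta> x i = (\<Sum>j\<in>neighbours G i. sgn (x i - x j) \<bullet> \<theta>)"

text \<open>A bound on the sum of inverse edge lengths that does not mention the tour: n / r pays
  for edges of length r or more, the sum over all pairs for shorter ones. No tour is singled out, so
  one expectation handles all tours at once.\<close>

definition proximity :: "nat \<Rightarrow> real \<Rightarrow> real \<Rightarrow> (nat \<Rightarrow> 'v::real_normed_vector) \<Rightarrow> real" where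
  "proximity n r \<sigma> x = real n / r +
     (\<Sum>i\<in>{1..n}. \<Sum>j\<in>{1..n} - {i}. indicat_real {z. norm z < r} (x i - x j) / max (norm (x i - x j)) \<sigma>)"

lemma proximity_nonneg: "r > 0 \<Longrightarrow> \<sigma> > 0 \<Longrightarrow> proximity n r \<sigma> x \<ge> 0"
  unfolding proximity_def by (intro add_nonneg_nonneg sum_nonneg divide_nonneg_nonneg) auto

lemma sum_inverse_edge_le_proximity:
  fixes x :: "nat \<Rightarrow> 'v::real_normed_vector"
  assumes G: "G \<in> hamiltonian_cycles n" and r: "r > 0" and \<sigma>: "\<sigma> > 0"
  shows "(\<Sum>(i, j)\<in>{(i, j). i < j \<and> {i, j} \<in> G}. 1 / max (norm (x i - x j)) \<sigma>) \<le> proximity n r \<sigma> x"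
proof -
  define E where "E = {(i, j). i < j \<and> {i, j} \<in> G}"
  define k where "k = (\<lambda>z::'v. indicat_real {z. norm z < r} z / max (norm z) \<sigma>)"
  have k: "k z \<ge> 0" for z using \<sigma> by (simp add: k_def)
  have E: "finite E" "E \<subseteq> Sigma {1..n} (\<lambda>i. {1..n} - {i})"
  proof -
    show "E \<subseteq> Sigma {1..n} (\<lambda>i. {1..n} - {i})"
    proof
      fix e assume "e \<in> E"
      then obtain i j where ij: "e = (i, j)" "i < j" "{i, j} \<in> G" by (auto simp: E_def)
      obtain a b where "a \<in> {1..n} \<and> b \<in> {1..n} \<and> a \<noteq> b \<and> {i, j} = {a, b}"
        using hamiltonian_cycle_edge[OF G ij(3)] by (elim exE)
      hence "{i, j} \<subseteq> {1..n}" by simp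
      thus "e \<in> Sigma {1..n} (\<lambda>i. {1..n} - {i})" using ij by simp
    qed
    thus "finite E" by (rule finite_subset) auto
  qed
  have "(\<Sum>(i, j)\<in>E. 1 / max (norm (x i - x j)) \<sigma>) \<le> (\<Sum>(i, j)\<in>E. 1 / r + k (x i - x j))"
  proof (intro sum_mono, clarify)
    fix i j
    show "1 / max (norm (x i - x j)) \<sigma> \<le> 1 / r + k (x i - x j)"
    proof (cases "norm (x i - x j) < r")
      case True
      thus ?thesis using r by (simp add: k_def)
    next
      case False
      hence "1 / max (norm (x i - x j)) \<sigma> \<le> 1 / r" using r by (intro divide_left_mono) auto
      thus ?thesis using k[of "x i - x j"] by linarith
    qed
  qed
  also have "\<dots> = card E / r + (\<Sum>(i, j)\<in>E. k (x i - x j))"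
    by (simp add: case_prod_unfold sum.distrib)
  also have "(\<Sum>(i, j)\<in>E. k (x i - x j)) \<le> (\<Sum>(i, j)\<in>Sigma {1..n} (\<lambda>i. {1..n} - {i}). k (x i - x j))"
    using E k by (intro sum_mono2) auto
  also have "\<dots> = (\<Sum>i\<in>{1..n}. \<Sum>j\<in>{1..n} - {i}. k (x i - x j))"
    by (rule sum.Sigma[symmetric]) auto
  finally show ?thesis using card_tour_edges[OF G] by (simp add: E_def k_def proximity_def)
qed

text \<open>Each edge is expanded by \<open>norm_add_le_sgn\<close>. Since \<open>sgn\<close> is
  odd, the linear term of an edge splits symmetrically between its ends and the whole regroups by
  vertices.\<close>

lemma tour_length_perturb:
  fixes x \<eta> :: "nat \<Rightarrow> 'v::real_inner"
  assumes G: "G \<in> hamiltonian_cycles n" and r: "r > 0" and s: "s > 0" and \<eta>: "\<And>i. norm (\<eta> i) \<le> s"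
  shows "tour_length (\<lambda>i. x i + \<eta> i) G \<le> tour_length x G
    + (\<Sum>i\<in>{1..n}. \<Sum>j\<in>neighbours G i. \<eta> i \<bullet> sgn (x i - x j)) + 8 * s\<^sup>2 * proximity n r (2 * s) x"
proof -
  define E where "E = {(i, j). i < j \<and> {i, j} \<in> G}"
  have "tour_length (\<lambda>i. x i + \<eta> i) G = (\<Sum>(i, j)\<in>E. norm ((x i - x j) + (\<eta> i - \<eta> j)))"
    by (simp add: tour_length_def E_def algebra_simps)
  also have "\<dots> \<le> (\<Sum>(i, j)\<in>E. norm (x i - x j) + (\<eta> i \<bullet> sgn (x i - x j) + \<eta> j \<bullet> sgn (x j - x i))
      + 8 * s\<^sup>2 * (1 / max (norm (x i - x j)) (2 * s)))"
  proof (intro sum_mono, clarify)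
    fix i j
    have "norm (\<eta> i - \<eta> j) \<le> 2 * s" using norm_triangle_ineq4[of "\<eta> i" "\<eta> j"] \<eta>[of i] \<eta>[of j] by linarith
    from norm_add_le_sgn[OF s this, of "x i - x j"]
    have "norm ((x i - x j) + (\<eta> i - \<eta> j)) \<le> norm (x i - x j) + (\<eta> i - \<eta> j) \<bullet> sgn (x i - x j)
        + 8 * s\<^sup>2 * (1 / max (norm (x i - x j)) (2 * s))" by simp
    moreover have "sgn (x j - x i) = - sgn (x i - x j)" by (metis minus_diff_eq sgn_minus)
    ultimately show "norm ((x i - x j) + (\<eta> i - \<eta> j)) \<le> norm (x i - x j)
      + (\<eta> i \<bullet> sgn (x i - x j) + \<eta> j \<bullet> sgn (x j - x i)) + 8 * s\<^sup>2 * (1 / max (norm (x i - x j)) (2 * s))"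
      by (simp add: inner_diff_left)
  qed
  also have "\<dots> = tour_length x G + (\<Sum>(i, j)\<in>E. \<eta> i \<bullet> sgn (x i - x j) + \<eta> j \<bullet> sgn (x j - x i))
      + 8 * s\<^sup>2 * (\<Sum>(i, j)\<in>E. 1 / max (norm (x i - x j)) (2 * s))"
    by (simp add: case_prod_unfold sum.distrib sum_distrib_left tour_length_def E_def)
  also have "(\<Sum>(i, j)\<in>E. \<eta> i \<bullet> sgn (x i - x j) + \<eta> j \<bullet> sgn (x j - x i))
      = (\<Sum>i\<in>{1..n}. \<Sum>j\<in>neighbours G i. \<eta> i \<bullet> sgn (x i - x j))"
    unfolding E_def using sum_over_tour[OF G, of "\<lambda>i j. \<eta> i \<bullet> sgn (x i - x j)"] by simp
  also have "8 * s\<^sup>2 * (\<Sum>(i, j)\<in>E. 1 / max (norm (x i - x j)) (2 * s)) \<le> 8 * s\<^sup>2 * proximity n r (2 * s) x"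
    unfolding E_def using sum_inverse_edge_le_proximity[OF G r, of "2 * s" x] s
    by (intro mult_left_mono) auto
  finally show ?thesis by simp
qed

lemma tour_length_le_add:
  fixes x y :: "nat \<Rightarrow> 'v::real_normed_vector"
  assumes G: "G \<in> hamiltonian_cycles n"
  shows "tour_length x G \<le> tour_length y G + 2 * (\<Sum>i\<in>{1..n}. norm (x i - y i))"
proof -
  define E where "E = {(i, j). i < j \<and> {i, j} \<in> G}"
  have "tour_length x G \<le> (\<Sum>(i, j)\<in>E. norm (y i - y j) + (norm (x i - y i) + norm (x j - y j)))"
    unfolding tour_length_def E_def[symmetric]
  proof (intro sum_mono, clarify)
    fix i j
    have "x i - x j = (y i - y j) + ((x i - y i) - (x j - y j))" by simp
    thus "norm (x i - x j) \<le> norm (y i - y j) + (norm (x i - y i) + norm (x j - y j))"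
      by (metis add_left_mono norm_triangle_ineq norm_triangle_ineq4 order_trans)
  qed
  also have "\<dots> = tour_length y G + (\<Sum>(i, j)\<in>E. norm (x i - y i) + norm (x j - y j))"
    by (simp add: case_prod_unfold sum.distrib tour_length_def E_def)
  also have "(\<Sum>(i, j)\<in>E. norm (x i - y i) + norm (x j - y j)) = 2 * (\<Sum>i\<in>{1..n}. norm (x i - y i))"
    unfolding E_def using sum_over_tour[OF G, of "\<lambda>i j. norm (x i - y i)"] card_neighbours[OF G]
    by (simp add: sum_distrib_left)
  finally show ?thesis .
qed

text \<open>An edge in only one of the tours has an end with differing neighbourhoods, and at most
  four edges of the two tours meet at such a vertex.\<close>

lemma card_neighbours_differ:
  assumes G: "G \<in> hamiltonian_cycles n" and H: "H \<in> hamiltonian_cycles n"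
  shows "card (G - H \<union> (H - G)) \<le> 4 * card {i \<in> {1..n}. neighbours G i \<noteq> neighbours H i}"
proof -
  define D where "D = {i \<in> {1..n}. neighbours G i \<noteq> neighbours H i}"
  define S where "S = (\<lambda>i. (\<lambda>j. {i, j}) ` (neighbours G i \<union> neighbours H i))"
  have "G - H \<union> (H - G) \<subseteq> (\<Union>i\<in>D. S i)"
  proof
    fix e assume e: "e \<in> G - H \<union> (H - G)"
    hence "e \<in> G \<or> e \<in> H" by auto
    hence "\<exists>i j. i \<in> {1..n} \<and> j \<in> {1..n} \<and> i \<noteq> j \<and> e = {i, j}"
      using hamiltonian_cycle_edge[OF G] hamiltonian_cycle_edge[OF H] by (elim disjE)
    then obtain i j where ij: "i \<in> {1..n}" "i \<noteq> j" "e = {i, j}" by (elim exE conjE)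
    have "j \<in> neighbours G i \<longleftrightarrow> e \<in> G" "j \<in> neighbours H i \<longleftrightarrow> e \<in> H"
      using ij by (auto simp: neighbours_def)
    hence "i \<in> D" "j \<in> neighbours G i \<union> neighbours H i" using ij(1) e by (auto simp: D_def)
    thus "e \<in> (\<Union>i\<in>D. S i)" using ij(3) by (auto simp: S_def)
  qed
  hence "card (G - H \<union> (H - G)) \<le> card (\<Union>i\<in>D. S i)"
    using finite_neighbours[OF G] finite_neighbours[OF H] by (intro card_mono) (auto simp: D_def S_def)
  also have "\<dots> \<le> (\<Sum>i\<in>D. card (S i))" by (rule card_UN_le) (simp add: D_def)
  also have "\<dots> \<le> (\<Sum>i\<in>D. 4)"
  proof (rule sum_mono)
    fix i assume "i \<in> D"
    hence i: "i \<in> {1..n}" by (simp add: D_def)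
    have "card (S i) \<le> card (neighbours G i \<union> neighbours H i)"
      unfolding S_def using finite_neighbours[OF G i] finite_neighbours[OF H i] by (intro card_image_le) auto
    also have "\<dots> \<le> 4"
      using card_Un_le[of "neighbours G i" "neighbours H i"] card_neighbours[OF G i] card_neighbours[OF H i] by simp
    finally show "card (S i) \<le> 4" .
  qed
  finally show ?thesis by (simp add: D_def)
qed

definition long_vertices :: "nat \<Rightarrow> real \<Rightarrow> (nat \<Rightarrow> 'v::real_normed_vector) \<Rightarrow> nat set set \<Rightarrow> nat set" where
  "long_vertices n r x G = {i \<in> {1..n}. \<exists>j\<in>neighbours G i. norm (x i - x j) > r}"

lemma card_long_vertices:
  assumes G: "G \<in> hamiltonian_cycles n" and r: "r > 0"
  shows "r * card (long_vertices n r x G) \<le> 2 * tour_length x G"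
proof -
  have "r * card (long_vertices n r x G) = (\<Sum>i\<in>long_vertices n r x G. r)" by simp
  also have "\<dots> \<le> (\<Sum>i\<in>long_vertices n r x G. \<Sum>j\<in>neighbours G i. norm (x i - x j))"
  proof (rule sum_mono)
    fix i assume "i \<in> long_vertices n r x G"
    then obtain j where j: "i \<in> {1..n}" "j \<in> neighbours G i" "norm (x i - x j) > r"
      by (auto simp: long_vertices_def)
    have "norm (x i - x j) \<le> (\<Sum>j\<in>neighbours G i. norm (x i - x j))"
      using finite_neighbours[OF G j(1)] j(2) by (intro member_le_sum) auto
    thus "r \<le> (\<Sum>j\<in>neighbours G i. norm (x i - x j))" using j(3) by linarith
  qed
  also have "\<dots> \<le> (\<Sum>i\<in>{1..n}. \<Sum>j\<in>neighbours G i. norm (x i - x j))"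
    by (intro sum_mono2 sum_nonneg) (auto simp: long_vertices_def)
  finally show ?thesis by (simp add: tour_length_neighbours[OF G])
qed

lemma tour_gradient_le:
  fixes \<theta> :: "'v::euclidean_space"
  assumes G: "G \<in> hamiltonian_cycles n" and i: "i \<in> {1..n}" and \<theta>: "norm \<theta> = 1"
  shows "\<bar>tour_gradient G \<theta> x i\<bar> \<le> 2"
proof -
  have "\<bar>tour_gradient G \<theta> x i\<bar> \<le> (\<Sum>j\<in>neighbours G i. \<bar>sgn (x i - x j) \<bullet> \<theta>\<bar>)"
    unfolding tour_gradient_def by (rule sum_abs)
  also have "\<dots> \<le> (\<Sum>j\<in>neighbours G i. 1)"
  proof (rule sum_mono)
    fix j
    have "\<bar>sgn (x i - x j) \<bullet> \<theta>\<bar> \<le> norm (sgn (x i - x j)) * norm \<theta>" by (rule Cauchy_Schwarz_ineq2)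
    also have "\<dots> \<le> 1" using \<theta> by (simp add: norm_sgn)
    finally show "\<bar>sgn (x i - x j) \<bullet> \<theta>\<bar> \<le> 1" .
  qed
  finally show ?thesis using card_neighbours[OF G i] by simp
qed

text \<open>Both neighbourhoods have two elements, so some neighbour k of i in H is none in G. All
  neighbours are within r of i, and absence of coincidences applies to k against the two neighbours
  in G and the other one in H.\<close>

lemma tour_gradient_diff_ge:
  assumes G: "G \<in> hamiltonian_cycles n" and H: "H \<in> hamiltonian_cycles n" and i: "i \<in> {1..n}"
    and ne: "neighbours G i \<noteq> neighbours H i"
    and lG: "i \<notin> long_vertices n r x G" and lH: "i \<notin> long_vertices n r x H"
    and co: "\<not> coincident {1..n} r \<kappa> \<theta> x i"
  shows "\<bar>tour_gradient G \<theta> x i - tour_gradient H \<theta> x i\<bar> \<ge> \<kappa>"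
proof -
  obtain a b where ab: "neighbours G i = {a, b}" "a \<noteq> b"
    using card_neighbours[OF G i] by (meson card_2_iff)
  have "\<not> neighbours H i \<subseteq> neighbours G i"
    using ne card_neighbours[OF G i] card_neighbours[OF H i] finite_neighbours[OF G i]
    by (metis card_subset_eq)
  then obtain k where k: "k \<in> neighbours H i" "k \<noteq> a" "k \<noteq> b" using ab by blast
  obtain c where c: "neighbours H i = {k, c}" "k \<noteq> c"
    using card_neighbours[OF H i] k(1) by (metis card_2_iff insert_commute insertE singletonD)
  have near: "j \<in> crowd {1..n} r x i" if "j \<in> neighbours G i \<union> neighbours H i" for j
  proof -
    have "j \<in> {1..n} - {i}" using that neighbours_subset[OF G i] neighbours_subset[OF H i] by blast
    moreover have "norm (x i - x j) \<le> r"
      using that lG lH i unfolding long_vertices_def by force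
    ultimately show ?thesis by (simp add: crowd_def)
  qed
  have kc: "k \<in> crowd {1..n} r x i" using near k by simp
  have "a \<in> crowd ({1..n} - {k}) r x i" "b \<in> crowd ({1..n} - {k}) r x i" "c \<in> crowd ({1..n} - {k}) r x i"
    using near[of a] near[of b] near[of c] ab c k by (auto simp: crowd_def)
  hence "\<not> \<bar>direction_defect \<theta> x i a b c k\<bar> < \<kappa>" using co kc unfolding coincident_def by blast
  moreover have "direction_defect \<theta> x i a b c k = - (tour_gradient G \<theta> x i - tour_gradient H \<theta> x i)"
    using ab c by (simp add: direction_defect_def tour_gradient_def inner_add_left inner_diff_left)
  ultimately show ?thesis by simp
qed

text \<open>At least \<epsilon> n / 4 vertices have differing neighbourhoods. Each of the four kinds
  of bad vertices removes at most \<epsilon> n / 32 of them, and \<epsilon> n / 8 remain, each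
  contributing \<kappa>^2.\<close>

lemma tour_gradients_separated:
  fixes x :: "nat \<Rightarrow> 'v::euclidean_space"
  assumes G: "G \<in> hamiltonian_cycles n" and H: "H \<in> hamiltonian_cycles n"
    and dist: "graph_dist n G H > \<epsilon>" and \<kappa>: "\<kappa> > 0"
    and bad: "card {i \<in> {1..n}. \<not> m i} \<le> \<epsilon> * n / 32"
      "card {i \<in> {1..n}. coincident {1..n} r \<kappa> \<theta> x i} \<le> \<epsilon> * n / 32"
      "card (long_vertices n r x G) \<le> \<epsilon> * n / 32" "card (long_vertices n r x H) \<le> \<epsilon> * n / 32"
  shows "(\<Sum>i\<in>{1..n}. (of_bool (m i) * tour_gradient G \<theta> x i - of_bool (m i) * tour_gradient H \<theta> x i)\<^sup>2)
    \<ge> \<kappa>\<^sup>2 * (\<epsilon> * n / 8)"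
proof -
  have n: "n \<ge> 3" by (rule hamiltonian_cycle_ge3[OF G])
  define D where "D = {i \<in> {1..n}. neighbours G i \<noteq> neighbours H i}"
  define W where "W = D - ({i \<in> {1..n}. \<not> m i} \<union> {i \<in> {1..n}. coincident {1..n} r \<kappa> \<theta> x i}
      \<union> long_vertices n r x G \<union> long_vertices n r x H)"
  have "\<epsilon> * n < card (G - H \<union> (H - G))" using dist n by (simp add: graph_dist_def field_simps)
  also have "\<dots> \<le> real (4 * card D)" unfolding D_def of_nat_le_iff by (rule card_neighbours_differ[OF G H])
  finally have D: "card D \<ge> \<epsilon> * n / 4" by simp
  have "D \<subseteq> W \<union> ({i \<in> {1..n}. \<not> m i} \<union> {i \<in> {1..n}. coincident {1..n} r \<kappa> \<theta> x i}
      \<union> long_vertices n r x G \<union> long_vertices n r x H)" by (auto simp: W_def)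
  hence "card D \<le> card (W \<union> ({i \<in> {1..n}. \<not> m i} \<union> {i \<in> {1..n}. coincident {1..n} r \<kappa> \<theta> x i}
      \<union> long_vertices n r x G \<union> long_vertices n r x H))"
    by (intro card_mono) (auto simp: W_def D_def long_vertices_def)
  also have "\<dots> \<le> card W + (card {i \<in> {1..n}. \<not> m i} + card {i \<in> {1..n}. coincident {1..n} r \<kappa> \<theta> x i}
      + card (long_vertices n r x G) + card (long_vertices n r x H))"
    by (intro order_trans[OF card_Un_le] add_mono order_refl)
  finally have "real (card D) \<le> card W + (card {i \<in> {1..n}. \<not> m i}
      + card {i \<in> {1..n}. coincident {1..n} r \<kappa> \<theta> x i}
      + card (long_vertices n r x G) + card (long_vertices n r x H))" by linarith
  hence W: "card W \<ge> \<epsilon> * n / 8" using D bad by linarith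
  have "\<kappa>\<^sup>2 * (\<epsilon> * n / 8) \<le> \<kappa>\<^sup>2 * card W" using W by (intro mult_left_mono) auto
  also have "\<dots> = (\<Sum>i\<in>W. \<kappa>\<^sup>2)" by simp
  also have "\<dots> \<le> (\<Sum>i\<in>W. (of_bool (m i) * tour_gradient G \<theta> x i - of_bool (m i) * tour_gradient H \<theta> x i)\<^sup>2)"
  proof (rule sum_mono)
    fix i assume i: "i \<in> W"
    have "\<kappa> \<le> \<bar>tour_gradient G \<theta> x i - tour_gradient H \<theta> x i\<bar>"
      by (rule tour_gradient_diff_ge[OF G H]) (use i in \<open>auto simp: W_def D_def\<close>)
    hence "\<kappa>\<^sup>2 \<le> \<bar>tour_gradient G \<theta> x i - tour_gradient H \<theta> x i\<bar>\<^sup>2" using \<kappa> by (intro power_mono) auto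
    moreover have "m i" using i by (auto simp: W_def D_def)
    ultimately show "\<kappa>\<^sup>2 \<le> (of_bool (m i) * tour_gradient G \<theta> x i - of_bool (m i) * tour_gradient H \<theta> x i)\<^sup>2"
      by simp
  qed
  also have "\<dots> \<le> (\<Sum>i\<in>{1..n}. (of_bool (m i) * tour_gradient G \<theta> x i - of_bool (m i) * tour_gradient H \<theta> x i)\<^sup>2)"
    by (intro sum_mono2) (auto simp: W_def D_def)
  finally show ?thesis .
qed

section \<open>Few separated near-optimal tours\<close>

lemma emeasure_gt_le:
  assumes u [measurable]: "u \<in> borel_measurable M" and t: "t > 0"
  shows "emeasure M {x \<in> space M. ennreal t < u x} \<le> ennreal (1 / t) * (\<integral>\<^sup>+ x. u x \<partial>M)"
proof -
  have "emeasure M {x \<in> space M. ennreal t < u x} = (\<integral>\<^sup>+ x. indicator {x \<in> space M. ennreal t < u x} x \<partial>M)"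
    by (rule nn_integral_indicator[symmetric]) measurable
  also have "\<dots> \<le> (\<integral>\<^sup>+ x. ennreal (1 / t) * u x \<partial>M)"
  proof (rule nn_integral_mono)
    fix x
    show "indicator {x \<in> space M. ennreal t < u x} x \<le> ennreal (1 / t) * u x"
    proof (cases "ennreal t < u x")
      case True
      have "1 = ennreal (1 / t) * ennreal t" using t by (subst ennreal_mult[symmetric]) auto
      also have "\<dots> \<le> ennreal (1 / t) * u x" using True by (intro mult_left_mono) auto
      finally show ?thesis by (simp add: indicator_def)
    qed simp
  qed
  also have "\<dots> = ennreal (1 / t) * (\<integral>\<^sup>+ x. u x \<partial>M)" by (rule nn_integral_cmult) measurable
  finally show ?thesis .
qed

lemma emeasure_gt_le_real:
  assumes u: "u \<in> borel_measurable M" and t: "t > 0" and le: "(\<integral>\<^sup>+ x. u x \<partial>M) \<le> ennreal c" and c: "c \<le> t * \<delta>" "0 \<le> c"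
  shows "emeasure M {x \<in> space M. ennreal t < u x} \<le> ennreal \<delta>"
proof -
  have "emeasure M {x \<in> space M. ennreal t < u x} \<le> ennreal (1 / t) * (\<integral>\<^sup>+ x. u x \<partial>M)"
    by (rule emeasure_gt_le[OF u t])
  also have "\<dots> \<le> ennreal (1 / t) * ennreal c" using le by (intro mult_left_mono) auto
  also have "\<dots> = ennreal (c / t)" using t c by (subst ennreal_mult[symmetric]) auto
  also have "\<dots> \<le> ennreal \<delta>" using t c by (intro ennreal_leI) (simp add: field_simps)
  finally show ?thesis .
qed

text \<open>Ranging over the finite power set makes this a finite union of conditions on tour
  lengths, hence a measurable event.\<close>

definition many_near_optimal :: "nat \<Rightarrow> nat \<Rightarrow> real \<Rightarrow> real \<Rightarrow> (nat \<Rightarrow> 'v::real_normed_vector) \<Rightarrow> bool" where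
  "many_near_optimal n K \<epsilon> g x \<longleftrightarrow> (\<exists>T\<in>Pow (hamiltonian_cycles n). card T = K \<and>
     pairwise (\<lambda>G H. graph_dist n G H > \<epsilon>) T \<and> (\<forall>G\<in>T. tour_length x G \<le> optimal_length n x + g))"

lemma ennreal_sign_average:
  assumes "\<And>\<xi>. \<xi> \<in> signs I \<Longrightarrow> F \<xi> \<ge> 0"
  shows "ennreal (sign_average I F) = ennreal (1 / 2 ^ card I) * (\<Sum>\<xi>\<in>signs I. ennreal (F \<xi>))"
proof -
  have "ennreal (sign_average I F) = ennreal (1 / 2 ^ card I * (\<Sum>\<xi>\<in>signs I. F \<xi>))"
    by (simp add: sign_average_def)
  also have "\<dots> = ennreal (1 / 2 ^ card I) * ennreal (\<Sum>\<xi>\<in>signs I. F \<xi>)"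
    using assms by (intro ennreal_mult sum_nonneg) auto
  also have "ennreal (\<Sum>\<xi>\<in>signs I. F \<xi>) = (\<Sum>\<xi>\<in>signs I. ennreal (F \<xi>))"
    using assms by (intro sum_ennreal[symmetric]) auto
  finally show ?thesis .
qed

context bounded_density
begin

lemma tour_length_measurable:
  assumes G: "G \<in> hamiltonian_cycles n"
  shows "(\<lambda>x. tour_length x G) \<in> borel_measurable (PiM {1..n} (\<lambda>_. P))"
proof -
  have eq: "tour_length x G = (\<Sum>i\<in>{1..n}. \<Sum>j\<in>neighbours G i. norm (x i - x j)) / 2" for x :: "nat \<Rightarrow> 'v"
    using tour_length_neighbours[OF G, of x] by simp
  show ?thesis
    unfolding eq
  proof (intro borel_measurable_divide borel_measurable_sum)
    fix i j assume i: "i \<in> {1..n}" and j: "j \<in> neighbours G i"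
    have "j \<in> {1..n}" using neighbours_subset[OF G i] j by blast
    thus "(\<lambda>x. norm (x i - x j)) \<in> borel_measurable (PiM {1..n} (\<lambda>_. P))" using i by measurable
  qed auto
qed

lemma optimal_length_measurable:
  "(\<lambda>x. optimal_length n x) \<in> borel_measurable (PiM {1..n} (\<lambda>_. P))"
  unfolding optimal_length_def using finite_hamiltonian_cycles tour_length_measurable
  by (intro borel_measurable_Min) auto

lemma many_near_optimal_measurable:
  "Measurable.pred (PiM {1..n} (\<lambda>_. P)) (\<lambda>x. many_near_optimal n K \<epsilon> g x)"
proof -
  note fin = finite_hamiltonian_cycles[of n]
  have 1: "Measurable.pred (PiM {1..n} (\<lambda>_. P)) (\<lambda>x. \<forall>G\<in>T. tour_length x G \<le> optimal_length n x + g)"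
    if T: "T \<in> Pow (hamiltonian_cycles n)" for T
  proof (rule pred_intros_finite(3))
    show "finite T" using T fin by (auto intro: finite_subset)
    fix G assume "G \<in> T"
    hence "(\<lambda>x. tour_length x G) \<in> borel_measurable (PiM {1..n} (\<lambda>_. P))"
      using T by (intro tour_length_measurable) auto
    moreover have "(\<lambda>x. optimal_length n x + g) \<in> borel_measurable (PiM {1..n} (\<lambda>_. P))"
      by (intro borel_measurable_add borel_measurable_const optimal_length_measurable)
    ultimately show "Measurable.pred (PiM {1..n} (\<lambda>_. P)) (\<lambda>x. tour_length x G \<le> optimal_length n x + g)"
      unfolding pred_def by (rule borel_measurable_le)
  qed
  have 2: "Measurable.pred (PiM {1..n} (\<lambda>_. P)) (\<lambda>x. card T = K \<and>
     pairwise (\<lambda>G H. graph_dist n G H > \<epsilon>) T \<and> (\<forall>G\<in>T. tour_length x G \<le> optimal_length n x + g))"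
    if T: "T \<in> Pow (hamiltonian_cycles n)" for T
  proof -
    show ?thesis by (intro pred_intros_logic 1[OF T]) auto
  qed
  show ?thesis unfolding many_near_optimal_def
    using fin by (intro pred_intros_finite(4) 2) auto
qed

end

context metropolis
begin

definition points :: "nat set \<Rightarrow> (nat \<Rightarrow> 'v \<times> real) \<Rightarrow> nat \<Rightarrow> 'v" where
  "points I q = (\<lambda>i\<in>I. fst (q i))"

lemma distr_points:
  assumes I: "finite I"
  shows "distr (PiM I (\<lambda>_. Q)) (PiM I (\<lambda>_. P)) (points I) = PiM I (\<lambda>_. P)"
proof -
  have fst_m: "fst \<in> measurable Q P" by simp
  have "distr Q P fst = P"
  proof (rule measure_eqI)
    fix A assume "A \<in> sets (distr Q P fst)"
    hence A: "A \<in> sets P" "A \<in> sets borel" by auto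
    have "emeasure (distr Q P fst) A = (\<integral>\<^sup>+ x. indicator A x \<partial>distr Q P fst)" using A by simp
    also have "\<dots> = (\<integral>\<^sup>+ q. indicator A (fst q) \<partial>Q)" using A by (intro nn_integral_distr fst_m) simp
    also have "\<dots> = (\<integral>\<^sup>+ x. indicator A x \<partial>P)" using A by (intro nn_integral_fst_Q) simp
    finally show "emeasure (distr Q P fst) A = emeasure P A" using A by simp
  qed simp
  moreover have "points I = compose I fst" by (auto simp: points_def compose_def)
  ultimately show ?thesis
    using distr_PiM_finite_prob_space'[OF I, of "\<lambda>_. Q" "\<lambda>_. P" fst] prob_space_Q prob_space_axioms fst_m
    by simp
qed

lemma points_measurable: "points I \<in> measurable (PiM I (\<lambda>_. Q)) (PiM I (\<lambda>_. P))"
  unfolding points_def by measurable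

lemma nn_integral_points:
  assumes I: "finite I" and F: "F \<in> borel_measurable (PiM I (\<lambda>_. P))"
  shows "(\<integral>\<^sup>+ q. F (points I q) \<partial>PiM I (\<lambda>_. Q)) = (\<integral>\<^sup>+ x. F x \<partial>PiM I (\<lambda>_. P))"
  using nn_integral_distr[OF points_measurable, of F I] F distr_points[OF I] by simp

lemma nn_integral_coordinate_Q:
  assumes i: "i \<in> I" and g: "g \<in> borel_measurable (borel \<Otimes>\<^sub>M borel)"
  shows "(\<integral>\<^sup>+ q. g (q i) \<partial>PiM I (\<lambda>_::nat. Q)) = (\<integral>\<^sup>+ z. g z \<partial>Q)"
proof -
  have "(\<integral>\<^sup>+ z. g z \<partial>Q) = (\<integral>\<^sup>+ z. g z \<partial>distr (PiM I (\<lambda>_. Q)) Q (\<lambda>q. q i))"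
    using distr_PiM_component[of I "\<lambda>_. Q" i] prob_space_Q i by simp
  also have "\<dots> = (\<integral>\<^sup>+ q. g (q i) \<partial>PiM I (\<lambda>_. Q))"
    using i g by (intro nn_integral_distr) (auto cong: measurable_cong_sets)
  finally show ?thesis by simp
qed

text \<open>The detour through \<open>\<eta>\<close> separates the effects: without rejections the
  displacement is linear in the signs, and each rejection shifts one point by s, which changes two
  edges.\<close>

lemma tour_length_steps_le:
  assumes G: "G \<in> hamiltonian_cycles n" and \<theta>: "norm \<theta> = 1" and v: "v = s *\<^sub>R \<theta>" and s: "s > 0" and r: "r > 0"
    and \<xi>: "\<xi> \<in> signs {1..n}"
  shows "tour_length (steps {1..n} q \<xi>) G \<le> tour_length (points {1..n} q) G
     + s * (\<Sum>i\<in>{1..n}. \<xi> i * (of_bool (movable (q i)) * tour_gradient G \<theta> (points {1..n} q) i))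
     + 8 * s\<^sup>2 * proximity n r (2 * s) (points {1..n} q)
     + 2 * s * (\<Sum>i\<in>{1..n}. of_bool (rejected (q i) (\<xi> i)))"
proof -
  define x where "x = points {1..n} q"
  \<comment> \<open>A fictitious displacement that moves every movable point, even where the step is
    rejected.\<close>
  define \<eta> where "\<eta> = (\<lambda>i. if i \<in> {1..n} \<and> movable (q i) then \<xi> i *\<^sub>R v else 0)"
  have nv: "norm v = s" using v \<theta> s by simp
  have \<eta>: "norm (\<eta> i) \<le> s" for i
    using abs_signs[OF \<xi>, of i] nv s by (simp add: \<eta>_def)
  have "tour_length (steps {1..n} q \<xi>) G \<le> tour_length (\<lambda>i. x i + \<eta> i) G
      + 2 * (\<Sum>i\<in>{1..n}. norm (steps {1..n} q \<xi> i - (x i + \<eta> i)))"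
    by (rule tour_length_le_add[OF G])
  also have "(\<Sum>i\<in>{1..n}. norm (steps {1..n} q \<xi> i - (x i + \<eta> i))) = (\<Sum>i\<in>{1..n}. s * of_bool (rejected (q i) (\<xi> i)))"
  proof (rule sum.cong)
    fix i assume i: "i \<in> {1..n}"
    have "norm (\<xi> i *\<^sub>R v) = s" using abs_signs[OF \<xi> i] nv by simp
    thus "norm (steps {1..n} q \<xi> i - (x i + \<eta> i)) = s * of_bool (rejected (q i) (\<xi> i))"
      using i by (auto simp: steps_def step_eq x_def points_def \<eta>_def rejected_def)
  qed simp
  also have "tour_length (\<lambda>i. x i + \<eta> i) G \<le> tour_length x G
    + (\<Sum>i\<in>{1..n}. \<Sum>j\<in>neighbours G i. \<eta> i \<bullet> sgn (x i - x j)) + 8 * s\<^sup>2 * proximity n r (2 * s) x"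
    by (rule tour_length_perturb[OF G r s \<eta>])
  also have "(\<Sum>i\<in>{1..n}. \<Sum>j\<in>neighbours G i. \<eta> i \<bullet> sgn (x i - x j))
      = (\<Sum>i\<in>{1..n}. s * (\<xi> i * (of_bool (movable (q i)) * tour_gradient G \<theta> x i)))"
  proof (rule sum.cong)
    fix i assume i: "i \<in> {1..n}"
    show "(\<Sum>j\<in>neighbours G i. \<eta> i \<bullet> sgn (x i - x j)) = s * (\<xi> i * (of_bool (movable (q i)) * tour_gradient G \<theta> x i))"
      using i by (auto simp: \<eta>_def v tour_gradient_def sum_distrib_left inner_commute mult_ac)
  qed simp
  finally show ?thesis by (simp add: x_def sum_distrib_left[symmetric] mult_ac)
qed

text \<open>For every sign vector the tour attaining the maximum is used as a competitor. The minus
  sign in \<open>w\<close> turns a large Rademacher sum into a short tour, and the factor 1 / sqrt n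
  normalises the coefficient vectors.\<close>

lemma sign_average_optimal_length_le:
  assumes n: "n \<ge> 3" and \<theta>: "norm \<theta> = 1" and v: "v = s *\<^sub>R \<theta>" and s: "s > 0" and r: "r > 0"
    and T: "T \<subseteq> hamiltonian_cycles n" "T \<noteq> {}"
    and near: "\<And>G. G \<in> T \<Longrightarrow> tour_length (points {1..n} q) G \<le> optimal_length n (points {1..n} q) + g"
    and w: "\<And>G i. w G i = - (of_bool (movable (q i)) * tour_gradient G \<theta> (points {1..n} q) i) / sqrt n"
  shows "sign_average {1..n} (\<lambda>\<xi>. optimal_length n (steps {1..n} q \<xi>))
     \<le> optimal_length n (points {1..n} q) + g
     - s * sqrt n * sign_average {1..n} (\<lambda>\<xi>. MAX G\<in>T. \<Sum>i\<in>{1..n}. \<xi> i * w G i)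
     + 8 * s\<^sup>2 * proximity n r (2 * s) (points {1..n} q)
     + 2 * s * sign_average {1..n} (\<lambda>\<xi>. \<Sum>i\<in>{1..n}. of_bool (rejected (q i) (\<xi> i)))"
proof -
  define x where "x = points {1..n} q"
  define c where "c = optimal_length n x + g + 8 * s\<^sup>2 * proximity n r (2 * s) x"
  have fT: "finite T" using T(1) finite_hamiltonian_cycles by (rule finite_subset)
  have "sign_average {1..n} (\<lambda>\<xi>. optimal_length n (steps {1..n} q \<xi>))
     \<le> sign_average {1..n} (\<lambda>\<xi>. (c - s * sqrt n * (MAX G\<in>T. \<Sum>i\<in>{1..n}. \<xi> i * w G i))
        + 2 * s * (\<Sum>i\<in>{1..n}. of_bool (rejected (q i) (\<xi> i))))"
  proof (rule sign_average_mono)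
    fix \<xi> assume \<xi>: "\<xi> \<in> signs {1..n}"
    have "(MAX G\<in>T. \<Sum>i\<in>{1..n}. \<xi> i * w G i) \<in> (\<lambda>G. \<Sum>i\<in>{1..n}. \<xi> i * w G i) ` T"
      using fT T(2) by (intro Max_in) auto
    then obtain G where G: "G \<in> T" "(MAX G\<in>T. \<Sum>i\<in>{1..n}. \<xi> i * w G i) = (\<Sum>i\<in>{1..n}. \<xi> i * w G i)" by auto
    have GH: "G \<in> hamiltonian_cycles n" using G T by auto
    have "sqrt n * (\<Sum>i\<in>{1..n}. \<xi> i * w G i)
        = - (\<Sum>i\<in>{1..n}. \<xi> i * (of_bool (movable (q i)) * tour_gradient G \<theta> x i))"
      using n by (simp add: w x_def sum_distrib_left sum_negf[symmetric])
    hence eq: "s * (\<Sum>i\<in>{1..n}. \<xi> i * (of_bool (movable (q i)) * tour_gradient G \<theta> x i))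
        = - (s * sqrt n * (\<Sum>i\<in>{1..n}. \<xi> i * w G i))" by (simp add: mult.assoc)
    have "optimal_length n (steps {1..n} q \<xi>) \<le> tour_length (steps {1..n} q \<xi>) G"
      by (rule optimal_length_le[OF GH])
    also have "\<dots> \<le> tour_length x G
     + s * (\<Sum>i\<in>{1..n}. \<xi> i * (of_bool (movable (q i)) * tour_gradient G \<theta> x i))
     + 8 * s\<^sup>2 * proximity n r (2 * s) x
     + 2 * s * (\<Sum>i\<in>{1..n}. of_bool (rejected (q i) (\<xi> i)))"
      unfolding x_def by (rule tour_length_steps_le[OF GH \<theta> v s r \<xi>])
    also have "tour_length x G \<le> optimal_length n x + g" unfolding x_def by (rule near[OF G(1)])
    finally show "optimal_length n (steps {1..n} q \<xi>)
      \<le> (c - s * sqrt n * (MAX G\<in>T. \<Sum>i\<in>{1..n}. \<xi> i * w G i)) + 2 * s * (\<Sum>i\<in>{1..n}. of_bool (rejected (q i) (\<xi> i)))"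
      unfolding eq G(2) c_def by simp
  qed
  also have "\<dots> = c - s * sqrt n * sign_average {1..n} (\<lambda>\<xi>. MAX G\<in>T. \<Sum>i\<in>{1..n}. \<xi> i * w G i)
      + 2 * s * sign_average {1..n} (\<lambda>\<xi>. \<Sum>i\<in>{1..n}. of_bool (rejected (q i) (\<xi> i)))"
    unfolding sign_average_add sign_average_diff sign_average_cmult by (simp add: sign_average_const)
  finally show ?thesis by (simp add: c_def x_def)
qed

text \<open>The case of a single tour, whose linear term averages to zero. It shows that
  configurations without many separated tours lose no more than the error terms.\<close>

lemma sign_average_optimal_length_le':
  assumes n: "n \<ge> 3" and \<theta>: "norm \<theta> = 1" and v: "v = s *\<^sub>R \<theta>" and s: "s > 0" and r: "r > 0"
  shows "sign_average {1..n} (\<lambda>\<xi>. optimal_length n (steps {1..n} q \<xi>))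
     \<le> optimal_length n (points {1..n} q)
     + 8 * s\<^sup>2 * proximity n r (2 * s) (points {1..n} q)
     + 2 * s * sign_average {1..n} (\<lambda>\<xi>. \<Sum>i\<in>{1..n}. of_bool (rejected (q i) (\<xi> i)))"
proof -
  define G where "G = optimal_tour n (points {1..n} q)"
  define w where "w = (\<lambda>G i. - (of_bool (movable (q i)) * tour_gradient G \<theta> (points {1..n} q) i) / sqrt n)"
  have "sign_average {1..n} (\<lambda>\<xi>. optimal_length n (steps {1..n} q \<xi>))
     \<le> optimal_length n (points {1..n} q) + 0
     - s * sqrt n * sign_average {1..n} (\<lambda>\<xi>. MAX G\<in>{G}. \<Sum>i\<in>{1..n}. \<xi> i * w G i)
     + 8 * s\<^sup>2 * proximity n r (2 * s) (points {1..n} q)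
     + 2 * s * sign_average {1..n} (\<lambda>\<xi>. \<Sum>i\<in>{1..n}. of_bool (rejected (q i) (\<xi> i)))"
    using optimal_tour[OF n, of "points {1..n} q"] tour_length_optimal_tour[OF n, of "points {1..n} q"]
    by (intro sign_average_optimal_length_le[OF n \<theta> v s r]) (auto simp: G_def w_def)
  moreover have "sign_average {1..n} (\<lambda>\<xi>. MAX G\<in>{G}. \<Sum>i\<in>{1..n}. \<xi> i * w G i) = 0"
    by (simp add: sign_average_linear)
  ultimately show ?thesis by simp
qed

end

context metropolis
begin

lemma nn_integral_proximity_le:
  assumes dim: "DIM('v) \<ge> 2" and r: "r > 0" and \<sigma>: "\<sigma> > 0"
  shows "(\<integral>\<^sup>+ x. ennreal (proximity n r \<sigma> x) \<partial>PiM {1..n} (\<lambda>_. P))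
    \<le> ennreal (n / r + (real n)\<^sup>2 * (B * (4 * unit_ball_vol (DIM('v)) * r ^ (DIM('v) - 1))))"
    and proximity_measurable: "proximity n r \<sigma> \<in> borel_measurable (PiM {1..n} (\<lambda>_. P))"
proof -
  define M where "M = PiM {1..n} (\<lambda>_. P)"
  interpret M: prob_space M unfolding M_def by (rule prob_space_PiM_P)
  define C where "C = B * (4 * unit_ball_vol (DIM('v)) * r ^ (DIM('v) - 1))"
  have C: "C \<ge> 0" using B_nonneg r by (simp add: C_def)
  define k where "k = (\<lambda>i j (x :: nat \<Rightarrow> 'v). indicat_real {z. norm z < r} (x i - x j) / max (norm (x i - x j)) \<sigma>)"
  have k_nonneg: "k i j x \<ge> 0" for i j x using \<sigma> by (simp add: k_def)
  have k_m: "k i j \<in> borel_measurable M" if "i \<in> {1..n}" "j \<in> {1..n} - {i}" for i j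
  proof -
    have [measurable]: "{z::'v. norm z < r} \<in> sets borel" by measurable
    have "j \<in> {1..n}" using that by simp
    thus ?thesis unfolding k_def M_def using that by measurable
  qed
  have eq: "proximity n r \<sigma> = (\<lambda>x. real n / r + (\<Sum>i\<in>{1..n}. \<Sum>j\<in>{1..n} - {i}. k i j x))"
    by (intro ext) (simp add: proximity_def k_def)
  show meas: "proximity n r \<sigma> \<in> borel_measurable (PiM {1..n} (\<lambda>_. P))"
    unfolding eq M_def[symmetric] by (intro borel_measurable_add borel_measurable_const borel_measurable_sum k_m)
  have "(\<integral>\<^sup>+ x. ennreal (proximity n r \<sigma> x) \<partial>M)
      = (\<integral>\<^sup>+ x. ennreal (n / r) + (\<Sum>i\<in>{1..n}. \<Sum>j\<in>{1..n} - {i}. ennreal (k i j x)) \<partial>M)"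
    unfolding eq using r k_nonneg by (simp add: sum_nonneg sum_ennreal ennreal_plus)
  also have "\<dots> = (\<integral>\<^sup>+ x. ennreal (n / r) \<partial>M) + (\<integral>\<^sup>+ x. (\<Sum>i\<in>{1..n}. \<Sum>j\<in>{1..n} - {i}. ennreal (k i j x)) \<partial>M)"
    by (intro nn_integral_add borel_measurable_const borel_measurable_sum measurable_compose[OF k_m measurable_ennreal])
  also have "(\<integral>\<^sup>+ x. (\<Sum>i\<in>{1..n}. \<Sum>j\<in>{1..n} - {i}. ennreal (k i j x)) \<partial>M)
      = (\<Sum>i\<in>{1..n}. \<integral>\<^sup>+ x. (\<Sum>j\<in>{1..n} - {i}. ennreal (k i j x)) \<partial>M)"
    by (intro nn_integral_sum borel_measurable_sum measurable_compose[OF k_m measurable_ennreal])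
  also have "\<dots> = (\<Sum>i\<in>{1..n}. \<Sum>j\<in>{1..n} - {i}. \<integral>\<^sup>+ x. ennreal (k i j x) \<partial>M)"
    by (intro sum.cong refl nn_integral_sum measurable_compose[OF k_m measurable_ennreal])
  also have "\<dots> \<le> (\<Sum>i\<in>{1..n}. \<Sum>j\<in>{1..n} - {i}. ennreal C)"
  proof (intro sum_mono)
    fix i j assume "i \<in> {1..n}" "j \<in> {1..n} - {i}"
    thus "(\<integral>\<^sup>+ x. ennreal (k i j x) \<partial>M) \<le> ennreal C"
      unfolding k_def M_def C_def by (intro nn_integral_inverse_distance_le[OF dim r \<sigma>]) auto
  qed
  also have "\<dots> \<le> (\<Sum>i\<in>{1..n}. \<Sum>j\<in>{1..n}. ennreal C)" by (intro sum_mono sum_mono2) auto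
  also have "\<dots> = ennreal ((real n)\<^sup>2 * C)"
    using C by (simp add: ennreal_of_nat_eq_real_of_nat ennreal_mult[symmetric] power2_eq_square mult.assoc)
  also have "(\<integral>\<^sup>+ x. ennreal (n / r) \<partial>M) = ennreal (n / r)" by (simp add: M.emeasure_space_1)
  finally have "(\<integral>\<^sup>+ x. ennreal (proximity n r \<sigma> x) \<partial>M) \<le> ennreal (n / r) + ennreal ((real n)\<^sup>2 * C)"
    by (simp add: add_left_mono)
  also have "\<dots> = ennreal (n / r + (real n)\<^sup>2 * C)" using r C by (intro ennreal_plus[symmetric]) auto
  finally show "(\<integral>\<^sup>+ x. ennreal (proximity n r \<sigma> x) \<partial>PiM {1..n} (\<lambda>_. P))
    \<le> ennreal (n / r + (real n)\<^sup>2 * (B * (4 * unit_ball_vol (DIM('v)) * r ^ (DIM('v) - 1))))"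
    by (simp add: M_def C_def)
qed

lemma nn_integral_sign_average_optimal_length:
  assumes n: "n \<ge> 3"
  shows "(\<integral>\<^sup>+ q. ennreal (sign_average {1..n} (\<lambda>\<xi>. optimal_length n (steps {1..n} q \<xi>))) \<partial>PiM {1..n} (\<lambda>_. Q))
      = (\<integral>\<^sup>+ x. ennreal (optimal_length n x) \<partial>PiM {1..n} (\<lambda>_. P))" (is "?A = ?B")
    and sign_average_optimal_length_measurable:
      "(\<lambda>q. ennreal (sign_average {1..n} (\<lambda>\<xi>. optimal_length n (steps {1..n} q \<xi>)))) \<in> borel_measurable (PiM {1..n} (\<lambda>_. Q))"
proof -
  have eq: "ennreal (sign_average {1..n} (\<lambda>\<xi>. optimal_length n (steps {1..n} q \<xi>)))
      = ennreal (1 / 2 ^ n) * (\<Sum>\<xi>\<in>signs {1..n}. ennreal (optimal_length n (steps {1..n} q \<xi>)))" for q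
    by (subst ennreal_sign_average) (simp_all add: optimal_length_nonneg[OF n])
  have m: "(\<lambda>x. ennreal (optimal_length n x)) \<in> borel_measurable (PiM {1..n} (\<lambda>_. P))"
    by (rule measurable_compose[OF optimal_length_measurable measurable_ennreal])
  have m2: "(\<lambda>q. \<Sum>\<xi>\<in>signs {1..n}. ennreal (optimal_length n (steps {1..n} q \<xi>))) \<in> borel_measurable (PiM {1..n} (\<lambda>_. Q))"
    by (intro borel_measurable_sum measurable_compose[OF steps_measurable m])
  show "(\<lambda>q. ennreal (sign_average {1..n} (\<lambda>\<xi>. optimal_length n (steps {1..n} q \<xi>)))) \<in> borel_measurable (PiM {1..n} (\<lambda>_. Q))"
    unfolding eq using m2 by (intro borel_measurable_times_ennreal borel_measurable_const)
  have "?A = ennreal (1 / 2 ^ n) * (\<integral>\<^sup>+ q. (\<Sum>\<xi>\<in>signs {1..n}. ennreal (optimal_length n (steps {1..n} q \<xi>))) \<partial>PiM {1..n} (\<lambda>_. Q))"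
    unfolding eq by (rule nn_integral_cmult[OF m2])
  also have "\<dots> = ennreal (1 / 2 ^ n) * (2 ^ n * ?B)"
    using nn_integral_steps[OF _ m] by simp
  also have "\<dots> = (ennreal (1 / 2 ^ n) * 2 ^ n) * ?B" by (simp add: mult.assoc)
  also have "ennreal (1 / 2 ^ n) * 2 ^ n = 1"
  proof -
    have "(2::ennreal) ^ n = ennreal (2 ^ n)" by (simp add: ennreal_power[symmetric])
    thus ?thesis by (simp add: ennreal_mult[symmetric])
  qed
  finally show "?A = ?B" by simp
qed

lemma nn_integral_sign_average_rejected:
  fixes n :: nat
  assumes lip: "\<And>x y. \<bar>h x - h y\<bar> \<le> k * norm (x - y)" and supp: "\<And>x. norm x > k \<Longrightarrow> h x = 0"
    and k: "k > 0"
  shows "(\<integral>\<^sup>+ q. ennreal (sign_average {1..n} (\<lambda>\<xi>. \<Sum>i\<in>{1..n}. of_bool (rejected (q i) (\<xi> i)))) \<partial>PiM {1..n} (\<lambda>_. Q))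
      \<le> ennreal (real n * (k * norm v * (unit_ball_vol (DIM('v)) * k ^ DIM('v))))" (is "?A \<le> _")
    and sign_average_rejected_measurable:
      "(\<lambda>q. ennreal (sign_average {1..n} (\<lambda>\<xi>. \<Sum>i\<in>{1..n}. of_bool (rejected (q i) (\<xi> i))))) \<in> borel_measurable (PiM {1..n} (\<lambda>_. Q))"
proof -
  define c where "c = k * norm v * (unit_ball_vol (DIM('v)) * k ^ DIM('v))"
  have c: "c \<ge> 0" using k by (simp add: c_def)
  define R where "R = (\<lambda>e z. if rejected z e then 1 else 0 :: ennreal)"
  have R_m: "R e \<in> borel_measurable (borel \<Otimes>\<^sub>M borel)" for e unfolding R_def by measurable
  have R_i: "(\<lambda>q. R e (q i)) \<in> borel_measurable (PiM {1..n} (\<lambda>_. Q))" if "i \<in> {1..n}" for e i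
  proof (rule measurable_compose[OF measurable_component_singleton[OF that]])
    show "R e \<in> borel_measurable Q" using R_m by (simp cong: measurable_cong_sets)
  qed
  have eq: "ennreal (sign_average {1..n} (\<lambda>\<xi>. \<Sum>i\<in>{1..n}. of_bool (rejected (q i) (\<xi> i))))
      = ennreal (1 / 2 ^ n) * (\<Sum>\<xi>\<in>signs {1..n}. \<Sum>i\<in>{1..n}. R (\<xi> i) (q i))" for q
  proof -
    have "ennreal (\<Sum>i\<in>{1..n}. of_bool (rejected (q i) (\<xi> i))) = (\<Sum>i\<in>{1..n}. R (\<xi> i) (q i))" for \<xi>
    proof -
      have "ennreal (\<Sum>i\<in>{1..n}. of_bool (rejected (q i) (\<xi> i))) = (\<Sum>i\<in>{1..n}. ennreal (of_bool (rejected (q i) (\<xi> i))))"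
        by (rule sum_ennreal[symmetric]) simp
      also have "\<dots> = (\<Sum>i\<in>{1..n}. R (\<xi> i) (q i))" by (intro sum.cong refl) (simp add: R_def of_bool_def)
      finally show ?thesis .
    qed
    thus ?thesis
      by (subst ennreal_sign_average) (simp_all add: sum_nonneg del: sum_of_bool_eq)
  qed
  have m2: "(\<lambda>q. \<Sum>\<xi>\<in>signs {1..n}. \<Sum>i\<in>{1..n}. R (\<xi> i) (q i)) \<in> borel_measurable (PiM {1..n} (\<lambda>_. Q))"
    by (intro borel_measurable_sum R_i)
  show "(\<lambda>q. ennreal (sign_average {1..n} (\<lambda>\<xi>. \<Sum>i\<in>{1..n}. of_bool (rejected (q i) (\<xi> i))))) \<in> borel_measurable (PiM {1..n} (\<lambda>_. Q))"
    unfolding eq using m2 by (intro borel_measurable_times_ennreal borel_measurable_const)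
  have "?A = ennreal (1 / 2 ^ n) * (\<integral>\<^sup>+ q. (\<Sum>\<xi>\<in>signs {1..n}. \<Sum>i\<in>{1..n}. R (\<xi> i) (q i)) \<partial>PiM {1..n} (\<lambda>_. Q))"
    unfolding eq by (rule nn_integral_cmult[OF m2])
  also have "(\<integral>\<^sup>+ q. (\<Sum>\<xi>\<in>signs {1..n}. \<Sum>i\<in>{1..n}. R (\<xi> i) (q i)) \<partial>PiM {1..n} (\<lambda>_. Q))
      = (\<Sum>\<xi>\<in>signs {1..n}. \<integral>\<^sup>+ q. (\<Sum>i\<in>{1..n}. R (\<xi> i) (q i)) \<partial>PiM {1..n} (\<lambda>_. Q))"
    by (intro nn_integral_sum borel_measurable_sum R_i)
  also have "\<dots> = (\<Sum>\<xi>\<in>signs {1..n}. \<Sum>i\<in>{1..n}. \<integral>\<^sup>+ q. R (\<xi> i) (q i) \<partial>PiM {1..n} (\<lambda>_. Q))"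
    by (intro sum.cong refl nn_integral_sum R_i)
  also have "\<dots> \<le> (\<Sum>\<xi>\<in>signs {1..n}. \<Sum>i\<in>{1..n}. ennreal c)"
  proof (intro sum_mono)
    fix \<xi> i assume \<xi>: "\<xi> \<in> signs {1..n}" and i: "i \<in> {1..n}"
    have "(\<integral>\<^sup>+ q. R (\<xi> i) (q i) \<partial>PiM {1..n} (\<lambda>_. Q)) = (\<integral>\<^sup>+ z. R (\<xi> i) z \<partial>Q)"
      by (rule nn_integral_coordinate_Q[OF i R_m])
    also have "\<dots> \<le> ennreal (k * norm (\<xi> i *\<^sub>R v) * (unit_ball_vol (DIM('v)) * k ^ DIM('v)))"
      unfolding R_def by (rule rejected_prob_le[OF lip supp k])
    also have "norm (\<xi> i *\<^sub>R v) = norm v" using abs_signs[OF \<xi> i] by simp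
    finally show "(\<integral>\<^sup>+ q. R (\<xi> i) (q i) \<partial>PiM {1..n} (\<lambda>_. Q)) \<le> ennreal c" by (simp add: c_def)
  qed
  also have "\<dots> = ennreal (2 ^ n * (n * c))"
    using c by (simp add: card_signs ennreal_of_nat_eq_real_of_nat ennreal_mult ennreal_power[symmetric])
  finally have "?A \<le> ennreal (1 / 2 ^ n) * ennreal (2 ^ n * (n * c))" by (simp add: mult_left_mono)
  also have "\<dots> = ennreal (n * c)" using c by (subst ennreal_mult[symmetric]) auto
  finally show "?A \<le> ennreal (real n * (k * norm v * (unit_ball_vol (DIM('v)) * k ^ DIM('v))))" by (simp add: c_def)
qed

text \<open>By stationarity the optimal length does not change on average, so it rarely decreases much.\<close>

lemma gain_probability_le:
  assumes dim: "DIM('v) \<ge> 2" and n: "n \<ge> 3" and \<theta>: "norm \<theta> = 1" and v: "v = s *\<^sub>R \<theta>" and s: "s > 0" and r: "r > 0"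
    and lip: "\<And>x y. \<bar>h x - h y\<bar> \<le> k * norm (x - y)" and supp: "\<And>x. norm x > k \<Longrightarrow> h x = 0" and k: "k > 0"
    and fin: "(\<integral>\<^sup>+ x. ennreal (optimal_length n x) \<partial>PiM {1..n} (\<lambda>_. P)) < \<infinity>"
    and W: "W \<in> sets (PiM {1..n} (\<lambda>_. Q))" and gain: "gain \<ge> 0"
    and gainW: "\<And>q. q \<in> W \<Longrightarrow> sign_average {1..n} (\<lambda>\<xi>. optimal_length n (steps {1..n} q \<xi>)) + gain
     \<le> optimal_length n (points {1..n} q) + 8 * s\<^sup>2 * proximity n r (2 * s) (points {1..n} q)
     + 2 * s * sign_average {1..n} (\<lambda>\<xi>. \<Sum>i\<in>{1..n}. of_bool (rejected (q i) (\<xi> i)))"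
  shows "ennreal gain * emeasure (PiM {1..n} (\<lambda>_. Q)) W \<le>
    ennreal (8 * s\<^sup>2 * (n / r + (real n)\<^sup>2 * (B * (4 * unit_ball_vol (DIM('v)) * r ^ (DIM('v) - 1))))
      + 2 * s * (n * (k * s * (unit_ball_vol (DIM('v)) * k ^ DIM('v)))))"
proof -
  define M where "M = PiM {1..n} (\<lambda>_. Q)"
  define L where "L = (\<lambda>q. sign_average {1..n} (\<lambda>\<xi>. optimal_length n (steps {1..n} q \<xi>)))"
  define O' where "O' = (\<lambda>q. optimal_length n (points {1..n} q))"
  define \<Psi> where "\<Psi> = (\<lambda>q. proximity n r (2 * s) (points {1..n} q))"
  define J where "J = (\<lambda>q. sign_average {1..n} (\<lambda>\<xi>. \<Sum>i\<in>{1..n}. of_bool (rejected (q i) (\<xi> i))))"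
  define c1 where "c1 = n / r + (real n)\<^sup>2 * (B * (4 * unit_ball_vol (DIM('v)) * r ^ (DIM('v) - 1)))"
  define c2 where "c2 = n * (k * s * (unit_ball_vol (DIM('v)) * k ^ DIM('v)))"
  have c: "c1 \<ge> 0" "c2 \<ge> 0" using r k s B_nonneg by (auto simp: c1_def c2_def)
  have s2: "2 * s > 0" using s by simp
  have nv: "norm v = s" using v \<theta> s by simp
  have nonneg: "L q \<ge> 0" "O' q \<ge> 0" "\<Psi> q \<ge> 0" "J q \<ge> 0" for q
  proof -
    have "sign_average {1..n} (\<lambda>_. 0) \<le> L q" unfolding L_def
      by (rule sign_average_mono) (rule optimal_length_nonneg[OF n])
    thus "L q \<ge> 0" by (simp add: sign_average_const)
    have "sign_average {1..n} (\<lambda>_. 0) \<le> J q" unfolding J_def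
      by (rule sign_average_mono) (rule sum_nonneg, simp)
    thus "J q \<ge> 0" by (simp add: sign_average_const)
  qed (simp_all add: O'_def \<Psi>_def optimal_length_nonneg[OF n] proximity_nonneg[OF r s2])
  have L_m: "(\<lambda>q. ennreal (L q)) \<in> borel_measurable M"
    unfolding L_def M_def by (rule sign_average_optimal_length_measurable[OF n])
  have J_m: "(\<lambda>q. ennreal (J q)) \<in> borel_measurable M"
    unfolding J_def M_def by (rule sign_average_rejected_measurable[OF lip supp k])
  have O_mP: "(\<lambda>x. ennreal (optimal_length n x)) \<in> borel_measurable (PiM {1..n} (\<lambda>_. P))"
    by (rule measurable_compose[OF optimal_length_measurable measurable_ennreal])
  have \<Psi>_mP: "(\<lambda>x. ennreal (proximity n r (2 * s) x)) \<in> borel_measurable (PiM {1..n} (\<lambda>_. P))"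
    by (rule measurable_compose[OF proximity_measurable[OF dim r s2] measurable_ennreal])
  have O_m: "(\<lambda>q. ennreal (O' q)) \<in> borel_measurable M"
    unfolding O'_def M_def by (rule measurable_compose[OF points_measurable O_mP])
  have \<Psi>_m: "(\<lambda>q. ennreal (\<Psi> q)) \<in> borel_measurable M"
    unfolding \<Psi>_def M_def by (rule measurable_compose[OF points_measurable \<Psi>_mP])
  have W_m: "W \<in> sets M" using W by (simp add: M_def)
  define E where "E = (\<integral>\<^sup>+ x. ennreal (optimal_length n x) \<partial>PiM {1..n} (\<lambda>_. P))"
  \<comment> \<open>The gain is claimed on \<open>W\<close> only; elsewhere
    \<open>sign_average_optimal_length_le'\<close> supplies the same inequality without it.\<close>
  have pt: "ennreal (L q) + ennreal gain * indicator W q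
      \<le> ennreal (O' q) + (ennreal (8 * s\<^sup>2) * ennreal (\<Psi> q) + ennreal (2 * s) * ennreal (J q))" for q
  proof -
    have "L q + gain * indicat_real W q \<le> O' q + 8 * s\<^sup>2 * \<Psi> q + 2 * s * J q"
    proof (cases "q \<in> W")
      case True
      thus ?thesis using gainW[OF True] by (simp add: L_def O'_def \<Psi>_def J_def)
    next
      case False
      thus ?thesis using sign_average_optimal_length_le'[OF n \<theta> v s r, of q]
        by (simp add: L_def O'_def \<Psi>_def J_def)
    qed
    hence "ennreal (L q + gain * indicat_real W q) \<le> ennreal (O' q + (8 * s\<^sup>2 * \<Psi> q + 2 * s * J q))"
      by (intro ennreal_leI) (simp add: add.assoc)
    also have "\<dots> = ennreal (O' q) + (ennreal (8 * s\<^sup>2) * ennreal (\<Psi> q) + ennreal (2 * s) * ennreal (J q))"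
      using nonneg[of q] s by (simp add: ennreal_plus ennreal_mult)
    also have "ennreal (L q + gain * indicat_real W q) = ennreal (L q) + ennreal gain * indicator W q"
      using nonneg[of q] gain by (cases "q \<in> W") (auto simp: ennreal_plus)
    finally show ?thesis .
  qed
  have "E + ennreal gain * emeasure M W = (\<integral>\<^sup>+ q. ennreal (L q) \<partial>M) + (\<integral>\<^sup>+ q. ennreal gain * indicator W q \<partial>M)"
    using nn_integral_sign_average_optimal_length[OF n] nn_integral_cmult_indicator[OF W_m, of "ennreal gain"]
    by (simp add: E_def L_def M_def)
  also have "\<dots> = (\<integral>\<^sup>+ q. ennreal (L q) + ennreal gain * indicator W q \<partial>M)"
    using L_m W_m by (intro nn_integral_add[symmetric]) auto
  also have "\<dots> \<le> (\<integral>\<^sup>+ q. ennreal (O' q) + (ennreal (8 * s\<^sup>2) * ennreal (\<Psi> q) + ennreal (2 * s) * ennreal (J q)) \<partial>M)"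
    by (intro nn_integral_mono pt)
  also have "\<dots> = (\<integral>\<^sup>+ q. ennreal (O' q) \<partial>M) + (\<integral>\<^sup>+ q. ennreal (8 * s\<^sup>2) * ennreal (\<Psi> q) + ennreal (2 * s) * ennreal (J q) \<partial>M)"
    using O_m \<Psi>_m J_m by (intro nn_integral_add) auto
  also have "(\<integral>\<^sup>+ q. ennreal (8 * s\<^sup>2) * ennreal (\<Psi> q) + ennreal (2 * s) * ennreal (J q) \<partial>M)
      = (\<integral>\<^sup>+ q. ennreal (8 * s\<^sup>2) * ennreal (\<Psi> q) \<partial>M) + (\<integral>\<^sup>+ q. ennreal (2 * s) * ennreal (J q) \<partial>M)"
    using \<Psi>_m J_m by (intro nn_integral_add) auto
  also have "(\<integral>\<^sup>+ q. ennreal (O' q) \<partial>M) = E"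
    unfolding O'_def M_def E_def by (rule nn_integral_points[OF _ O_mP]) simp
  also have "(\<integral>\<^sup>+ q. ennreal (8 * s\<^sup>2) * ennreal (\<Psi> q) \<partial>M) \<le> ennreal (8 * s\<^sup>2 * c1)"
  proof -
    have "(\<integral>\<^sup>+ q. ennreal (8 * s\<^sup>2) * ennreal (\<Psi> q) \<partial>M) = ennreal (8 * s\<^sup>2) * (\<integral>\<^sup>+ q. ennreal (\<Psi> q) \<partial>M)"
      by (rule nn_integral_cmult[OF \<Psi>_m])
    also have "(\<integral>\<^sup>+ q. ennreal (\<Psi> q) \<partial>M) = (\<integral>\<^sup>+ x. ennreal (proximity n r (2 * s) x) \<partial>PiM {1..n} (\<lambda>_. P))"
      unfolding \<Psi>_def M_def by (rule nn_integral_points[OF _ \<Psi>_mP]) simp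
    also have "ennreal (8 * s\<^sup>2) * \<dots> \<le> ennreal (8 * s\<^sup>2) * ennreal c1"
      unfolding c1_def by (intro mult_left_mono nn_integral_proximity_le[OF dim r s2]) simp
    also have "\<dots> = ennreal (8 * s\<^sup>2 * c1)" using c by (intro ennreal_mult[symmetric]) auto
    finally show ?thesis .
  qed
  also have "(\<integral>\<^sup>+ q. ennreal (2 * s) * ennreal (J q) \<partial>M) \<le> ennreal (2 * s * c2)"
  proof -
    have "(\<integral>\<^sup>+ q. ennreal (2 * s) * ennreal (J q) \<partial>M) = ennreal (2 * s) * (\<integral>\<^sup>+ q. ennreal (J q) \<partial>M)"
      by (rule nn_integral_cmult[OF J_m])
    also have "\<dots> \<le> ennreal (2 * s) * ennreal c2"
      using nn_integral_sign_average_rejected[OF lip supp k, of n] unfolding J_def M_def c2_def nv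
      by (intro mult_left_mono) auto
    also have "\<dots> = ennreal (2 * s * c2)" using c s by (intro ennreal_mult[symmetric]) auto
    finally show ?thesis .
  qed
  finally have "E + ennreal gain * emeasure M W \<le> E + (ennreal (8 * s\<^sup>2 * c1) + ennreal (2 * s * c2))"
    by (simp add: add_left_mono add_right_mono)
  \<comment> \<open>Finiteness permits cancelling the expected optimal length, which occurs on both
    sides by stationarity.\<close>
  moreover have "E \<noteq> \<infinity>" using fin by (simp add: E_def)
  ultimately have "ennreal gain * emeasure M W \<le> ennreal (8 * s\<^sup>2 * c1) + ennreal (2 * s * c2)"
    by (simp add: ennreal_add_left_cancel_le)
  also have "\<dots> = ennreal (8 * s\<^sup>2 * c1 + 2 * s * c2)" using c s by (intro ennreal_plus[symmetric]) auto
  finally show ?thesis by (simp add: M_def c1_def c2_def)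
qed

end

context bounded_density
begin

text \<open>All lengths are measured in units of n^(-1/d). The constants are chosen in the order
  radius, crowd bound, cone width, h, minoration level, K; none of them depends on n. Many separated
  tours then yield a gain that \<open>gain_probability_le\<close> permits only with small
  probability.\<close>

lemma few_near_optimal:
  fixes C0 g \<epsilon> \<delta> :: real
  assumes dim: "DIM('v) \<ge> 2" and cont: "AE x in lborel. isCont f x"
    and C0: "C0 > 0" and opt: "\<And>n. n \<ge> N0 \<Longrightarrow> (\<integral>\<^sup>+ x. ennreal (optimal_length n x) \<partial>PiM {1..n} (\<lambda>_. P))
        \<le> ennreal (C0 * (real n * real n powr (- 1 / DIM('v))))"
    and \<epsilon>: "\<epsilon> > 0" and \<delta>: "\<delta> > 0" and g: "g > 0"
  shows "\<exists>K>0. \<exists>N. \<forall>n\<ge>N. emeasure (PiM {1..n} (\<lambda>_. P))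
    {x \<in> space (PiM {1..n} (\<lambda>_. P)). many_near_optimal n K \<epsilon> (g * real n powr (- 1 / DIM('v))) x} \<le> ennreal \<delta>"
proof -
  define d where "d = DIM('v)"
  have d: "d \<ge> 2" "d > 0" using dim by (auto simp: d_def)
  define \<omega> where "\<omega> = unit_ball_vol (DIM('v))"
  have \<omega>: "\<omega> \<ge> 0" by (simp add: \<omega>_def)
  obtain \<theta> :: 'v where \<theta>: "\<theta> \<in> Basis" using nonempty_Basis by blast
  have "(Basis :: 'v set) \<noteq> {\<theta>}"
  proof
    assume "(Basis :: 'v set) = {\<theta>}"
    hence "DIM('v) = card {\<theta>}" by (rule arg_cong)
    thus False using dim by simp
  qed
  then obtain \<theta>' :: 'v where \<theta>': "\<theta>' \<in> Basis" "\<theta> \<noteq> \<theta>'"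
    using \<theta> by blast
  have n\<theta>: "norm \<theta> = 1" using \<theta> by simp
  \<comment> \<open>By Markov's inequality the optimal length exceeds
    \<open>C3 * (n * \<alpha>)\<close> with probability at most \<delta> / 8.\<close>
  define C3 where "C3 = 8 * C0 / \<delta>"
  have C3: "C3 > 0" using C0 \<delta> by (simp add: C3_def)
  \<comment> \<open>Chosen so that r = R \<alpha> satisfies r \<epsilon> n / 32 = 2 (C3 + g) n
    \<alpha>, twice the greatest length allowed for a near-optimal tour; hence such tours have at
    most \<epsilon> n / 32 vertices on an edge longer than r.\<close>
  define R where "R = 64 * (C3 + g) / \<epsilon>"
  have R: "R > 0" using C3 g \<epsilon> by (simp add: R_def)
  define D where "D = B * \<omega> * R ^ d"
  have D: "D \<ge> 0" using B_nonneg \<omega> R by (simp add: D_def)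
  \<comment> \<open>First q makes large crowds rare, then m makes the order q^3 cones per pair thin
    enough, and m determines \<kappa>. The shares \<epsilon> \<delta> / 512 of both add up to b
    \<delta> / 8 after multiplication by n.\<close>
  obtain q where q: "512 * D / (\<epsilon> * \<delta>) + 1 < real q" using reals_Archimedean2 by blast
  have q0: "real q > 0" using q D \<epsilon> \<delta> by (smt (verit) divide_nonneg_pos mult_pos_pos)
  have Dq: "D * (1 / q) \<le> \<epsilon> * \<delta> / 512"
  proof -
    have "512 * D / (\<epsilon> * \<delta>) \<le> q" using q by linarith
    hence "512 * D \<le> q * (\<epsilon> * \<delta>)" using \<epsilon> \<delta> by (simp add: pos_divide_le_eq)
    thus ?thesis using q0 by (simp add: field_simps)
  qed
  define D2 where "D2 = D * (2 * 2 ^ d * real q ^ 3)"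
  have D2: "D2 \<ge> 0" using D by (simp add: D2_def)
  obtain m where m: "512 * D2 / (\<epsilon> * \<delta>) + 1 < real m" using reals_Archimedean2 by blast
  have m0: "real m > 0" using m D2 \<epsilon> \<delta> by (smt (verit) divide_nonneg_pos mult_pos_pos)
  have Dm: "D2 / m \<le> \<epsilon> * \<delta> / 512"
  proof -
    have "512 * D2 / (\<epsilon> * \<delta>) \<le> m" using m by linarith
    hence "512 * D2 \<le> m * (\<epsilon> * \<delta>)" using \<epsilon> \<delta> by (simp add: pos_divide_le_eq)
    thus ?thesis using m0 by (simp add: field_simps)
  qed
  define \<kappa> where "\<kappa> = 1 / (8 * real m ^ 3)"
  have \<kappa>: "\<kappa> > 0" using m0 by (simp add: \<kappa>_def)
  have "(\<integral>\<^sup>+ x. ennreal (f x) \<partial>lborel) < \<infinity>"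
    using emeasure_space_1 unfolding density by (simp add: emeasure_density)
  \<comment> \<open>The mass \<epsilon> \<delta> / 256 is the expected fraction of points that
    cannot move; Markov's inequality with threshold \<epsilon> n / 32 leaves probability \<delta> /
    8.\<close>
  then obtain h k where k: "k > 0" and h: "\<And>x. 0 \<le> h x" "\<And>x. h x \<le> f x"
    and lip: "\<And>x y. \<bar>h x - h y\<bar> \<le> k * norm (x - y)" and supp: "\<And>x. norm x > k \<Longrightarrow> h x = 0"
    and hf: "(\<integral>\<^sup>+ x. ennreal (f x - h x) \<partial>lborel) \<le> ennreal (\<epsilon> * \<delta> / 256)"
    using lipschitz_lower_approximation[OF f_meas f_nonneg _ cont, of "\<epsilon> * \<delta> / 256"] \<epsilon> \<delta> by auto
  have "continuous_on UNIV h"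
  proof (rule continuous_onI)
    fix x :: 'v and e :: real assume e: "0 < e"
    show "\<exists>d>0. \<forall>x'\<in>UNIV. dist x' x < d \<longrightarrow> dist (h x') (h x) \<le> e"
    proof (intro exI[of _ "e / k"] conjI ballI impI)
      fix x' assume "dist x' x < e / k"
      hence "k * norm (x' - x) \<le> e" using k by (simp add: dist_norm field_simps)
      thus "dist (h x') (h x) \<le> e" using lip[of x' x] by (simp add: dist_real_def)
    qed (use e k in simp)
  qed
  hence h_m: "h \<in> borel_measurable borel" by (rule borel_measurable_continuous_onI)
  \<comment> \<open>Both error terms together are at most \<open>\<alpha> * c\<close>: the first
    summand is the second order term, the second one the rejections.\<close>
  define c where "c = 8 * (1 + 4 * B * \<omega>) + 2 * k * \<omega> * k ^ d"
  have c: "c \<ge> 0" using B_nonneg \<omega> k by (simp add: c_def)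
  \<comment> \<open>After the slack g is subtracted, the gain is \<alpha> 2 (c + 1) / \<delta>,
    which beats the error \<alpha> c outside probability \<delta> / 2.\<close>
  define \<Lambda> where "\<Lambda> = g + 2 * (c + 1) / \<delta>"
  \<comment> \<open>The bound \<kappa>^2 \<epsilon> n / 8 on squared differences of gradients,
    divided by n.\<close>
  define a where "a = \<kappa> * sqrt (\<epsilon> / 8)"
  have a: "a > 0" using \<kappa> \<epsilon> by (simp add: a_def)
  have a2: "a\<^sup>2 = \<kappa>\<^sup>2 * (\<epsilon> / 8)" using \<epsilon> by (simp add: a_def power_mult_distrib)
  obtain K \<beta> where K: "K > 0" and \<beta>: "\<beta> > 0" and sud:
    "\<And>(I :: nat set) (T :: nat set set set) v. finite I \<Longrightarrow> finite T \<Longrightarrow> K \<le> card T \<Longrightarrow>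
       (\<forall>k\<in>T. \<forall>i\<in>I. \<bar>v k i\<bar> \<le> \<beta>) \<Longrightarrow> (\<forall>k\<in>T. (\<Sum>i\<in>I. (v k i)\<^sup>2) \<le> 2\<^sup>2) \<Longrightarrow>
       pairwise (\<lambda>j k. (\<Sum>i\<in>I. (v j i - v k i)\<^sup>2) \<ge> a\<^sup>2) T \<Longrightarrow>
       sign_average I (\<lambda>\<xi>. MAX k\<in>T. \<Sum>i\<in>I. \<xi> i * v k i) \<ge> \<Lambda>"
    using rademacher_sudakov[OF a, of 2 \<Lambda>, where 'i = nat and 'k = "nat set set"] by auto
  \<comment> \<open>Normalised coefficients are at most 2 / sqrt n, hence at most \<beta> from
    \<open>N1\<close> on.\<close>
  obtain N1 where N1: "(2 / \<beta>)\<^sup>2 < real N1" using reals_Archimedean2 by blast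
  define N where "N = max 3 (max N0 N1)"
  have main: "emeasure (PiM {1..n} (\<lambda>_. P))
    {x \<in> space (PiM {1..n} (\<lambda>_. P)). many_near_optimal n K \<epsilon> (g * real n powr (- 1 / DIM('v))) x} \<le> ennreal \<delta>"
    if nN: "n \<ge> N" for n
  proof -
    define \<alpha> where "\<alpha> = real n powr (- 1 / DIM('v))"
    have n: "n \<ge> 3" "n \<ge> N0" "n \<ge> N1" "real n > 0" using nN by (auto simp: N_def)
    have \<alpha>: "\<alpha> > 0" using n by (simp add: \<alpha>_def)
    have \<alpha>1: "\<alpha> \<le> 1"
    proof -
      have "real n powr (- 1 / DIM('v)) \<le> real n powr 0" using n by (intro powr_mono) auto
      thus ?thesis using n by (simp add: \<alpha>_def)
    qed
    have \<alpha>d: "\<alpha> ^ d = 1 / n"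
    proof -
      have "\<alpha> ^ d = real n powr (- 1 / d * d)"
        using n d by (simp add: \<alpha>_def d_def powr_powr flip: powr_realpow)
      thus ?thesis using n d by (simp add: powr_minus_divide)
    qed
    have \<alpha>d1: "\<alpha> ^ (d - 1) = 1 / (n * \<alpha>)"
    proof -
      have "\<alpha> ^ d = \<alpha> ^ (d - 1) * \<alpha>" using d by (cases d) auto
      thus ?thesis using \<alpha>d \<alpha> n by (simp add: field_simps)
    qed
    define s where "s = \<alpha> / sqrt n"
    have s: "s > 0" "s * sqrt n = \<alpha>" "s\<^sup>2 = \<alpha>\<^sup>2 / n" using \<alpha> n by (auto simp: s_def power_divide)
    define r where "r = R * \<alpha>"
    have r: "r > 0" using R \<alpha> by (simp add: r_def)
    have rd: "r ^ d = R ^ d / n" by (simp add: r_def power_mult_distrib \<alpha>d)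
    interpret Me: metropolis P f B h "s *\<^sub>R \<theta>"
      by unfold_locales (use h h_m in auto)
    define PP where "PP = PiM {1..n} (\<lambda>_. P)"
    define QQ where "QQ = PiM {1..n} (\<lambda>_. Me.Q)"
    interpret QQ: prob_space QQ unfolding QQ_def by (intro prob_space_PiM Me.prob_space_Q)
    define b where "b = \<epsilon> * n / 32"
    have b: "b > 0" using \<epsilon> n by (simp add: b_def)
    obtain J where J_m: "J \<in> borel_measurable PP"
      and J_ge: "\<And>x. of_nat (card {i \<in> {1..n}. coincident {1..n} r \<kappa> \<theta> x i}) \<le> J x"
      and J_int: "(\<integral>\<^sup>+ x. J x \<partial>PP) \<le> ennreal ((real n)\<^sup>2 * B * \<omega> * r ^ d * (1 / q + 2 * 2 ^ d * real q ^ 3 / m))"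
      using coincident_count[OF \<theta> \<theta>' r, of m q \<kappa> "{1..n}"] m0 q0 unfolding PP_def \<omega>_def d_def
      by (auto simp: \<kappa>_def)
    have J_int': "(real n)\<^sup>2 * B * \<omega> * r ^ d * (1 / q + 2 * 2 ^ d * real q ^ 3 / m) \<le> b * (\<delta> / 8)"
    proof -
      have "(real n)\<^sup>2 * B * \<omega> * r ^ d * (1 / q + 2 * 2 ^ d * real q ^ 3 / m) = n * (D * (1 / q) + D2 / m)"
        unfolding rd using n by (simp add: D_def D2_def power2_eq_square field_simps)
      also have "\<dots> \<le> n * (\<epsilon> * \<delta> / 512 + \<epsilon> * \<delta> / 512)"
        using Dq Dm by (intro mult_left_mono add_mono) auto
      also have "\<dots> = b * (\<delta> / 8)" by (simp add: b_def)
      finally show ?thesis .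
    qed
    define NM where "NM = (\<lambda>p. \<Sum>i\<in>{1..n}. if Me.movable (p i) then 0 else 1 :: ennreal)"
    have mov_m: "(\<lambda>z. if Me.movable z then 0 else 1 :: ennreal) \<in> borel_measurable (borel \<Otimes>\<^sub>M borel)"
      by measurable
    have mov_i: "(\<lambda>p. if Me.movable (p i) then 0 else 1 :: ennreal) \<in> borel_measurable QQ" if "i \<in> {1..n}" for i
    proof -
      have "(\<lambda>z. if Me.movable z then 0 else 1 :: ennreal) \<in> borel_measurable Me.Q"
        using mov_m by (simp cong: measurable_cong_sets)
      from measurable_compose[OF measurable_component_singleton[OF that] this]
      show ?thesis by (simp add: QQ_def)
    qed
    have NM_m: "NM \<in> borel_measurable QQ" unfolding NM_def by (intro borel_measurable_sum mov_i)
    have NM_int: "(\<integral>\<^sup>+ p. NM p \<partial>QQ) \<le> ennreal (n * (\<epsilon> * \<delta> / 256))"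
    proof -
      have "(\<integral>\<^sup>+ p. NM p \<partial>QQ) = (\<Sum>i\<in>{1..n}. \<integral>\<^sup>+ p. (if Me.movable (p i) then 0 else 1) \<partial>QQ)"
        unfolding NM_def by (rule nn_integral_sum) (rule mov_i)
      also have "\<dots> = (\<Sum>i\<in>{1..n}. \<integral>\<^sup>+ z. (if Me.movable z then 0 else 1) \<partial>Me.Q)"
        unfolding QQ_def by (intro sum.cong refl Me.nn_integral_coordinate_Q[OF _ mov_m])
      also have "\<dots> \<le> (\<Sum>i\<in>{1..n}. ennreal (\<epsilon> * \<delta> / 256))"
        unfolding Me.not_movable_prob by (intro sum_mono hf)
      also have "\<dots> = ennreal (n * (\<epsilon> * \<delta> / 256))"
        using \<epsilon> \<delta> by (simp add: ennreal_of_nat_eq_real_of_nat ennreal_mult[symmetric])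
      finally show ?thesis .
    qed
    define many where "many = {x \<in> space PP. many_near_optimal n K \<epsilon> (g * \<alpha>) x}"
    have many_s: "many \<in> sets PP"
      unfolding many_def PP_def using many_near_optimal_measurable[of n K \<epsilon> "g * \<alpha>"] by (simp add: pred_def)
    have O_m: "(\<lambda>x. ennreal (optimal_length n x)) \<in> borel_measurable PP"
      unfolding PP_def by (rule measurable_compose[OF optimal_length_measurable measurable_ennreal])
    have opt_int: "(\<integral>\<^sup>+ x. ennreal (optimal_length n x) \<partial>PP) \<le> ennreal (C0 * (n * \<alpha>))"
      using opt[OF n(2)] by (simp add: PP_def \<alpha>_def)
    have pm: "Me.points {1..n} \<in> measurable QQ PP" unfolding QQ_def PP_def by (rule Me.points_measurable)
    have pts: "distr QQ PP (Me.points {1..n}) = PP" unfolding QQ_def PP_def by (rule Me.distr_points) simp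
    have em_pts: "emeasure PP A = emeasure QQ {p \<in> space QQ. Me.points {1..n} p \<in> A}" if "A \<in> sets PP" for A
    proof -
      have "emeasure PP A = emeasure (distr QQ PP (Me.points {1..n})) A" unfolding pts by (rule refl)
      also have "\<dots> = emeasure QQ (Me.points {1..n} -` A \<inter> space QQ)" by (rule emeasure_distr[OF pm that])
      also have "Me.points {1..n} -` A \<inter> space QQ = {p \<in> space QQ. Me.points {1..n} p \<in> A}" by auto
      finally show ?thesis .
    qed
    \<comment> \<open>Three bad events of probability at most \<delta> / 8 each: too many immovable
      points, too many coincidences, too long an optimal tour.\<close>
    define A1 where "A1 = {p \<in> space QQ. ennreal b < NM p}"
    define A2 where "A2 = {x \<in> space PP. ennreal b < J x}"
    define A3 where "A3 = {x \<in> space PP. ennreal (C3 * (n * \<alpha>)) < ennreal (optimal_length n x)}"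
    define A2' where "A2' = {p \<in> space QQ. Me.points {1..n} p \<in> A2}"
    define A3' where "A3' = {p \<in> space QQ. Me.points {1..n} p \<in> A3}"
    define many' where "many' = {p \<in> space QQ. Me.points {1..n} p \<in> many}"
    have sA2: "A2 \<in> sets PP" and sA3: "A3 \<in> sets PP"
      unfolding A2_def A3_def using J_m O_m by (auto intro!: borel_measurable_less)
    have sets: "A1 \<in> sets QQ" "A2' \<in> sets QQ" "A3' \<in> sets QQ" "many' \<in> sets QQ"
    proof -
      have vi: "{p \<in> space QQ. Me.points {1..n} p \<in> A} \<in> sets QQ" if "A \<in> sets PP" for A
        using measurable_sets[OF pm that] by (simp add: vimage_def Int_def conj_commute)
      show "A1 \<in> sets QQ" unfolding A1_def using NM_m by (auto intro!: borel_measurable_less)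
      show "A2' \<in> sets QQ" "A3' \<in> sets QQ" "many' \<in> sets QQ"
        unfolding A2'_def A3'_def many'_def using vi sA2 sA3 many_s by auto
    qed
    have e1: "emeasure QQ A1 \<le> ennreal (\<delta> / 8)"
      unfolding A1_def by (rule emeasure_gt_le_real[OF NM_m b NM_int]) (use \<epsilon> \<delta> in \<open>auto simp: b_def\<close>)
    have e2: "emeasure QQ A2' \<le> ennreal (\<delta> / 8)"
    proof -
      have "emeasure PP A2 \<le> ennreal (\<delta> / 8)"
        unfolding A2_def
        by (rule emeasure_gt_le_real[OF J_m b J_int J_int']) (use B_nonneg \<omega> r in simp)
      thus ?thesis unfolding A2'_def em_pts[OF sA2] .
    qed
    have e3: "emeasure QQ A3' \<le> ennreal (\<delta> / 8)"
    proof -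
      have "emeasure PP A3 \<le> ennreal (\<delta> / 8)"
        unfolding A3_def
        by (rule emeasure_gt_le_real[OF O_m _ opt_int]) (use C0 C3 \<delta> n \<alpha> in \<open>auto simp: C3_def\<close>)
      thus ?thesis unfolding A3'_def em_pts[OF sA3] .
    qed
    define W where "W = many' - (A1 \<union> A2' \<union> A3')"
    have W_s: "W \<in> sets QQ" using sets by (simp add: W_def)
    define gain where "gain = \<alpha> * (\<Lambda> - g)"
    have gain: "gain > 0" using \<alpha> c \<delta> by (simp add: gain_def \<Lambda>_def)
    have gainW: "sign_average {1..n} (\<lambda>\<xi>. optimal_length n (Me.steps {1..n} p \<xi>)) + gain
     \<le> optimal_length n (Me.points {1..n} p) + 8 * s\<^sup>2 * proximity n \<alpha> (2 * s) (Me.points {1..n} p)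
     + 2 * s * sign_average {1..n} (\<lambda>\<xi>. \<Sum>i\<in>{1..n}. of_bool (Me.rejected (p i) (\<xi> i)))" if p: "p \<in> W" for p
    proof -
      define x where "x = Me.points {1..n} p"
      have pW: "x \<in> many" "p \<in> space QQ" "p \<notin> A1" "p \<notin> A2'" "p \<notin> A3'"
        using p by (auto simp: W_def many'_def x_def)
      have xPP: "x \<in> space PP" using pW(1) by (simp add: many_def)
      have "\<not> ennreal b < NM p" using pW by (simp add: A1_def)
      hence "NM p \<le> ennreal b" by simp
      moreover have "NM p = of_nat (card {i \<in> {1..n}. \<not> Me.movable (p i)})"
        unfolding NM_def by (subst sum.If_cases) (auto simp: Int_def)
      ultimately have b1: "card {i \<in> {1..n}. \<not> Me.movable (p i)} \<le> b"
        using b by (simp add: ennreal_of_nat_eq_real_of_nat ennreal_le_iff)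
      have "J x \<le> ennreal b" using pW xPP by (auto simp: A2'_def A2_def x_def)
      hence "of_nat (card {i \<in> {1..n}. coincident {1..n} r \<kappa> \<theta> x i}) \<le> ennreal b"
        using J_ge order_trans by blast
      hence b2: "card {i \<in> {1..n}. coincident {1..n} r \<kappa> \<theta> x i} \<le> b"
        using b by (simp add: ennreal_of_nat_eq_real_of_nat ennreal_le_iff)
      have "ennreal (optimal_length n x) \<le> ennreal (C3 * (n * \<alpha>))"
        using pW xPP by (auto simp: A3'_def A3_def x_def)
      hence b3: "optimal_length n x \<le> C3 * (n * \<alpha>)"
        using C3 n \<alpha> by (subst (asm) ennreal_le_iff) auto
      have "many_near_optimal n K \<epsilon> (g * \<alpha>) x" using pW(1) by (simp add: many_def)
      then obtain T where T: "T \<subseteq> hamiltonian_cycles n" "card T = K"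
        and sep: "pairwise (\<lambda>G H. graph_dist n G H > \<epsilon>) T"
        and near: "\<And>G. G \<in> T \<Longrightarrow> tour_length x G \<le> optimal_length n x + g * \<alpha>"
        unfolding many_near_optimal_def by blast
      have fT: "finite T" "T \<noteq> {}" using T K by (auto intro: card_ge_0_finite)
      have b4: "card (long_vertices n r x G) \<le> b" if G: "G \<in> T" for G
      proof -
        have GH: "G \<in> hamiltonian_cycles n" using G T by auto
        have "r * card (long_vertices n r x G) \<le> 2 * tour_length x G" by (rule card_long_vertices[OF GH r])
        also have "\<dots> \<le> 2 * (C3 * (n * \<alpha>) + g * \<alpha>)" using near[OF G] b3 by simp
        also have "\<dots> \<le> 2 * (C3 * (n * \<alpha>) + g * (n * \<alpha>))"
          using g n \<alpha> by (intro mult_left_mono add_left_mono) auto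
        also have "\<dots> = r * b" using \<epsilon> by (simp add: r_def R_def b_def field_simps)
        finally show ?thesis using r by simp
      qed
      \<comment> \<open>Gradients are at most 2 in absolute value, so the squared norms are at most
        4; this is the radius 2 in the application of the minoration.\<close>
      define w where "w = (\<lambda>G i. - (of_bool (Me.movable (p i)) * tour_gradient G \<theta> x i) / sqrt n)"
      have w_sq: "(w G i)\<^sup>2 = (of_bool (Me.movable (p i)) * tour_gradient G \<theta> x i)\<^sup>2 / n" for G i
        by (simp add: w_def power_divide)
      have grad2: "(of_bool (Me.movable (p i)) * tour_gradient G \<theta> x i)\<^sup>2 \<le> 4" if "G \<in> T" "i \<in> {1..n}" for G i
      proof -
        have "\<bar>of_bool (Me.movable (p i)) * tour_gradient G \<theta> x i\<bar> \<le> 2"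
          using tour_gradient_le[OF _ that(2) n\<theta>, of G x] that(1) T by (auto simp: abs_mult of_bool_def)
        hence "\<bar>of_bool (Me.movable (p i)) * tour_gradient G \<theta> x i\<bar>\<^sup>2 \<le> 2\<^sup>2" by (intro power_mono) auto
        thus ?thesis by simp
      qed
      have "\<Lambda> \<le> sign_average {1..n} (\<lambda>\<xi>. MAX G\<in>T. \<Sum>i\<in>{1..n}. \<xi> i * w G i)"
      proof (rule sud)
        show "\<forall>G\<in>T. \<forall>i\<in>{1..n}. \<bar>w G i\<bar> \<le> \<beta>"
        proof (intro ballI)
          fix G i assume Gi: "G \<in> T" "i \<in> {1..n}"
          have "(w G i)\<^sup>2 \<le> 4 / n" unfolding w_sq using grad2[OF Gi] n by (intro divide_right_mono) auto
          also have "4 / n \<le> \<beta>\<^sup>2"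
          proof -
            have "(2 / \<beta>)\<^sup>2 \<le> n" using N1 n by linarith
            thus ?thesis using \<beta> n by (simp add: power_divide field_simps)
          qed
          finally have "\<bar>w G i\<bar>\<^sup>2 \<le> \<beta>\<^sup>2" by simp
          thus "\<bar>w G i\<bar> \<le> \<beta>" by (rule power2_le_imp_le[OF _ less_imp_le[OF \<beta>]])
        qed
        show "\<forall>G\<in>T. (\<Sum>i\<in>{1..n}. (w G i)\<^sup>2) \<le> 2\<^sup>2"
        proof
          fix G assume G: "G \<in> T"
          have "(\<Sum>i\<in>{1..n}. (w G i)\<^sup>2) \<le> (\<Sum>i\<in>{1..n}. 4 / real n)"
            unfolding w_sq using grad2[OF G] by (intro sum_mono divide_right_mono) auto
          thus "(\<Sum>i\<in>{1..n}. (w G i)\<^sup>2) \<le> 2\<^sup>2" using n by simp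
        qed
        show "pairwise (\<lambda>G H. (\<Sum>i\<in>{1..n}. (w G i - w H i)\<^sup>2) \<ge> a\<^sup>2) T"
          unfolding pairwise_def
        proof (intro ballI impI)
          fix G H assume GH: "G \<in> T" "H \<in> T" "G \<noteq> H"
          have dist: "graph_dist n G H > \<epsilon>" using sep GH by (auto simp: pairwise_def)
          have "\<kappa>\<^sup>2 * (\<epsilon> * n / 8) \<le> (\<Sum>i\<in>{1..n}. (of_bool (Me.movable (p i)) * tour_gradient G \<theta> x i
              - of_bool (Me.movable (p i)) * tour_gradient H \<theta> x i)\<^sup>2)"
            by (rule tour_gradients_separated[OF _ _ dist \<kappa>])
              (use GH T b1 b2 b4 in \<open>auto simp: b_def\<close>)
          also have "\<dots> = n * (\<Sum>i\<in>{1..n}. (w G i - w H i)\<^sup>2)"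
          proof -
            have "(w G i - w H i)\<^sup>2 = (of_bool (Me.movable (p i)) * tour_gradient G \<theta> x i
              - of_bool (Me.movable (p i)) * tour_gradient H \<theta> x i)\<^sup>2 / n" for i
              using n by (simp add: w_def power_divide power2_commute flip: diff_divide_distrib minus_diff_commute)
            thus ?thesis using n by (simp add: sum_divide_distrib[symmetric])
          qed
          finally show "a\<^sup>2 \<le> (\<Sum>i\<in>{1..n}. (w G i - w H i)\<^sup>2)"
            unfolding a2 using n by (simp add: field_simps)
        qed
      qed (use fT T in auto)
      hence "\<alpha> * \<Lambda> \<le> s * sqrt n * sign_average {1..n} (\<lambda>\<xi>. MAX G\<in>T. \<Sum>i\<in>{1..n}. \<xi> i * w G i)"
        unfolding s(2) using \<alpha> by (intro mult_left_mono) auto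
      moreover have "sign_average {1..n} (\<lambda>\<xi>. optimal_length n (Me.steps {1..n} p \<xi>))
         \<le> optimal_length n (Me.points {1..n} p) + g * \<alpha>
         - s * sqrt n * sign_average {1..n} (\<lambda>\<xi>. MAX G\<in>T. \<Sum>i\<in>{1..n}. \<xi> i * w G i)
         + 8 * s\<^sup>2 * proximity n \<alpha> (2 * s) (Me.points {1..n} p)
         + 2 * s * sign_average {1..n} (\<lambda>\<xi>. \<Sum>i\<in>{1..n}. of_bool (Me.rejected (p i) (\<xi> i)))"
        by (rule Me.sign_average_optimal_length_le[OF n(1) n\<theta> refl s(1) \<alpha> T(1) fT(2)])
          (use near in \<open>auto simp: x_def w_def\<close>)
      ultimately show ?thesis by (simp add: gain_def algebra_simps)
    qed
    have fin: "(\<integral>\<^sup>+ x. ennreal (optimal_length n x) \<partial>PiM {1..n} (\<lambda>_. P)) < \<infinity>"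
      using opt_int unfolding PP_def by (metis ennreal_less_top infinity_ennreal_def le_less_trans)
    have "ennreal gain * emeasure QQ W \<le>
      ennreal (8 * s\<^sup>2 * (n / \<alpha> + (real n)\<^sup>2 * (B * (4 * unit_ball_vol (DIM('v)) * \<alpha> ^ (DIM('v) - 1))))
      + 2 * s * (n * (k * s * (unit_ball_vol (DIM('v)) * k ^ DIM('v)))))"
      unfolding QQ_def
      by (rule Me.gain_probability_le[OF dim n(1) n\<theta> refl s(1) \<alpha> lip supp k fin _ less_imp_le[OF gain] gainW])
        (use W_s in \<open>auto simp: QQ_def\<close>)
    also have "\<dots> \<le> ennreal (gain * (\<delta> / 2))"
    proof (rule ennreal_leI)
      \<comment> \<open>The radius \<alpha> in \<open>proximity\<close> equalises its two parts:
        \<alpha>^(d-1) = 1 / (n \<alpha>) makes n^2 \<alpha>^(d-1) equal to n / \<alpha>.\<close>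
      have "8 * s\<^sup>2 * (n / \<alpha> + (real n)\<^sup>2 * (B * (4 * \<omega> * \<alpha> ^ (d - 1)))) = \<alpha> * (8 * (1 + 4 * B * \<omega>))"
        unfolding s(3) \<alpha>d1 using n \<alpha> by (simp add: power2_eq_square field_simps)
      moreover have "2 * s * (n * (k * s * (\<omega> * k ^ d))) = \<alpha> * (\<alpha> * (2 * k * \<omega> * k ^ d))"
      proof -
        have "2 * s * (n * (k * s * (\<omega> * k ^ d))) = s\<^sup>2 * n * (2 * k * \<omega> * k ^ d)"
          by (simp add: power2_eq_square)
        also have "s\<^sup>2 * n = \<alpha> * \<alpha>" unfolding s(3) using n by (simp add: power2_eq_square)
        finally show ?thesis by simp
      qed
      moreover have "\<alpha> * (\<alpha> * (2 * k * \<omega> * k ^ d)) \<le> \<alpha> * (1 * (2 * k * \<omega> * k ^ d))"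
        using \<alpha> \<alpha>1 k \<omega> by (intro mult_left_mono mult_right_mono) auto
      ultimately have "8 * s\<^sup>2 * (n / \<alpha> + (real n)\<^sup>2 * (B * (4 * \<omega> * \<alpha> ^ (d - 1))))
          + 2 * s * (n * (k * s * (\<omega> * k ^ d)))
          \<le> \<alpha> * (8 * (1 + 4 * B * \<omega>)) + \<alpha> * (1 * (2 * k * \<omega> * k ^ d))"
        by linarith
      also have "\<dots> = \<alpha> * c" by (simp add: c_def distrib_left)
      also have "\<dots> \<le> \<alpha> * (c + 1)" using \<alpha> by simp
      also have "\<dots> = gain * (\<delta> / 2)" using \<delta> by (simp add: gain_def \<Lambda>_def)
      finally show "8 * s\<^sup>2 * (n / \<alpha> + (real n)\<^sup>2 * (B * (4 * unit_ball_vol (DIM('v)) * \<alpha> ^ (DIM('v) - 1))))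
          + 2 * s * (n * (k * s * (unit_ball_vol (DIM('v)) * k ^ DIM('v)))) \<le> gain * (\<delta> / 2)"
        by (simp add: \<omega>_def d_def)
    qed
    also have "ennreal (gain * (\<delta> / 2)) = ennreal gain * ennreal (\<delta> / 2)"
      using gain \<delta> by (intro ennreal_mult) auto
    finally have eW: "emeasure QQ W \<le> ennreal (\<delta> / 2)"
      using gain by (subst (asm) ennreal_mult_le_mult_iff) auto
    have "emeasure PP many = emeasure QQ many'" unfolding many'_def by (rule em_pts[OF many_s])
    also have "\<dots> \<le> emeasure QQ (W \<union> (A1 \<union> (A2' \<union> A3')))"
      using sets W_s by (intro emeasure_mono) (auto simp: W_def)
    also have "\<dots> \<le> emeasure QQ W + (emeasure QQ A1 + (emeasure QQ A2' + emeasure QQ A3'))"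
      using sets W_s by (intro order_trans[OF emeasure_subadditive] add_mono order_refl) auto
    also have "\<dots> \<le> ennreal (\<delta> / 2) + (ennreal (\<delta> / 8) + (ennreal (\<delta> / 8) + ennreal (\<delta> / 8)))"
      by (intro add_mono eW e1 e2 e3)
    also have "\<dots> = ennreal (\<delta> / 2 + (\<delta> / 8 + (\<delta> / 8 + \<delta> / 8)))"
      using \<delta> by (simp only: ennreal_plus[symmetric] add_nonneg_nonneg less_imp_le divide_nonneg_nonneg zero_le_numeral)
    also have "\<dots> \<le> ennreal \<delta>" using \<delta> by (intro ennreal_leI) simp
    finally show ?thesis by (simp add: many_def PP_def \<alpha>_def)
  qed
  thus ?thesis using K by blast
qed

end

section \<open>Resampling one point\<close>

definition nearest_distance :: "nat \<Rightarrow> (nat \<Rightarrow> 'v::real_normed_vector) \<Rightarrow> nat \<Rightarrow> real" where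
  "nearest_distance n x l = (MIN a\<in>{1..n} - {l}. norm (x l - x a))"

lemma other_vertices: "n \<ge> 3 \<Longrightarrow> {1..n} - {l} \<noteq> ({} :: nat set)"
proof
  assume n: "n \<ge> 3" and eq: "{1..n} - {l} = ({} :: nat set)"
  have "1 \<in> {1..n}" "2 \<in> {1..n}" using n by auto
  hence "1 = l" "2 = l" using eq by blast+
  thus False by simp
qed

lemma nearest_distance_attained:
  assumes "n \<ge> 3"
  obtains a where "a \<in> {1..n}" "a \<noteq> l" "norm (x l - x a) = nearest_distance n x l"
proof -
  have "nearest_distance n x l \<in> (\<lambda>a. norm (x l - x a)) ` ({1..n} - {l})"
    unfolding nearest_distance_def using other_vertices[OF assms, of l] by (intro Min_in) auto
  thus ?thesis using that by fastforce
qed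

lemma nearest_distance_le: "a \<in> {1..n} - {l} \<Longrightarrow> nearest_distance n x l \<le> norm (x l - x a)"
  unfolding nearest_distance_def by (intro Min_le) auto

lemma nearest_distance_nonneg: "n \<ge> 3 \<Longrightarrow> nearest_distance n x l \<ge> 0"
  by (metis nearest_distance_attained norm_ge_zero)

text \<open>Both tour edges at a vertex are at least as long as its nearest neighbour distance, and
  every edge is counted at both ends, so the two factors of 2 cancel.\<close>

lemma sum_nearest_distance_le:
  assumes n: "n \<ge> 3"
  shows "(\<Sum>l\<in>{1..n}. nearest_distance n x l) \<le> optimal_length n x"
proof -
  define G where "G = optimal_tour n x"
  have G: "G \<in> hamiltonian_cycles n" unfolding G_def by (rule optimal_tour[OF n])
  have "2 * (\<Sum>l\<in>{1..n}. nearest_distance n x l) = (\<Sum>l\<in>{1..n}. \<Sum>j\<in>neighbours G l. nearest_distance n x l)"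
    using card_neighbours[OF G] by (simp add: sum_distrib_left)
  also have "\<dots> \<le> (\<Sum>l\<in>{1..n}. \<Sum>j\<in>neighbours G l. norm (x l - x j))"
    using neighbours_subset[OF G] by (intro sum_mono nearest_distance_le) blast
  also have "\<dots> = 2 * optimal_length n x"
    using tour_length_neighbours[OF G, of x] tour_length_optimal_tour[OF n, of x] by (simp add: G_def)
  finally show ?thesis by simp
qed

lemma graph_dist_triangle:
  assumes "finite G" "finite H" "finite K"
  shows "graph_dist n G K \<le> graph_dist n G H + graph_dist n H K"
proof -
  have "card (G - K \<union> (K - G)) \<le> card ((G - H \<union> (H - G)) \<union> (H - K \<union> (K - H)))"
    using assms by (intro card_mono) auto
  also have "\<dots> \<le> card (G - H \<union> (H - G)) + card (H - K \<union> (K - H))" by (rule card_Un_le)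
  finally have "real (card (G - K \<union> (K - G))) \<le> real (card (G - H \<union> (H - G))) + real (card (H - K \<union> (K - H)))"
    by linarith
  thus ?thesis by (simp add: graph_dist_def add_divide_distrib[symmetric] divide_right_mono)
qed

lemma graph_dist_commute: "graph_dist n G H = graph_dist n H G"
  by (simp add: graph_dist_def Un_commute)

text \<open>
  Reinsertion is used twice: to repair the optimal tour for \<open>z\<close>, and to compare the optimal length for
  \<open>z\<close> with that for \<open>x\<close>.
\<close>

lemma repaired_tour:
  fixes x z :: "nat \<Rightarrow> 'v::real_normed_vector"
  assumes n: "n \<ge> 3" and l: "l \<in> {1..n}" and xz: "\<And>i. i \<in> {1..n} - {l} \<Longrightarrow> z i = x i"
  shows "\<exists>G\<in>hamiltonian_cycles n. graph_dist n (optimal_tour n z) G \<le> 6 / n \<and>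
    tour_length x G \<le> optimal_length n x + 2 * (nearest_distance n x l + nearest_distance n z l)"
proof -
  obtain a where a: "a \<in> {1..n}" "a \<noteq> l" "norm (x l - x a) = nearest_distance n x l"
    by (rule nearest_distance_attained[OF n])
  obtain b where b: "b \<in> {1..n}" "b \<noteq> l" "norm (z l - z b) = nearest_distance n z l"
    by (rule nearest_distance_attained[OF n])
  obtain G where G: "G \<in> hamiltonian_cycles n"
    and c: "card (optimal_tour n z - G \<union> (G - optimal_tour n z)) \<le> 6"
    and L: "\<forall>x y :: nat \<Rightarrow> 'v. (\<forall>i\<in>{1..n} - {l}. x i = y i) \<longrightarrow>
       tour_length x G \<le> tour_length y (optimal_tour n z) + 2 * norm (x l - x a)"
    using reinsert_vertex[OF optimal_tour[OF n, of z] l a(1,2)] by (elim bexE conjE)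
  obtain H where H: "H \<in> hamiltonian_cycles n"
    and LH: "\<forall>x' y :: nat \<Rightarrow> 'v. (\<forall>i\<in>{1..n} - {l}. x' i = y i) \<longrightarrow>
       tour_length x' H \<le> tour_length y (optimal_tour n x) + 2 * norm (x' l - x' b)"
    using reinsert_vertex[OF optimal_tour[OF n, of x] l b(1,2)] by (elim bexE conjE)
  have "tour_length x G \<le> tour_length z (optimal_tour n z) + 2 * norm (x l - x a)"
    using xz by (intro L[rule_format]) simp
  moreover have "optimal_length n z \<le> tour_length z H" by (rule optimal_length_le[OF H])
  moreover have "tour_length z H \<le> tour_length x (optimal_tour n x) + 2 * norm (z l - z b)"
    using xz by (intro LH[rule_format])
  ultimately have "tour_length x G \<le> optimal_length n x + 2 * (nearest_distance n x l + nearest_distance n z l)"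
    unfolding a(3) b(3) tour_length_optimal_tour[OF n] by simp
  moreover have "graph_dist n (optimal_tour n z) G \<le> 6 / n"
    using c by (simp add: graph_dist_def divide_right_mono)
  ultimately show ?thesis using G by blast
qed

section \<open>From packing numbers to near-optimal tours\<close>

lemma packing_number_ge_obtain:
  assumes "packing_number T dst \<epsilon> \<ge> enat K" "K > 0"
  obtains S where "S \<subseteq> T" "finite S" "pairwise (\<lambda>x y. dst x y > \<epsilon>) S" "card S \<ge> K"
proof -
  have "\<exists>S. S \<subseteq> T \<and> finite S \<and> pairwise (\<lambda>x y. dst x y > \<epsilon>) S \<and> card S \<ge> K"
  proof (rule ccontr)
    assume no: "\<nexists>S. S \<subseteq> T \<and> finite S \<and> pairwise (\<lambda>x y. dst x y > \<epsilon>) S \<and> card S \<ge> K"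
    have "card S \<le> K - 1" if "S \<subseteq> T" "finite S" "pairwise (\<lambda>x y. dst x y > \<epsilon>) S" for S
    proof -
      have "\<not> card S \<ge> K" using no that by blast
      thus ?thesis by simp
    qed
    hence "packing_number T dst \<epsilon> \<le> enat (K - 1)"
      unfolding packing_number_def by (intro SUP_least) auto
    with assms(1) have "enat K \<le> enat (K - 1)" by (rule order_trans)
    thus False using assms(2) by simp
  qed
  thus ?thesis using that by blast
qed

text \<open>The vertices with small nearest distances form an admissible index set, so its packing
  number bounds the infimum from above. Repair moves each tour by at most 6 / n, hence reduces
  separations by 12 / n \<le> \<epsilon> / 2, whence the condition 24 / \<epsilon> \<le> n. Repaired
  tours are distinct because they stay apart.\<close>

lemma many_near_optimal_of_packing:
  fixes x :: "nat \<Rightarrow> 'v::real_normed_vector" and \<epsilon> t :: real and n K :: nat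
  assumes n: "n \<ge> 3" "24 / \<epsilon> \<le> n" and \<epsilon>: "\<epsilon> > 0" and K: "K > 0"
    and few: "card {l \<in> {1..n}. nearest_distance n x l + nearest_distance n (z l) l > t} < \<epsilon> * n"
    and z: "\<And>l i. l \<in> {1..n} \<Longrightarrow> i \<in> {1..n} - {l} \<Longrightarrow> z l i = x i"
    and pack: "(INF A \<in> {A. A \<subseteq> {1..n} \<and> real (card A) > (1 - \<epsilon>) * real (card {1..n})}.
        packing_number ((\<lambda>l. optimal_tour n (z l)) ` A) (graph_dist n) \<epsilon>) \<ge> enat K"
  shows "many_near_optimal n K (\<epsilon> / 2) (2 * t) x"
proof -
  define bad where "bad = {l \<in> {1..n}. nearest_distance n x l + nearest_distance n (z l) l > t}"
  define A where "A = {1..n} - bad"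
  have "card A = n - card bad" unfolding A_def by (subst card_Diff_subset) (auto simp: bad_def)
  moreover have "card bad \<le> n"
  proof -
    have "bad \<subseteq> {1..n}" by (auto simp: bad_def)
    from card_mono[OF _ this] show ?thesis by simp
  qed
  ultimately have "real (card A) = real n - real (card bad)" by simp
  moreover have "real (card bad) < \<epsilon> * real n" using few unfolding bad_def .
  ultimately have cA: "real (card A) > (1 - \<epsilon>) * real (card {1..n})" by (simp add: left_diff_distrib)
  have "(INF A \<in> {A. A \<subseteq> {1..n} \<and> real (card A) > (1 - \<epsilon>) * real (card {1..n})}.
        packing_number ((\<lambda>l. optimal_tour n (z l)) ` A) (graph_dist n) \<epsilon>)
      \<le> packing_number ((\<lambda>l. optimal_tour n (z l)) ` A) (graph_dist n) \<epsilon>"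
    using cA by (intro INF_lower) (auto simp: A_def)
  with pack have "packing_number ((\<lambda>l. optimal_tour n (z l)) ` A) (graph_dist n) \<epsilon> \<ge> enat K"
    by (rule order_trans)
  then obtain S where S: "S \<subseteq> (\<lambda>l. optimal_tour n (z l)) ` A" "finite S"
      "pairwise (\<lambda>x y. graph_dist n x y > \<epsilon>) S" "card S \<ge> K"
    using K by (rule packing_number_ge_obtain)
  have "\<exists>H\<in>hamiltonian_cycles n. graph_dist n G H \<le> 6 / n \<and> tour_length x H \<le> optimal_length n x + 2 * t"
    if GS: "G \<in> S" for G
  proof -
    obtain l where l: "l \<in> A" "G = optimal_tour n (z l)" using S(1) GS by auto
    have lI: "l \<in> {1..n}" using l by (simp add: A_def)
    obtain H where H: "H \<in> hamiltonian_cycles n" "graph_dist n (optimal_tour n (z l)) H \<le> 6 / n"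
        "tour_length x H \<le> optimal_length n x + 2 * (nearest_distance n x l + nearest_distance n (z l) l)"
      using repaired_tour[of n l "z l" x, OF n(1) lI z[OF lI]] by blast
    moreover have "nearest_distance n x l + nearest_distance n (z l) l \<le> t"
      using l lI by (auto simp: A_def bad_def)
    ultimately show ?thesis unfolding l(2) by (intro bexI[of _ H]) auto
  qed
  then obtain rep where rep: "\<And>G. G \<in> S \<Longrightarrow> rep G \<in> hamiltonian_cycles n"
      "\<And>G. G \<in> S \<Longrightarrow> graph_dist n G (rep G) \<le> 6 / n"
      "\<And>G. G \<in> S \<Longrightarrow> tour_length x (rep G) \<le> optimal_length n x + 2 * t"
    by metis
  have S_HC: "G \<in> hamiltonian_cycles n" if "G \<in> S" for G
    using S(1) that optimal_tour[OF n(1)] by auto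
  have "12 / n \<le> \<epsilon> / 2" using n \<epsilon> by (simp add: field_simps)
  have far: "graph_dist n (rep G) (rep H) > \<epsilon> / 2" if GH: "G \<in> S" "H \<in> S" "G \<noteq> H" for G H
  proof -
    note fin = finite_hamiltonian_cycle[OF S_HC] finite_hamiltonian_cycle[OF rep(1)]
    have "\<epsilon> < graph_dist n G H" using S(3) GH by (auto simp: pairwise_def)
    also have "\<dots> \<le> graph_dist n G (rep G) + graph_dist n (rep G) H"
      by (intro graph_dist_triangle fin GH)
    also have "graph_dist n (rep G) H \<le> graph_dist n (rep G) (rep H) + graph_dist n (rep H) H"
      by (intro graph_dist_triangle fin GH)
    also have "graph_dist n (rep H) H \<le> 6 / n" using rep(2)[OF GH(2)] unfolding graph_dist_commute[of n "rep H" H] .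
    also have "graph_dist n G (rep G) \<le> 6 / n" by (rule rep(2)[OF GH(1)])
    finally have "\<epsilon> < 12 / n + graph_dist n (rep G) (rep H)" by simp
    thus ?thesis using \<open>12 / n \<le> \<epsilon> / 2\<close> by linarith
  qed
  have "inj_on rep S"
  proof (rule inj_onI, rule ccontr)
    fix G H assume GH: "G \<in> S" "H \<in> S" "rep G = rep H" "G \<noteq> H"
    have "graph_dist n (rep G) (rep H) = 0" using GH by (simp add: graph_dist_def)
    thus False using far[OF GH(1,2,4)] \<epsilon> by simp
  qed
  hence "card (rep ` S) \<ge> K" using S(4) by (simp add: card_image)
  then obtain T where T: "T \<subseteq> rep ` S" "card T = K" by (meson obtain_subset_with_card_n)
  show ?thesis
    unfolding many_near_optimal_def
  proof (intro bexI[of _ T] conjI ballI)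
    show "pairwise (\<lambda>G H. graph_dist n G H > \<epsilon> / 2) T"
    proof (rule pairwiseI)
      fix G H assume GH: "G \<in> T" "H \<in> T" "G \<noteq> H"
      then obtain G' H' where "G' \<in> S" "H' \<in> S" "G = rep G'" "H = rep H'" using T(1) by blast
      thus "graph_dist n G H > \<epsilon> / 2" using far[of G' H'] GH(3) by blast
    qed
    show "T \<in> Pow (hamiltonian_cycles n)" using T(1) rep(1) by blast
    show "tour_length x G \<le> optimal_length n x + 2 * t" if "G \<in> T" for G
      using that T(1) rep(3) by blast
  qed (rule T(2))
qed

lemma many_near_optimal_cong:
  assumes "\<And>i. i \<in> {1..n} \<Longrightarrow> x i = y i"
  shows "many_near_optimal n K \<epsilon> g x \<longleftrightarrow> many_near_optimal n K \<epsilon> g y"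
proof -
  have len: "tour_length x G = tour_length y G" if "G \<in> hamiltonian_cycles n" for G
    by (rule tour_length_cong[OF that assms])
  have opt: "optimal_length n x = optimal_length n y" by (rule optimal_length_cong[OF assms])
  have "(\<forall>G\<in>T. tour_length x G \<le> optimal_length n x + g) \<longleftrightarrow> (\<forall>G\<in>T. tour_length y G \<le> optimal_length n y + g)"
    if "T \<in> Pow (hamiltonian_cycles n)" for T
    unfolding opt using that by (intro ball_cong refl) (metis len PowD subsetD)
  thus ?thesis unfolding many_near_optimal_def by (intro bex_cong refl) simp
qed

lemma nearest_distance_cong:
  assumes "\<And>i. i \<in> {1..n} \<Longrightarrow> x i = y i" "l \<in> {1..n}"
  shows "nearest_distance n x l = nearest_distance n y l"
  unfolding nearest_distance_def using assms by (intro arg_cong[of _ _ Min] image_cong) auto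

context bounded_density
begin

section \<open>The law of the input with one point resampled\<close>

lemma nearest_distance_measurable:
  assumes "l \<in> {1..n}"
  shows "(\<lambda>x. nearest_distance n x l) \<in> borel_measurable (PiM {1..n} (\<lambda>_. P))"
  unfolding nearest_distance_def
proof (rule borel_measurable_Min)
  fix a assume "a \<in> {1..n} - {l}"
  hence "a \<in> {1..n}" by simp
  thus "(\<lambda>x. norm (x l - x a)) \<in> borel_measurable (PiM {1..n} (\<lambda>_. P))" using assms by measurable
qed simp

text \<open>The preimage of a box is a product of two boxes: the condition on coordinate l moves to
  the second factor, all others stay in the first.\<close>

lemma distr_resample_coordinate:
  fixes I :: "nat set"
  assumes I: "finite I" and l: "l \<in> I"
  shows "distr (PiM I (\<lambda>_. P) \<Otimes>\<^sub>M PiM I (\<lambda>_. P)) (PiM I (\<lambda>_. P)) (\<lambda>(x, y). x(l := y l)) = PiM I (\<lambda>_. P)"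
    and resample_measurable:
      "(\<lambda>(x, y). x(l := y l)) \<in> measurable (PiM I (\<lambda>_. P) \<Otimes>\<^sub>M PiM I (\<lambda>_. P)) (PiM I (\<lambda>_. P))"
proof -
  define PP where "PP = PiM I (\<lambda>_. P)"
  interpret PP: prob_space PP unfolding PP_def by (rule prob_space_PiM_P)
  interpret S: product_prob_space "\<lambda>_::nat. P" by (rule product_P)
  define \<phi> where "\<phi> = (\<lambda>(x :: nat \<Rightarrow> 'v, y). x(l := y l))"
  have \<phi>_m: "\<phi> \<in> measurable (PP \<Otimes>\<^sub>M PP) PP"
    unfolding PP_def
  proof (rule measurable_PiM_single')
    show "(\<lambda>\<omega>. \<phi> \<omega> i) \<in> measurable (PiM I (\<lambda>_. P) \<Otimes>\<^sub>M PiM I (\<lambda>_. P)) P" if i: "i \<in> I" for i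
    proof (cases "i = l")
      case True
      hence "(\<lambda>\<omega>. \<phi> \<omega> i) = (\<lambda>y. y l) \<circ> snd" by (auto simp: \<phi>_def)
      thus ?thesis using l by (auto intro!: measurable_comp[OF measurable_snd] measurable_component_singleton)
    next
      case False
      hence "(\<lambda>\<omega>. \<phi> \<omega> i) = (\<lambda>y. y i) \<circ> fst" by (auto simp: \<phi>_def)
      thus ?thesis using i by (auto intro!: measurable_comp[OF measurable_fst] measurable_component_singleton)
    qed
    show "\<phi> \<in> space (PiM I (\<lambda>_. P) \<Otimes>\<^sub>M PiM I (\<lambda>_. P)) \<rightarrow> (\<Pi>\<^sub>E i\<in>I. space P)"
      using l by (auto simp: \<phi>_def space_pair_measure space_PiM PiE_iff extensional_def)
  qed
  thus "(\<lambda>(x, y). x(l := y l)) \<in> measurable (PiM I (\<lambda>_. P) \<Otimes>\<^sub>M PiM I (\<lambda>_. P)) (PiM I (\<lambda>_. P))"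
    by (simp add: \<phi>_def PP_def)
  have "distr (PP \<Otimes>\<^sub>M PP) PP \<phi> = PiM I (\<lambda>_. P)"
  proof (rule S.PiM_eqI[OF I])
    fix A :: "nat \<Rightarrow> 'v set" assume A: "\<And>i. i \<in> I \<Longrightarrow> A i \<in> sets P"
    define A1 where "A1 = A(l := UNIV)"
    define A2 where "A2 = (\<lambda>i. if i = l then A l else UNIV)"
    have A12: "A1 i \<in> sets P" "A2 i \<in> sets P" if "i \<in> I" for i
      using A[OF that] A[OF l] by (auto simp: A1_def A2_def)
    have s: "Pi\<^sub>E I A \<in> sets PP" "Pi\<^sub>E I A1 \<in> sets PP" "Pi\<^sub>E I A2 \<in> sets PP"
      unfolding PP_def using A A12 by (intro sets_PiM_I_finite I; blast)+
    have "emeasure (distr (PP \<Otimes>\<^sub>M PP) PP \<phi>) (Pi\<^sub>E I A) = emeasure (PP \<Otimes>\<^sub>M PP) (\<phi> -` Pi\<^sub>E I A \<inter> space (PP \<Otimes>\<^sub>M PP))"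
      by (rule emeasure_distr[OF \<phi>_m s(1)])
    also have "\<phi> -` Pi\<^sub>E I A \<inter> space (PP \<Otimes>\<^sub>M PP) = Pi\<^sub>E I A1 \<times> Pi\<^sub>E I A2"
      using l by (auto simp: \<phi>_def A1_def A2_def PP_def space_pair_measure space_PiM PiE_iff
          extensional_def split: if_splits)
    also have "emeasure (PP \<Otimes>\<^sub>M PP) (Pi\<^sub>E I A1 \<times> Pi\<^sub>E I A2) = emeasure PP (Pi\<^sub>E I A1) * emeasure PP (Pi\<^sub>E I A2)"
      by (rule PP.emeasure_pair_measure_Times[OF s(2,3)])
    also have "emeasure PP (Pi\<^sub>E I A1) = (\<Prod>i\<in>I. emeasure P (A1 i))"
      unfolding PP_def using A12 by (intro S.emeasure_PiM I) auto
    also have "emeasure PP (Pi\<^sub>E I A2) = (\<Prod>i\<in>I. emeasure P (A2 i))"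
      unfolding PP_def using A12 by (intro S.emeasure_PiM I) auto
    also have "(\<Prod>i\<in>I. emeasure P (A1 i)) * (\<Prod>i\<in>I. emeasure P (A2 i)) = (\<Prod>i\<in>I. emeasure P (A1 i) * emeasure P (A2 i))"
      by (rule prod.distrib[symmetric])
    also have "\<dots> = (\<Prod>i\<in>I. emeasure P (A i))"
      using emeasure_space_1 by (intro prod.cong refl) (auto simp: A1_def A2_def)
    finally show "emeasure (distr (PP \<Otimes>\<^sub>M PP) PP \<phi>) (Pi\<^sub>E I A) = (\<Prod>i\<in>I. emeasure P (A i))" .
  qed (simp add: PP_def)
  thus "distr (PiM I (\<lambda>_. P) \<Otimes>\<^sub>M PiM I (\<lambda>_. P)) (PiM I (\<lambda>_. P)) (\<lambda>(x, y). x(l := y l)) = PiM I (\<lambda>_. P)"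
    by (simp add: \<phi>_def PP_def)
qed

end

theorem theorem3p10p3:
  fixes P :: "(real ^ 'd) measure"
    and f :: "real ^ 'd \<Rightarrow> real"
    and M :: "nat \<Rightarrow> 'a measure"
    and X :: "nat \<Rightarrow> nat \<Rightarrow> 'a \<Rightarrow> real ^ 'd"
    and Y :: "nat \<Rightarrow> nat \<Rightarrow> nat \<Rightarrow> 'a \<Rightarrow> real ^ 'd"
  assumes dim: "CARD('d) \<ge> 2"
    and P_prob: "prob_space P"
    and M_prob: "\<And>n. prob_space (M n)"
    and X_indep: "\<And>n. prob_space.indep_vars (M n) (\<lambda>_. borel) (X n) {1..n}"
    and X_distr: "\<And>n i. i \<in> {1..n} \<Longrightarrow> distr (M n) borel (X n i) = P"
    and Y_copy: "\<And>n l. l \<in> {1..n} \<Longrightarrow> independent_copy (M n) {1..n} (X n) (Y n l)"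
    and f_measurable: "f \<in> borel_measurable borel"
    and f_nonneg: "\<And>x. f x \<ge> 0"
    and f_density: "P = density lborel (\<lambda>x. ennreal (f x))"
    and f_bounded: "bounded (range f)"
    and f_continuous: "AE x in lborel. isCont f x"
    and first_moment: "integrable P (\<lambda>x. norm x)"
    and optimal_length:
      "(\<lambda>n. \<integral>\<omega>. (INF G\<in>hamiltonian_cycles n. tour_length (\<lambda>i. X n i \<omega>) G) \<partial>M n)
         \<in> O(\<lambda>n. real n powr ((real CARD('d) - 1) / real CARD('d)))"
    and langevin_or_rejection:
      "(\<exists>(\<rho> :: real ^ 'p \<Rightarrow> real) g.
          langevin_assumption P \<rho> g \<and> (AE y in lebesgue. jacobian g (at y) \<noteq> 0))
       \<or> rejection_assumption P f"
    and tail: "summable (\<lambda>k. shell_weight f k powr ((real CARD('d) - 1) / real CARD('d)))"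
  shows "stable_under_small_perturbations M (\<lambda>n. {1..n}) X (\<lambda>n. {1..n}) (\<lambda>n i. {i}) Y
           optimal_tour graph_dist"
proof -
  obtain B where B: "\<And>x. f x \<le> B"
    using f_bounded unfolding bounded_iff by (auto simp: abs_le_iff)
  interpret bounded_density P f B
    using P_prob f_measurable f_nonneg f_density B
    by (intro bounded_density.intro bounded_density_axioms.intro) auto
  define d where "d = CARD('d)"
  have d: "d \<ge> 2" using dim by (simp add: d_def)
  have DIM: "DIM(real ^ 'd) = d" by (simp add: d_def)
  \<comment> \<open>Restriction to the index set makes these elements of the product space; tour
    lengths and nearest distances do not notice it, by the congruence lemmas.\<close>
  define XI where "XI = (\<lambda>n \<omega>. \<lambda>i\<in>{1..n}. X n i \<omega>)"
  define YI where "YI = (\<lambda>n l \<omega>. \<lambda>i\<in>{1..n}. Y n l i \<omega>)"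
  define PP where "PP = (\<lambda>n::nat. PiM {1..n} (\<lambda>_. P))"
  define \<alpha> where "\<alpha> = (\<lambda>n. real n powr (- 1 / real d))"
  have sets_PP: "sets (PP n) = sets (PiM {1..n} (\<lambda>_. borel))" for n
    unfolding PP_def by (intro sets_PiM_cong) auto
  have rv: "X n i \<in> borel_measurable (M n)" if "i \<in> {1..n}" for n i
  proof -
    interpret M: prob_space "M n" by (rule M_prob)
    show ?thesis using X_indep[of n] that by (simp add: M.indep_vars_def)
  qed
  have distr_cong_PP: "distr (M n) (PP n) g = distr (M n) (PiM {1..n} (\<lambda>_. borel)) g" for n g
    by (intro distr_cong refl sets_PP)
  have XI_law: "distr (M n) (PP n) (XI n) = PP n" if "n \<ge> 1" for n
  proof -
    interpret M: prob_space "M n" by (rule M_prob)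
    have "distr (M n) (PiM {1..n} (\<lambda>_. borel)) (XI n) = PiM {1..n} (\<lambda>i. distr (M n) borel (X n i))"
      unfolding XI_def using M.indep_vars_iff_distr_eq_PiM'[where I = "{1..n}" and M' = "\<lambda>_. borel" and X = "X n"] X_indep[of n] rv that
      by simp
    also have "\<dots> = PP n" unfolding PP_def by (intro PiM_cong refl X_distr)
    finally show ?thesis by (simp add: distr_cong_PP)
  qed
  have XI_m: "XI n \<in> measurable (M n) (PP n)" for n
    unfolding XI_def PP_def
  proof (rule measurable_restrict)
    fix i assume "i \<in> {1..n}"
    thus "X n i \<in> measurable (M n) P" using rv by (simp cong: measurable_cong_sets)
  qed
  \<comment> \<open>One l at a time suffices, because the different copies meet only in a sum of
    expectations.\<close>
  have XY_law: "distr (M n) (PP n) (\<lambda>\<omega>. (XI n \<omega>)(l := YI n l \<omega> l)) = PP n"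
    and XY_m: "(\<lambda>\<omega>. (XI n \<omega>)(l := YI n l \<omega> l)) \<in> measurable (M n) (PP n)"
    if n: "n \<ge> 1" and l: "l \<in> {1..n}" for n l
  proof -
    interpret M: prob_space "M n" by (rule M_prob)
    let ?Bn = "PiM {1..n} (\<lambda>_. borel) :: (nat \<Rightarrow> real ^ 'd) measure"
    have ind: "M.indep_var ?Bn (XI n) ?Bn (YI n l)"
      and eq: "distr (M n) ?Bn (YI n l) = distr (M n) ?Bn (XI n)"
      using Y_copy[OF l] unfolding independent_copy_def XI_def YI_def by auto
    have lawX: "distr (M n) ?Bn (XI n) = PP n" using XI_law[OF n] by (simp add: distr_cong_PP)
    have YI_m: "YI n l \<in> measurable (M n) ?Bn" using ind by (simp add: M.indep_var_distribution_eq)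
    have joint: "distr (M n) (?Bn \<Otimes>\<^sub>M ?Bn) (\<lambda>\<omega>. (XI n \<omega>, YI n l \<omega>)) = PP n \<Otimes>\<^sub>M PP n"
      using ind unfolding M.indep_var_distribution_eq eq lawX by (elim conjE) (rule sym)
    have m1: "(\<lambda>\<omega>. (XI n \<omega>, YI n l \<omega>)) \<in> measurable (M n) (?Bn \<Otimes>\<^sub>M ?Bn)"
      using XI_m[of n] YI_m sets_PP[of n] by (intro measurable_Pair) (simp_all cong: measurable_cong_sets)
    have m2: "(\<lambda>(x, y). x(l := y l)) \<in> measurable (?Bn \<Otimes>\<^sub>M ?Bn) (PP n)"
    proof -
      have "sets (PP n \<Otimes>\<^sub>M PP n) = sets (?Bn \<Otimes>\<^sub>M ?Bn)" by (intro sets_pair_measure_cong sets_PP)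
      thus ?thesis using resample_measurable[OF _ l] unfolding PP_def
        by (simp cong: measurable_cong_sets)
    qed
    have comp: "(\<lambda>\<omega>. (XI n \<omega>)(l := YI n l \<omega> l)) = (\<lambda>(x, y). x(l := y l)) \<circ> (\<lambda>\<omega>. (XI n \<omega>, YI n l \<omega>))"
      by auto
    show "(\<lambda>\<omega>. (XI n \<omega>)(l := YI n l \<omega> l)) \<in> measurable (M n) (PP n)"
      unfolding comp by (rule measurable_comp[OF m1 m2])
    have "distr (M n) (PP n) (\<lambda>\<omega>. (XI n \<omega>)(l := YI n l \<omega> l))
        = distr (PP n \<Otimes>\<^sub>M PP n) (PP n) (\<lambda>(x, y). x(l := y l))"
      unfolding comp joint[symmetric] by (rule distr_distr[symmetric, OF m2 m1])
    also have "\<dots> = PP n" unfolding PP_def by (rule distr_resample_coordinate[OF _ l]) simp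
    finally show "distr (M n) (PP n) (\<lambda>\<omega>. (XI n \<omega>)(l := YI n l \<omega> l)) = PP n" .
  qed
  have O_m: "(\<lambda>x. ennreal (optimal_length n x)) \<in> borel_measurable (PP n)" for n
    unfolding PP_def by (rule measurable_compose[OF optimal_length_measurable measurable_ennreal])
  \<comment> \<open>A Bochner integral of a non-integrable function would be 0 by convention, so
    integrability has to be secured before the growth assumption says anything. Comparison with all
    points at the origin bounds the optimal length by twice the sum of the norms.\<close>
  have opt_eq: "(\<integral>\<^sup>+ x. ennreal (optimal_length n x) \<partial>PP n)
      = ennreal (\<integral>\<omega>. (INF G\<in>hamiltonian_cycles n. tour_length (\<lambda>i. X n i \<omega>) G) \<partial>M n)" if n: "n \<ge> 3" for n
  proof -
    interpret M: prob_space "M n" by (rule M_prob)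
    have inf_eq: "(INF G\<in>hamiltonian_cycles n. tour_length (\<lambda>i. X n i \<omega>) G) = optimal_length n (XI n \<omega>)" for \<omega>
    proof -
      have "(INF G\<in>hamiltonian_cycles n. tour_length (\<lambda>i. X n i \<omega>) G) = optimal_length n (\<lambda>i. X n i \<omega>)"
        unfolding optimal_length_def
        using finite_hamiltonian_cycles[of n] hamiltonian_cycles_nonempty[OF n] by (intro cInf_eq_Min) auto
      also have "\<dots> = optimal_length n (XI n \<omega>)" by (rule optimal_length_cong) (simp add: XI_def)
      finally show ?thesis .
    qed
    have meas: "(\<lambda>\<omega>. optimal_length n (XI n \<omega>)) \<in> borel_measurable (M n)"
      by (rule measurable_compose[OF XI_m]) (unfold PP_def, rule optimal_length_measurable)
    have "integrable (M n) (\<lambda>\<omega>. norm (X n i \<omega>))" if i: "i \<in> {1..n}" for i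
    proof -
      have "integrable (distr (M n) borel (X n i)) norm" using first_moment X_distr[OF i] by simp
      thus ?thesis using rv[OF i] by (subst (asm) integrable_distr_eq) auto
    qed
    hence bound_int: "integrable (M n) (\<lambda>\<omega>. 2 * (\<Sum>i\<in>{1..n}. norm (X n i \<omega>)))"
      by (intro integrable_mult_right Bochner_Integration.integrable_sum)
    have bound: "optimal_length n (XI n \<omega>) \<le> 2 * (\<Sum>i\<in>{1..n}. norm (X n i \<omega>))" for \<omega>
    proof -
      obtain G where G: "G \<in> hamiltonian_cycles n" using hamiltonian_cycles_nonempty[OF n] by blast
      have "optimal_length n (XI n \<omega>) \<le> tour_length (XI n \<omega>) G" by (rule optimal_length_le[OF G])
      also have "\<dots> \<le> tour_length (\<lambda>_. 0 :: real ^ 'd) G + 2 * (\<Sum>i\<in>{1..n}. norm (XI n \<omega> i - 0))"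
        by (rule tour_length_le_add[OF G])
      also have "\<dots> = 2 * (\<Sum>i\<in>{1..n}. norm (X n i \<omega>))" by (simp add: tour_length_def XI_def)
      finally show ?thesis .
    qed
    have int: "integrable (M n) (\<lambda>\<omega>. optimal_length n (XI n \<omega>))"
    proof (rule Bochner_Integration.integrable_bound[OF bound_int meas], rule AE_I2)
      fix \<omega>
      show "norm (optimal_length n (XI n \<omega>)) \<le> norm (2 * (\<Sum>i\<in>{1..n}. norm (X n i \<omega>)))"
        using order_trans[OF bound[of \<omega>] abs_ge_self] optimal_length_nonneg[OF n, of "XI n \<omega>"]
        unfolding real_norm_def by linarith
    qed
    have "(\<integral>\<^sup>+ x. ennreal (optimal_length n x) \<partial>PP n) = (\<integral>\<^sup>+ x. ennreal (optimal_length n x) \<partial>distr (M n) (PP n) (XI n))"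
      using XI_law[of n] n by simp
    also have "\<dots> = (\<integral>\<^sup>+ \<omega>. ennreal (optimal_length n (XI n \<omega>)) \<partial>M n)"
      by (rule nn_integral_distr[OF XI_m]) (simp add: O_m)
    also have "\<dots> = ennreal (\<integral>\<omega>. optimal_length n (XI n \<omega>) \<partial>M n)"
      using int optimal_length_nonneg[OF n] by (intro nn_integral_eq_integral AE_I2) auto
    finally show ?thesis by (simp add: inf_eq)
  qed
  obtain C0 N0 where C0: "C0 > 0"
    and opt: "\<And>n. n \<ge> N0 \<Longrightarrow> (\<integral>\<^sup>+ x. ennreal (optimal_length n x) \<partial>PP n) \<le> ennreal (C0 * (real n * \<alpha> n))"
    and N0: "N0 \<ge> 3"
  proof -
    obtain c where c: "c > 0" "eventually (\<lambda>n. norm (\<integral>\<omega>. (INF G\<in>hamiltonian_cycles n. tour_length (\<lambda>i. X n i \<omega>) G) \<partial>M n)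
        \<le> c * norm (real n powr ((real CARD('d) - 1) / real CARD('d)))) sequentially"
      using landau_o.bigE[OF optimal_length] by blast
    then obtain N1 where N1: "\<And>n. n \<ge> N1 \<Longrightarrow> norm (\<integral>\<omega>. (INF G\<in>hamiltonian_cycles n. tour_length (\<lambda>i. X n i \<omega>) G) \<partial>M n)
        \<le> c * norm (real n powr ((real CARD('d) - 1) / real CARD('d)))"
      by (auto simp: eventually_sequentially)
    show ?thesis
    proof (rule that[of c "max 3 N1"])
      fix n assume n: "n \<ge> max 3 N1"
      have "real n powr ((real CARD('d) - 1) / real CARD('d)) = real n powr (1 + - 1 / real d)"
        using d by (simp add: d_def diff_divide_distrib)
      also have "\<dots> = real n * \<alpha> n" unfolding powr_add \<alpha>_def using n by simp
      finally have "(\<integral>\<omega>. (INF G\<in>hamiltonian_cycles n. tour_length (\<lambda>i. X n i \<omega>) G) \<partial>M n) \<le> c * (real n * \<alpha> n)"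
        using N1[of n] n by (simp add: \<alpha>_def)
      thus "(\<integral>\<^sup>+ x. ennreal (optimal_length n x) \<partial>PP n) \<le> ennreal (c * (real n * \<alpha> n))"
        using n by (subst opt_eq) (auto intro: ennreal_leI)
    qed (use c in auto)
  qed
  show ?thesis
    unfolding stable_under_small_perturbations_def
  proof (intro conjI allI impI)
    show "finite {1..n}" "(\<Union>l\<in>{1..n}. {l}) = {1..n}" for n :: nat by auto
    fix \<epsilon> \<delta> :: real assume \<epsilon>: "\<epsilon> > 0" and \<delta>: "\<delta> > 0"
    \<comment> \<open>The nearest distances before and after resampling have total expectation at
      most 2 C0 n \<alpha>; exceeding \<open>C4\<close> n \<alpha> has probability at most \<delta>
      / 2.\<close>
    define C4 where "C4 = 4 * C0 / \<delta>"
    have C4: "C4 > 0" using C0 \<delta> by (simp add: C4_def)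
    \<comment> \<open>With t = g \<alpha> / 2 as threshold for one vertex, a total of C4 n \<alpha>
      allows at most \<epsilon> n / 2 bad vertices, and repair costs at most 2 t = g
      \<alpha>.\<close>
    define g where "g = 4 * C4 / \<epsilon>"
    have g: "g > 0" using C4 \<epsilon> by (simp add: g_def)
    obtain K N1 where K: "K > 0" and N1: "\<And>n. n \<ge> N1 \<Longrightarrow>
        emeasure (PP n) {x \<in> space (PP n). many_near_optimal n K (\<epsilon> / 2) (g * \<alpha> n) x} \<le> ennreal (\<delta> / 2)"
    proof -
      have "\<exists>K>0. \<exists>N. \<forall>n\<ge>N. emeasure (PiM {1..n} (\<lambda>_. P))
          {x \<in> space (PiM {1..n} (\<lambda>_. P)). many_near_optimal n K (\<epsilon> / 2) (g * real n powr (- 1 / DIM(real ^ 'd))) x}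
          \<le> ennreal (\<delta> / 2)"
        by (rule few_near_optimal[OF _ f_continuous C0, of N0])
          (use opt d \<epsilon> \<delta> g in \<open>auto simp: PP_def \<alpha>_def d_def\<close>)
      thus ?thesis using that unfolding PP_def \<alpha>_def DIM by blast
    qed
    obtain N2 where N2: "24 / \<epsilon> < real N2" using reals_Archimedean2 by blast
    define N where "N = max N0 (max N1 N2)"
    have "measure (M n) {\<omega> \<in> space (M n).
             (INF A \<in> {A. A \<subseteq> {1..n} \<and> real (card A) > (1 - \<epsilon>) * real (card {1..n})}.
                packing_number
                  ((\<lambda>l. optimal_tour n (override_on (\<lambda>i. X n i \<omega>) (\<lambda>i. Y n l i \<omega>) {l})) ` A)
                  (graph_dist n) \<epsilon>)
             \<ge> enat K} \<le> \<delta>" (is "measure _ ?E \<le> \<delta>") if nN: "n \<ge> N" for n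
    proof -
      interpret M: prob_space "M n" by (rule M_prob)
      have n: "n \<ge> 3" "n \<ge> N0" "n \<ge> N1" "24 / \<epsilon> \<le> n" using nN N0 N2 by (auto simp: N_def)
      have \<alpha>: "\<alpha> n > 0" using n by (simp add: \<alpha>_def)
      define XY where "XY = (\<lambda>l \<omega>. (XI n \<omega>)(l := YI n l \<omega> l))"
      \<comment> \<open>Resampling one point preserves the law, so the nearest distance of the
        resampled point has the same expectation as that of the original one, and
        \<open>sum_nearest_distance_le\<close> controls both halves.\<close>
      define Z where "Z = (\<lambda>\<omega>. \<Sum>l\<in>{1..n}. ennreal (nearest_distance n (XI n \<omega>) l) + ennreal (nearest_distance n (XY l \<omega>) l))"
      have nd_m: "(\<lambda>x. ennreal (nearest_distance n x l)) \<in> borel_measurable (PP n)" if "l \<in> {1..n}" for l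
        unfolding PP_def by (rule measurable_compose[OF nearest_distance_measurable[OF that] measurable_ennreal])
      have X_m: "(\<lambda>\<omega>. ennreal (nearest_distance n (XI n \<omega>) l)) \<in> borel_measurable (M n)" if "l \<in> {1..n}" for l
        by (rule measurable_compose[OF XI_m nd_m[OF that]])
      have XY_m': "XY l \<in> measurable (M n) (PP n)" if "l \<in> {1..n}" for l
        unfolding XY_def using XY_m[of n l] that n by simp
      have XYn_m: "(\<lambda>\<omega>. ennreal (nearest_distance n (XY l \<omega>) l)) \<in> borel_measurable (M n)" if "l \<in> {1..n}" for l
        by (rule measurable_compose[OF XY_m'[OF that] nd_m[OF that]])
      have Z_m: "Z \<in> borel_measurable (M n)"
        unfolding Z_def by (intro borel_measurable_sum borel_measurable_add X_m XYn_m)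
      have X_int: "(\<integral>\<^sup>+ \<omega>. ennreal (nearest_distance n (XI n \<omega>) l) \<partial>M n) = (\<integral>\<^sup>+ x. ennreal (nearest_distance n x l) \<partial>PP n)"
        if "l \<in> {1..n}" for l
        using nn_integral_distr[OF XI_m[of n], of "\<lambda>x. ennreal (nearest_distance n x l)"] nd_m[OF that] XI_law[of n] n
        by simp
      have XY_int: "(\<integral>\<^sup>+ \<omega>. ennreal (nearest_distance n (XY l \<omega>) l) \<partial>M n) = (\<integral>\<^sup>+ x. ennreal (nearest_distance n x l) \<partial>PP n)"
        if "l \<in> {1..n}" for l
        using nn_integral_distr[OF XY_m'[OF that], of "\<lambda>x. ennreal (nearest_distance n x l)"] nd_m[OF that]
          XY_law[of n l] that n
        by (simp add: XY_def)
      have sum_le: "(\<Sum>l\<in>{1..n}. \<integral>\<^sup>+ x. ennreal (nearest_distance n x l) \<partial>PP n) \<le> ennreal (C0 * (n * \<alpha> n))"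
      proof -
        have "(\<Sum>l\<in>{1..n}. \<integral>\<^sup>+ x. ennreal (nearest_distance n x l) \<partial>PP n)
            = (\<integral>\<^sup>+ x. (\<Sum>l\<in>{1..n}. ennreal (nearest_distance n x l)) \<partial>PP n)"
          by (rule nn_integral_sum[symmetric]) (rule nd_m)
        also have "\<dots> \<le> (\<integral>\<^sup>+ x. ennreal (optimal_length n x) \<partial>PP n)"
        proof (rule nn_integral_mono)
          fix x :: "nat \<Rightarrow> real ^ 'd"
          have "(\<Sum>l\<in>{1..n}. ennreal (nearest_distance n x l)) = ennreal (\<Sum>l\<in>{1..n}. nearest_distance n x l)"
            by (rule sum_ennreal) (rule nearest_distance_nonneg[OF n(1)])
          also have "\<dots> \<le> ennreal (optimal_length n x)" by (intro ennreal_leI sum_nearest_distance_le[OF n(1)])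
          finally show "(\<Sum>l\<in>{1..n}. ennreal (nearest_distance n x l)) \<le> ennreal (optimal_length n x)" .
        qed
        also have "\<dots> \<le> ennreal (C0 * (n * \<alpha> n))" by (rule opt[OF n(2)])
        finally show ?thesis .
      qed
      have Z_int: "(\<integral>\<^sup>+ \<omega>. Z \<omega> \<partial>M n) \<le> ennreal (2 * (C0 * (n * \<alpha> n)))"
      proof -
        have "(\<integral>\<^sup>+ \<omega>. Z \<omega> \<partial>M n) = (\<Sum>l\<in>{1..n}. \<integral>\<^sup>+ \<omega>. ennreal (nearest_distance n (XI n \<omega>) l) + ennreal (nearest_distance n (XY l \<omega>) l) \<partial>M n)"
          unfolding Z_def by (intro nn_integral_sum borel_measurable_add X_m XYn_m)
        also have "\<dots> = (\<Sum>l\<in>{1..n}. (\<integral>\<^sup>+ x. ennreal (nearest_distance n x l) \<partial>PP n) + (\<integral>\<^sup>+ x. ennreal (nearest_distance n x l) \<partial>PP n))"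
          using X_m XYn_m by (intro sum.cong refl) (simp add: nn_integral_add X_int XY_int)
        also have "\<dots> \<le> ennreal (C0 * (n * \<alpha> n)) + ennreal (C0 * (n * \<alpha> n))"
          unfolding sum.distrib by (intro add_mono sum_le)
        also have "\<dots> = ennreal (2 * (C0 * (n * \<alpha> n)))"
          using C0 \<alpha> by (subst ennreal_plus[symmetric]) auto
        finally show ?thesis .
      qed
      define E1 where "E1 = {\<omega> \<in> space (M n). ennreal (C4 * (n * \<alpha> n)) < Z \<omega>}"
      define many where "many = {x \<in> space (PP n). many_near_optimal n K (\<epsilon> / 2) (g * \<alpha> n) x}"
      define E2 where "E2 = XI n -` many \<inter> space (M n)"
      have many_s: "many \<in> sets (PP n)"
        unfolding many_def PP_def using many_near_optimal_measurable[of n K "\<epsilon> / 2" "g * \<alpha> n"] by (simp add: pred_def)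
      have E_s: "E1 \<in> sets (M n)" "E2 \<in> sets (M n)"
        unfolding E1_def E2_def using Z_m measurable_sets[OF XI_m many_s] by auto
      have eE1: "emeasure (M n) E1 \<le> ennreal (\<delta> / 2)"
        unfolding E1_def by (rule emeasure_gt_le_real[OF Z_m _ Z_int]) (use C0 C4 \<delta> \<alpha> n in \<open>auto simp: C4_def\<close>)
      have eE2: "emeasure (M n) E2 \<le> ennreal (\<delta> / 2)"
      proof -
        have "emeasure (M n) E2 = emeasure (distr (M n) (PP n) (XI n)) many"
          unfolding E2_def by (rule emeasure_distr[symmetric, OF XI_m many_s])
        also have "\<dots> = emeasure (PP n) many" using XI_law[of n] n by simp
        also have "\<dots> \<le> ennreal (\<delta> / 2)" unfolding many_def by (rule N1[OF n(3)])
        finally show ?thesis .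
      qed
      have "?E \<subseteq> E1 \<union> E2"
      proof
        fix \<omega> assume \<omega>: "\<omega> \<in> ?E"
        show "\<omega> \<in> E1 \<union> E2"
        proof (cases "\<omega> \<in> E1")
          case False
          define x where "x = (\<lambda>i. X n i \<omega>)"
          define z where "z = (\<lambda>l. override_on x (\<lambda>i. Y n l i \<omega>) {l})"
          define t where "t = g * \<alpha> n / 2"
          have t: "t > 0" using g \<alpha> by (simp add: t_def)
          define dd where "dd = (\<lambda>l. nearest_distance n x l + nearest_distance n (z l) l)"
          have dd: "dd l \<ge> 0" for l 
            using nearest_distance_nonneg[OF n(1), of x l] nearest_distance_nonneg[OF n(1), of "z l" l]
            by (simp add: dd_def)
          have "Z \<omega> = (\<Sum>l\<in>{1..n}. ennreal (dd l))"
            unfolding Z_def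
          proof (rule sum.cong)
            fix l assume l: "l \<in> {1..n}"
            have "nearest_distance n (XI n \<omega>) l = nearest_distance n x l"
              by (rule nearest_distance_cong[OF _ l]) (simp add: XI_def x_def)
            moreover have "nearest_distance n (XY l \<omega>) l = nearest_distance n (z l) l"
              by (rule nearest_distance_cong[OF _ l]) (auto simp: XY_def XI_def YI_def x_def z_def override_on_def)
            ultimately show "ennreal (nearest_distance n (XI n \<omega>) l) + ennreal (nearest_distance n (XY l \<omega>) l) = ennreal (dd l)"
              
              using nearest_distance_nonneg[OF n(1), of x l] nearest_distance_nonneg[OF n(1), of "z l" l]
              by (simp add: dd_def ennreal_plus)
          qed simp
          also have "\<dots> = ennreal (\<Sum>l\<in>{1..n}. dd l)" by (rule sum_ennreal) (rule dd)
          finally have "ennreal (\<Sum>l\<in>{1..n}. dd l) \<le> ennreal (C4 * (n * \<alpha> n))"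
            using False \<omega> by (simp add: E1_def not_less)
          hence sum_dd: "(\<Sum>l\<in>{1..n}. dd l) \<le> C4 * (n * \<alpha> n)"
            using C4 \<alpha> by (subst (asm) ennreal_le_iff) auto
          define bad where "bad = {l \<in> {1..n}. dd l > t}"
          have "card bad * t = (\<Sum>l\<in>bad. t)" by simp
          also have "\<dots> \<le> (\<Sum>l\<in>bad. dd l)" by (intro sum_mono) (simp add: bad_def)
          also have "\<dots> \<le> (\<Sum>l\<in>{1..n}. dd l)" using dd by (intro sum_mono2) (auto simp: bad_def)
          also have "\<dots> \<le> C4 * (n * \<alpha> n)" by (rule sum_dd)
          also have "\<dots> = (\<epsilon> * n / 2) * t" using \<epsilon> by (simp add: t_def g_def)
          finally have "card bad \<le> \<epsilon> * n / 2" using t by simp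
          moreover have "\<epsilon> * n / 2 < \<epsilon> * n" using \<epsilon> n by simp
          ultimately have few: "card bad < \<epsilon> * n" by linarith
          have "many_near_optimal n K (\<epsilon> / 2) (2 * t) x"
          proof (rule many_near_optimal_of_packing[OF n(1) n(4) \<epsilon> K])
            show "card {l \<in> {1..n}. t < nearest_distance n x l + nearest_distance n (z l) l} < \<epsilon> * n"
              using few by (simp add: bad_def dd_def)
            show "z l i = x i" if "l \<in> {1..n}" "i \<in> {1..n} - {l}" for l i
              using that by (simp add: z_def)
            show "enat K \<le> (INF A \<in> {A. A \<subseteq> {1..n} \<and> real (card A) > (1 - \<epsilon>) * real (card {1..n})}.
               packing_number ((\<lambda>l. optimal_tour n (z l)) ` A) (graph_dist n) \<epsilon>)"
              using \<omega> by (simp add: z_def x_def)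
          qed
          hence "many_near_optimal n K (\<epsilon> / 2) (g * \<alpha> n) (XI n \<omega>)"
            by (subst many_near_optimal_cong[of n _ x]) (auto simp: XI_def x_def t_def)
          moreover have "XI n \<omega> \<in> space (PP n)" using measurable_space[OF XI_m] \<omega> by auto
          ultimately show ?thesis using \<omega> by (simp add: E2_def many_def)
        qed simp
      qed
      \<comment> \<open>Monotonicity asks only the covering set \<open>E1 \<union> E2\<close> to be
        measurable.\<close>
      hence "emeasure (M n) ?E \<le> emeasure (M n) (E1 \<union> E2)" using E_s by (intro emeasure_mono) auto
      also have "\<dots> \<le> emeasure (M n) E1 + emeasure (M n) E2" using E_s by (intro emeasure_subadditive)
      also have "\<dots> \<le> ennreal (\<delta> / 2) + ennreal (\<delta> / 2)" by (intro add_mono eE1 eE2)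
      also have "\<dots> = ennreal \<delta>" using \<delta> by (subst ennreal_plus[symmetric]) auto
      finally show "measure (M n) ?E \<le> \<delta>" unfolding measure_def using \<delta> by (intro enn2real_leI) auto
    qed
    hence ev: "eventually (\<lambda>n. ereal (measure (M n) {\<omega> \<in> space (M n).
             (INF A \<in> {A. A \<subseteq> {1..n} \<and> real (card A) > (1 - \<epsilon>) * real (card {1..n})}.
                packing_number
                  ((\<lambda>l. optimal_tour n (override_on (\<lambda>i. X n i \<omega>) (\<lambda>i. Y n l i \<omega>) {l})) ` A)
                  (graph_dist n) \<epsilon>)
             \<ge> enat K}) \<le> ereal \<delta>) sequentially"
      unfolding eventually_sequentially by (intro exI[of _ N]) simp
    show "\<exists>K::nat. limsup (\<lambda>n. ereal (measure (M n) {\<omega> \<in> space (M n).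
             (INF A \<in> {A. A \<subseteq> {1..n} \<and> real (card A) > (1 - \<epsilon>) * real (card {1..n})}.
                packing_number
                  ((\<lambda>l. optimal_tour n (override_on (\<lambda>i. X n i \<omega>) (\<lambda>i. Y n l i \<omega>) {l})) ` A)
                  (graph_dist n) \<epsilon>)
             \<ge> enat K})) \<le> ereal \<delta>"
      by (rule exI[of _ K]) (rule Limsup_bounded[OF ev])
  qed
qed

end
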